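(* (1) For each $\kappa\in\mathbb{Z}\setminus\{4\}$, the set of primes $p>3$ for which $\mathcal{G}_\kappa(p)$ contains at least four mutually vertex-disjoint subdivisions of $K_{3,3}$ is infinite and has natural density at least $1/4$ if $\kappa=2$ and at least $1/2$ otherwise. Furthermore, if $\kappa$ is such that none of $4\kappa-7$, $16\kappa^2-68\kappa+41$ and $5$ is a square in $\mathbb{Z}$ and the ratio of any two of them is not a square in $\mathbb{Q}$, then this set of primes has natural density at least $5/8$. (2) The set of $\kappa\in\mathbb{Z}\setminus\{4\}$ satisfying the hypothesis of the latter assertion of (1) has natural density $1$ (i.e. their proportion among integers $\kappa$ with $|\kappa|\le x$ tends to $1$ as $x\to\infty$).
   Context: For a prime $p>3$, $\kappa$ is regarded in $\mathbb{F}_p$, $\mathcal{M}_\kappa(p)=\{(x,y,z)\in\mathbb{F}_p^3 : x^2+y^2+z^2=xyz+\kappa\}$, Vieta involutions $R_1(x,y,z)=(yz-x,y,z)$, $R_2(x,y,z)=(x,zx-y,z)$, $R_3(x,y,z)=(x,y,xy-z)$, and $\mathcal{G}_\kappa(p)$ is the $3$-regular graph (possibly with loops) on $\mathcal{M}_\kappa(p)$ with an edge joining $X$ and $R_i(X)$ for each vertex $X$ and each $i$. "Natural density at least $c$" for a set of primes $S$ means $\liminf_{x\to\infty}\#\{p\le x: p\in S\}/\#\{p\le x\}\ge c$. *)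

theory Defs
  imports
    Graph_Theory.Kuratowski
    "HOL-Computational_Algebra.Nth_Powers"
    "HOL-Number_Theory.Cong"
    "HOL-Library.Extended_Real"
    "HOL-Library.Liminf_Limsup"
begin

section \<open>The Markoff graph modulo a prime\<close>

text \<open>The field with \<open>p\<close> elements is represented by the residues \<open>0, \<dots>, p - 1\<close>.\<close>

type_synonym triple = "int \<times> int \<times> int"

definition markoff_surface :: "int \<Rightarrow> nat \<Rightarrow> triple set" where
  "markoff_surface \<kappa> p =
    {(x, y, z). x \<in> {0..<int p} \<and> y \<in> {0..<int p} \<and> z \<in> {0..<int p} \<and>
       [x^2 + y^2 + z^2 = x * y * z + \<kappa>] (mod int p)}"

datatype coord = C1 | C2 | C3

fun vieta :: "nat \<Rightarrow> coord \<Rightarrow> triple \<Rightarrow> triple" where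
  "vieta p C1 (x, y, z) = ((y * z - x) mod int p, y, z)"
| "vieta p C2 (x, y, z) = (x, (z * x - y) mod int p, z)"
| "vieta p C3 (x, y, z) = (x, y, (x * y - z) mod int p)"

text \<open>
  Undirected graphs are modelled as symmetric digraphs. Every vertex \<open>X\<close> has exactly one
  outgoing arc \<open>(X, i)\<close> for each of the three involutions; the reverse of \<open>(X, i)\<close> is
  \<open>(vieta p i X, i)\<close>, and a fixed point of an involution carries a loop, which counts
  once in the degree.
\<close>

definition markoff_graph :: "int \<Rightarrow> nat \<Rightarrow> (triple, triple \<times> coord) pre_digraph" where
  "markoff_graph \<kappa> p =
    \<lparr> verts = markoff_surface \<kappa> p,
      arcs = markoff_surface \<kappa> p \<times> UNIV,
      tail = fst,
      head = (\<lambda>(X, i). vieta p i X) \<rparr>"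

lemma vieta_cong:
  fixes x y z \<kappa> m :: int
  assumes "[x^2 + y^2 + z^2 = x * y * z + \<kappa>] (mod m)"
  shows "[((y * z - x) mod m)^2 + y^2 + z^2 = ((y * z - x) mod m) * y * z + \<kappa>] (mod m)"
proof -
  have "(y * z - x)^2 + y^2 + z^2 - ((y * z - x) * y * z + \<kappa>)
      = x^2 + y^2 + z^2 - (x * y * z + \<kappa>)"
    by (simp add: algebra_simps power2_eq_square)
  with assms have "[(y * z - x)^2 + y^2 + z^2 = (y * z - x) * y * z + \<kappa>] (mod m)"
    by (simp only: cong_iff_dvd_diff)
  moreover have "[(w mod m)^2 + y^2 + z^2 = w^2 + y^2 + z^2] (mod m)"
    and "[(w mod m) * y * z + \<kappa> = w * y * z + \<kappa>] (mod m)" for w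
    by (intro cong_add cong_mult cong_pow cong_refl; simp)+
  ultimately show ?thesis
    by (meson cong_sym cong_trans)
qed

lemma vieta_in_markoff_surface:
  assumes "X \<in> markoff_surface \<kappa> p"
  shows "vieta p i X \<in> markoff_surface \<kappa> p"
proof -
  obtain x y z where X: "X = (x, y, z)"
    by (cases X)
  have eq: "[x^2 + y^2 + z^2 = x * y * z + \<kappa>] (mod int p)"
    and rng: "x \<in> {0..<int p}" "y \<in> {0..<int p}" "z \<in> {0..<int p}"
    using assms by (auto simp: X markoff_surface_def)
  show ?thesis
    using rng vieta_cong[of x y z \<kappa> "int p"] vieta_cong[of y z x \<kappa> "int p"]
      vieta_cong[of z x y \<kappa> "int p"] eq
    by (cases i) (simp_all add: X markoff_surface_def ac_simps)
qed

lemma wf_digraph_markoff_graph: "wf_digraph (markoff_graph \<kappa> p)"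
  by unfold_locales (auto simp: markoff_graph_def vieta_in_markoff_surface)

section \<open>Disjoint subdivisions of the complete bipartite graph on 3 + 3 vertices\<close>

definition is_K33_subdivision :: "('a, 'b) pre_digraph \<Rightarrow> bool" where
  "is_K33_subdivision H \<longleftrightarrow>
    (\<exists>K rev_K rev_H. subdivision (K, rev_K) (H, rev_H) \<and> K\<^bsub>3,3\<^esub> K)"

text \<open>
  The library's \<^const>\<open>subdivision\<close> relates digraphs with the same tail and head functions, so
  an arc type in which any two vertices can be joined is needed to speak about the
  unsubdivided graph. Therefore subgraphs are taken in \<^const>\<open>mk_symmetric\<close> \<open>G\<close>, whose arcs are the
  ordered pairs of adjacent vertices of \<open>G\<close>. This forgets only the
  multiplicity of edges, and a subdivision of a simple graph is again simple.
\<close>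

definition has_disjoint_K33_subdivisions :: "nat \<Rightarrow> ('a, 'b) pre_digraph \<Rightarrow> bool" where
  "has_disjoint_K33_subdivisions n G \<longleftrightarrow>
    (\<exists>H :: nat \<Rightarrow> ('a, 'a \<times> 'a) pre_digraph.
       (\<forall>i<n. subgraph (H i) (with_proj (mk_symmetric G)) \<and> is_K33_subdivision (H i)) \<and>
       (\<forall>i<n. \<forall>j<n. i \<noteq> j \<longrightarrow> verts (H i) \<inter> verts (H j) = {}))"

definition K33_primes :: "int \<Rightarrow> nat set" where
  "K33_primes \<kappa> = {p. prime p \<and> p > 3 \<and> has_disjoint_K33_subdivisions 4 (markoff_graph \<kappa> p)}"

section \<open>Densities and the genericity condition\<close>

definition prime_density_at_least :: "nat set \<Rightarrow> real \<Rightarrow> bool" where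
  "prime_density_at_least S c \<longleftrightarrow>
    Liminf at_top (\<lambda>x :: real. ereal
      (real (card {p. prime p \<and> real p \<le> x \<and> p \<in> S}) / real (card {p :: nat. prime p \<and> real p \<le> x})))
    \<ge> ereal c"

definition int_density_one :: "int set \<Rightarrow> bool" where
  "int_density_one A \<longleftrightarrow>
    ((\<lambda>x :: real. real (card {k \<in> A. \<bar>real_of_int k\<bar> \<le> x}) / real (card {k :: int. \<bar>real_of_int k\<bar> \<le> x}))
      \<longlongrightarrow> 1) at_top"

text \<open>
  ``Any two'' refers to positions: if two of the three numbers coincide, their ratio
  is the square 1 and the condition fails. The denominators are nonzero because 0 is a square.
\<close>

definition generic_kappa :: "int \<Rightarrow> bool" where
  "generic_kappa \<kappa> \<longleftrightarrow>
    (let a = 4 * \<kappa> - 7; b = 16 * \<kappa>^2 - 68 * \<kappa> + 41; c = 5 in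
      \<not> is_square a \<and> \<not> is_square b \<and> \<not> is_square c \<and>
      \<not> is_square (rat_of_int a / rat_of_int b) \<and>
      \<not> is_square (rat_of_int a / rat_of_int c) \<and>
      \<not> is_square (rat_of_int b / rat_of_int c))"

end

theory Submission
  imports
    Defs
    "HOL-Complex_Analysis.Complex_Analysis"
    "HOL-Number_Theory.Number_Theory"
    "HOL-Real_Asymp.Real_Asymp"
    "HOL-Computational_Algebra.Squarefree"
begin

text \<open>
  A sequence \<open>s\<close> over the field with \<open>s\<^sub>n\<^sub>+\<^sub>2 = s\<^sub>1 s\<^sub>n\<^sub>+\<^sub>1 - s\<^sub>n\<close> and \<open>s\<^sub>n\<^sub>+\<^sub>N = - s\<^sub>n\<close> such that
  \<open>(s\<^sub>1, s\<^sub>0, s\<^sub>1)\<close> lies on the surface yields three closed walks of length \<open>2 N\<close> in the Markoff graph,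
  along which the first coordinate is \<open>s\<^sub>1\<close>, the second is \<open>s\<^sub>1\<close>, and the third is \<open>- s\<^sub>1\<close>
  respectively. For \<open>N = 3\<close> and \<open>N = 5\<close> their union contains a subdivision of the complete bipartite
  graph on 3 + 3 vertices, and the double sign changes move it to four disjoint copies.
  The case \<open>N = 3\<close> needs \<open>s\<^sub>1 = 1\<close> and \<open>s\<^sub>0\<^sup>2 - s\<^sub>0 + 2 = \<kappa>\<close>, so that \<open>4 \<kappa> - 7\<close> must be a square modulo \<open>p\<close>.
  The case \<open>N = 5\<close> needs \<open>s\<^sub>1 = w\<close> with \<open>w\<^sup>2 = w + 1\<close> and \<open>4 \<kappa> - 6 - 5 w\<close> a square; the product of
  the latter with its conjugate is \<open>16 \<kappa>\<^sup>2 - 68 \<kappa> + 41\<close>, so if this is a nonresidue then one of the two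
  choices of \<open>w\<close> works.

  The densities come from the prime number theorem for real characters: Newman's Tauberian theorem,
  applied to \<open>1 / L(s, \<psi>)\<close>, gives the convergence of \<open>\<Sum> \<mu>(n) \<psi>(n) / n\<close>, and the hyperbola method
  carries this over to \<open>\<psi>(n) \<Lambda>(n)\<close>.

  The exceptional \<open>\<kappa>\<close> are \<open>O(\<surd>x)\<close> in number because they come from squares, up to finitely many
  factors, and from a Pell equation, whose solutions grow geometrically.
\<close>

section \<open>Subdivisions from systems of paths\<close>

text \<open>With one coordinate fixed at s_1, the involutions of the other two run through a linear
  recurrence with characteristic roots \<zeta> and 1 / \<zeta>, where \<zeta> + 1 / \<zeta> = s_1.
  The sign change after N steps means \<zeta>^N = -1: a primitive sixth root of unity gives s_1 = 1,
  a primitive tenth root gives the two roots of w^2 = w + 1. The parameter 2 stands apart because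
  there 4 \<kappa> - 7 = 1 is a square, but the hexagon degenerates for every prime; only decagons
  remain, and they ask for two independent symbol values, hence 1/4. In the generic case decagons
  succeed for a quarter of the half of the primes that hexagons miss: 1/2 + 1/8 = 5/8. Natural
  density needs L to be non-zero on the whole line Re s = 1, not only at 1. The inverse 1 / L is
  preferred to the logarithmic derivative because the Tauberian theorem wants bounded coefficients,
  which \<mu> has and \<Lambda> has not. All discriminants are 1 modulo 4, so their symbols are
  characters of odd modulus in \<open>p\<close> and the prime 2 never enters reciprocity.\<close>

definition path_arcs :: "'a list \<Rightarrow> ('a \<times> 'a) set" where
  "path_arcs xs = set (zip xs (tl xs)) \<union> (set (zip xs (tl xs)))\<inverse>"

lemma path_arcs_Cons_Cons:
  "path_arcs (x # y # xs) = {(x, y), (y, x)} \<union> path_arcs (y # xs)"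
  by (auto simp: path_arcs_def)

text \<open>The library inserts one vertex into one edge at a time. Once the first inner vertex
  \<open>w\<close> is in place, the edge from \<open>w\<close> to \<open>v\<close> remains to be
  subdivided, so the induction moves \<open>u\<close> and \<open>H\<close> and keeps
  \<open>v\<close>.\<close>

lemma subdivision_pair_path:
  fixes H :: "'a pair_pre_digraph"
  assumes "subdivision_pair K H" "(u, v) \<in> parcs H" "distinct ws" "set ws \<inter> pverts H = {}"
  shows "\<exists>H'. subdivision_pair K H' \<and> pverts H' = pverts H \<union> set ws \<and>
    parcs H' = (parcs H - {(u, v), (v, u)}) \<union> path_arcs (u # ws @ [v])"
  using assms
proof (induction ws arbitrary: u H)
  case Nil
  interpret pair_bidirected_digraph H
    using Nil.prems(1) by (rule bidirected_digraphI_subdivision)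
  have "(v, u) \<in> parcs H" using Nil.prems(2) by (rule arcs_symmetric)
  with Nil.prems show ?case by (intro exI[of _ H]) (auto simp: path_arcs_def)
next
  case (Cons w ws)
  interpret pair_bidirected_digraph H
    using Cons.prems(1) by (rule bidirected_digraphI_subdivision)
  let ?H = "subdivide H (u, v) w"
  have "u \<in> pverts H" "v \<in> pverts H"
    using Cons.prems(2) in_arcsD1 in_arcsD2 by blast+
  have w: "w \<notin> pverts H" using Cons.prems by auto
  then have wa: "(w, x) \<notin> parcs H" "(x, w) \<notin> parcs H" for x
    using in_arcsD1 in_arcsD2 by blast+
  have "u \<noteq> v" using Cons.prems(2) no_loops' by blast
  have "subdivision_pair K ?H"
    using Cons.prems w by (intro subdivision_pair_divide)
  then obtain H' where H': "subdivision_pair K H'" "pverts H' = pverts ?H \<union> set ws"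
    "parcs H' = (parcs ?H - {(w, v), (v, w)}) \<union> path_arcs (w # ws @ [v])"
    using Cons.IH[of ?H w] Cons.prems by auto
  have "parcs H' = (parcs H - {(u, v), (v, u)}) \<union> path_arcs (u # (w # ws) @ [v])"
    unfolding H'(3) using wa \<open>u \<noteq> v\<close> \<open>u \<in> _\<close> \<open>v \<in> _\<close> w
    by (auto simp: path_arcs_Cons_Cons)
  with H' show ?case by (intro exI[of _ H']) auto
qed

text \<open>The edges of \<open>K\<close> are replaced one after the other. The next edge must still
  be present and must not also be an arc of an inserted path; the distinct end pairs and the fresh
  inner vertices guarantee this.\<close>

lemma subdivision_pair_paths:
  fixes K :: "'a pair_pre_digraph"
  assumes "pair_bidirected_digraph K"
    and "\<And>u ws v. (u, ws, v) \<in> set ps \<Longrightarrow> (u, v) \<in> parcs K"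
    and "distinct (concat (map (\<lambda>(u, ws, v). ws) ps))"
    and "\<And>u ws v. (u, ws, v) \<in> set ps \<Longrightarrow> set ws \<inter> pverts K = {}"
    and "distinct (map (\<lambda>(u, ws, v). {u, v}) ps)"
  shows "\<exists>H. subdivision_pair K H \<and> pverts H = pverts K \<union> (\<Union>(u, ws, v)\<in>set ps. set ws) \<and>
    parcs H = (parcs K - (\<Union>(u, ws, v)\<in>set ps. {(u, v), (v, u)})) \<union>
      (\<Union>(u, ws, v)\<in>set ps. path_arcs (u # ws @ [v]))"
  using assms
proof (induction ps)
  case Nil
  then show ?case using subdivision_pair_base by auto
next
  case (Cons p ps)
  obtain u ws v where p: "p = (u, ws, v)" by (cases p)
  interpret K: pair_bidirected_digraph K by fact
  have "\<exists>H. subdivision_pair K H \<and> pverts H = pverts K \<union> (\<Union>(u, ws, v)\<in>set ps. set ws) \<and>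
    parcs H = (parcs K - (\<Union>(u, ws, v)\<in>set ps. {(u, v), (v, u)})) \<union>
      (\<Union>(u, ws, v)\<in>set ps. path_arcs (u # ws @ [v]))"
  proof (rule Cons.IH[OF Cons.prems(1)])
    show "distinct (concat (map (\<lambda>(u, ws, v). ws) ps))" "distinct (map (\<lambda>(u, ws, v). {u, v}) ps)"
      using Cons.prems(3,5) by simp_all
    show "(a, c) \<in> parcs K" "set bs \<inter> pverts K = {}" if "(a, bs, c) \<in> set ps" for a bs c
      using Cons.prems(2,4)[of a bs c] that by simp_all
  qed
  then obtain H where H: "subdivision_pair K H" "pverts H = pverts K \<union> (\<Union>(u, ws, v)\<in>set ps. set ws)"
    "parcs H = (parcs K - (\<Union>(u, ws, v)\<in>set ps. {(u, v), (v, u)})) \<union>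
      (\<Union>(u, ws, v)\<in>set ps. path_arcs (u # ws @ [v]))" by blast
  have uvK: "(u, v) \<in> parcs K" using Cons.prems(2) p by auto
  then have uv: "u \<in> pverts K" "v \<in> pverts K" "u \<noteq> v"
    using K.in_arcsD1 K.in_arcsD2 K.no_loops' by blast+
  have new: "{u, v} \<noteq> {a, c}" if "(a, bs, c) \<in> set ps" for a bs c
  proof -
    have "{u, v} \<notin> (\<lambda>(u, ws, v). {u, v}) ` set ps"
      using Cons.prems(5) by (simp add: p)
    moreover have "{a, c} \<in> (\<lambda>(u, ws, v). {u, v}) ` set ps"
      using that by (intro image_eqI[of _ _ "(a, bs, c)"]) simp_all
    ultimately show ?thesis by metis
  qed
  \<comment> \<open>An arc of an inserted path touches an inner vertex unless the path is a single
    edge. Neither \<open>u\<close> nor \<open>v\<close> is an inner vertex, and a single edge has a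
    different pair of ends.\<close>
  have not_path: "(u, v) \<notin> path_arcs (a # bs @ [c]) \<and> (v, u) \<notin> path_arcs (a # bs @ [c])"
    if abc: "(a, bs, c) \<in> set ps" for a bs c
  proof -
    have "set bs \<inter> pverts K = {}" using Cons.prems(4)[of a bs c] abc by auto
    then have ub: "u \<notin> set bs" "v \<notin> set bs" using uv by auto
    show ?thesis
    proof (cases bs)
      case Nil
      then show ?thesis using new[OF abc] by (auto simp: path_arcs_def)
    next
      case (Cons b bs')
      show ?thesis
      proof (rule ccontr)
        assume "\<not> ?thesis"
        then obtain x y where xy: "{x, y} = {u, v}" "(x, y) \<in> set (zip (a # bs @ [c]) (bs @ [c]))"
          by (auto simp: path_arcs_def)
        then obtain i where i: "i < length (bs @ [c])" "x = (a # bs @ [c]) ! i" "y = (bs @ [c]) ! i"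
          by (auto simp: set_zip)
        have "x \<notin> set bs" "y \<notin> set bs" using ub xy by (auto simp: doubleton_eq_iff)
        then have "\<not> i < length bs" using i(3) by (auto simp: nth_append)
        then have "i = length bs" using i by simp
        then have "x = (a # bs) ! length bs" using i(2) nth_append[of "a # bs" "[c]"] by simp
        also have "\<dots> = last bs" using Cons by (simp add: last_conv_nth)
        finally show False using \<open>x \<notin> set bs\<close> Cons last_in_set[of bs] by simp
      qed
    qed
  qed
  have "(u, v) \<in> parcs H"
    unfolding H(3) using uvK new by (auto simp: doubleton_eq_iff)
  moreover have "set ws \<inter> pverts H = {}"
  proof -
    have "set ws \<inter> pverts K = {}" using Cons.prems(4)[of u ws v] p by simp
    moreover have "set ws \<inter> (\<Union>(u, ws, v)\<in>set ps. set ws) = {}"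
      using Cons.prems(3) by (simp add: p case_prod_unfold)
    ultimately show ?thesis unfolding H(2) by blast
  qed
  moreover have "distinct ws" using Cons.prems(3) p by simp
  ultimately obtain H' where H': "subdivision_pair K H'" "pverts H' = pverts H \<union> set ws"
    "parcs H' = (parcs H - {(u, v), (v, u)}) \<union> path_arcs (u # ws @ [v])"
    using subdivision_pair_path[OF H(1)] by blast
  have "parcs H' = (parcs K - (\<Union>(u, ws, v)\<in>set (p # ps). {(u, v), (v, u)})) \<union>
      (\<Union>(u, ws, v)\<in>set (p # ps). path_arcs (u # ws @ [v]))"
  proof -
    define P Q where "P = (\<Union>(u, ws, v)\<in>set ps. {(u, v), (v, u)})"
      and "Q = (\<Union>(u, ws, v)\<in>set ps. path_arcs (u # ws @ [v]))"
    have "{(u, v), (v, u)} \<inter> Q = {}" using not_path by (auto simp: Q_def)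
    then have "parcs H' = (parcs K - ({(u, v), (v, u)} \<union> P)) \<union> (path_arcs (u # ws @ [v]) \<union> Q)"
      unfolding H'(3) H(3) P_def[symmetric] Q_def[symmetric] by blast
    then show ?thesis by (simp add: p P_def Q_def)
  qed
  with H' H(2) p show ?case by (intro exI[of _ H']) auto
qed

text \<open>Every edge of \<open>K\<close> joins the ends of one of the nine paths, so the only arcs
  of the subdivision are those of the paths, and these lie in \<open>E\<close>.\<close>

lemma K33_subdivision_of_paths:
  fixes E :: "('a \<times> 'a) set"
  assumes ab: "distinct [a0, a1, a2, b0, b1, b2]"
    and ps: "map (\<lambda>(u, ws, v). (u, v)) ps =
      [(a0, b0), (a0, b1), (a0, b2), (a1, b0), (a1, b1), (a1, b2), (a2, b0), (a2, b1), (a2, b2)]"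
    and ws: "distinct (concat (map (\<lambda>(u, ws, v). ws) ps))"
    and inner: "\<And>u ws v. (u, ws, v) \<in> set ps \<Longrightarrow> set ws \<inter> {a0, a1, a2, b0, b1, b2} = {}"
    and E: "\<And>u ws v. (u, ws, v) \<in> set ps \<Longrightarrow> path_arcs (u # ws @ [v]) \<subseteq> E"
  shows "\<exists>H. is_K33_subdivision (with_proj H) \<and> pair_wf_digraph H \<and> parcs H \<subseteq> E \<and>
    pverts H = {a0, a1, a2, b0, b1, b2} \<union> (\<Union>(u, ws, v)\<in>set ps. set ws)"
proof -
  define U V where "U = {a0, a1, a2}" and "V = {b0, b1, b2}"
  define K where "K = \<lparr>pverts = U \<union> V, parcs = U \<times> V \<union> V \<times> U\<rparr>"
  have UV: "U \<inter> V = {}" "card U = 3" "card V = 3" using ab by (auto simp: U_def V_def)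
  have K33: "K\<^bsub>3,3\<^esub> (with_proj K)"
    unfolding complete_bipartite_digraph_pair_def
  proof (intro conjI exI)
    show "finite (pverts K)" by (simp add: K_def U_def V_def)
    show "pverts K = U \<union> V" "parcs K = U \<times> V \<union> V \<times> U" by (simp_all add: K_def)
  qed (use UV in auto)
  then interpret K: pair_graph K by (rule pair_graphI_complete_bipartite)
  have ends: "set (map (\<lambda>(u, ws, v). (u, v)) ps) = U \<times> V"
    unfolding ps by (auto simp: U_def V_def)
  have ends': "(u, v) \<in> U \<times> V" if "(u, ws, v) \<in> set ps" for u ws v
    using that unfolding ends[symmetric] by force
  have "map (\<lambda>(u, ws, v). {u, v}) ps = map (\<lambda>(u, v). {u, v}) (map (\<lambda>(u, ws, v). (u, v)) ps)"
    by (auto simp: o_def case_prod_unfold)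
  also have "distinct \<dots>" unfolding ps using ab by (auto simp: doubleton_eq_iff)
  finally have dist: "distinct (map (\<lambda>(u, ws, v). {u, v}) ps)" .
  have inn: "(u, ws, v) \<in> set ps \<Longrightarrow> set ws \<inter> pverts K = {}" for u ws v
    using inner[of u ws v] by (auto simp: K_def U_def V_def)
  have arcsK: "(u, ws, v) \<in> set ps \<Longrightarrow> (u, v) \<in> parcs K" for u ws v
    using ends'[of u ws v] by (auto simp: K_def)
  have "\<exists>H. subdivision_pair K H \<and> pverts H = pverts K \<union> (\<Union>(u, ws, v)\<in>set ps. set ws) \<and>
    parcs H = (parcs K - (\<Union>(u, ws, v)\<in>set ps. {(u, v), (v, u)})) \<union>
      (\<Union>(u, ws, v)\<in>set ps. path_arcs (u # ws @ [v]))"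
    by (rule subdivision_pair_paths[OF K.pair_bidirected_digraph_axioms]) (fact arcsK ws inn dist)+
  then obtain H where H: "subdivision_pair K H" "pverts H = pverts K \<union> (\<Union>(u, ws, v)\<in>set ps. set ws)"
    "parcs H = (parcs K - (\<Union>(u, ws, v)\<in>set ps. {(u, v), (v, u)})) \<union>
      (\<Union>(u, ws, v)\<in>set ps. path_arcs (u # ws @ [v]))" by blast
  have "parcs K \<subseteq> (\<Union>(u, ws, v)\<in>set ps. {(u, v), (v, u)})"
  proof -
    have "U \<times> V \<subseteq> (\<Union>(u, ws, v)\<in>set ps. {(u, v)})"
      unfolding ends[symmetric] by (auto simp: case_prod_unfold)
    then show ?thesis unfolding K_def by fastforce
  qed
  moreover have "(\<Union>(u, ws, v)\<in>set ps. path_arcs (u # ws @ [v])) \<subseteq> E"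
    using E by (intro UN_least) (auto simp: case_prod_unfold)
  ultimately have "parcs H \<subseteq> E" unfolding H(3) by blast
  moreover have "is_K33_subdivision (with_proj H)"
    unfolding is_K33_subdivision_def using H(1) K33 by blast
  moreover have "pair_wf_digraph H"
    using bidirected_digraphI_subdivision[OF H(1)]
    by (simp add: pair_bidirected_digraph_def pair_sym_digraph_def)
  moreover have "pverts H = {a0, a1, a2, b0, b1, b2} \<union> (\<Union>(u, ws, v)\<in>set ps. set ws)"
    using H(2) by (auto simp: K_def U_def V_def)
  ultimately show ?thesis by blast
qed

section \<open>Polygons of Vieta involutions\<close>

text \<open>
  The indices \<open>(a, b, c)\<close>, taken modulo \<open>2 N\<close>, stand for the triple \<open>(s a, s b, s c)\<close>. The condition
  \<open>c = N + 1\<close> encodes the third coordinate \<open>- s 1\<close>, since \<open>s (n + N) = - s n\<close>. Two triples have the same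
  image under \<open>index_class\<close> iff they agree up to signs of the coordinates.
\<close>

definition consecutive :: "nat \<Rightarrow> nat \<Rightarrow> nat \<Rightarrow> bool" where
  "consecutive N i j \<longleftrightarrow> j = (i + 1) mod (2 * N) \<or> i = (j + 1) mod (2 * N)"

text \<open>\<open>i\<close> and \<open>j\<close> are the two neighbours of \<open>k\<close> on the
  cycle of length \<open>2 * N\<close>; there the recurrence yields \<open>s j\<close> from
  \<open>s i\<close> and \<open>s k\<close>.\<close>

definition flanking :: "nat \<Rightarrow> nat \<Rightarrow> nat \<Rightarrow> nat \<Rightarrow> bool" where
  "flanking N i j k \<longleftrightarrow> i = (k + 1) mod (2 * N) \<and> k = (j + 1) mod (2 * N) \<or>
     j = (k + 1) mod (2 * N) \<and> k = (i + 1) mod (2 * N)"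

text \<open>One disjunct for each closed walk. In the third, \<open>b\<close> is shifted by half a
  period, so that a second sign accompanies that of - s_1.\<close>

definition index_vertex :: "nat \<Rightarrow> nat \<times> nat \<times> nat \<Rightarrow> bool" where
  "index_vertex N = (\<lambda>(a, b, c). a = 1 \<and> consecutive N b c \<or> b = 1 \<and> consecutive N c a \<or>
     c = N + 1 \<and> consecutive N a ((b + N) mod (2 * N)))"

text \<open>A Vieta involution sends \<open>s a\<close> to \<open>s b * s c - s a\<close>. This is
  the recurrence as soon as one of the factors is s_1 (index 1) or - s_1 (index
  \<open>N + 1\<close>); in the latter case the sign moves into the other factor, whose index grows
  by \<open>N\<close>.\<close>

definition index_flip :: "nat \<Rightarrow> nat \<Rightarrow> nat \<Rightarrow> nat \<Rightarrow> nat \<Rightarrow> bool" where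
  "index_flip N a a' b c \<longleftrightarrow> b = 1 \<and> flanking N a a' c \<or> c = 1 \<and> flanking N a a' b \<or>
     b = N + 1 \<and> flanking N a a' ((c + N) mod (2 * N)) \<or>
     c = N + 1 \<and> flanking N a a' ((b + N) mod (2 * N))"

definition index_adj :: "nat \<Rightarrow> nat \<times> nat \<times> nat \<Rightarrow> nat \<times> nat \<times> nat \<Rightarrow> bool" where
  "index_adj N = (\<lambda>(a, b, c) (a', b', c').
     index_flip N a a' b c \<and> b' = b \<and> c' = c \<or>
     a' = a \<and> index_flip N b b' c a \<and> c' = c \<or>
     a' = a \<and> b' = b \<and> index_flip N c c' a b)"

definition index_class :: "nat \<Rightarrow> nat \<times> nat \<times> nat \<Rightarrow> nat \<times> nat \<times> nat" where
  "index_class N = (\<lambda>(a, b, c). (a mod N, b mod N, c mod N))"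

text \<open>The sign patterns of product 1. They preserve the squares and the product of the
  coordinates, and they commute with the involutions because any two of the signs multiply to the
  third.\<close>

definition sign_changes :: "nat \<Rightarrow> int \<times> int \<times> int" where
  "sign_changes i = [(1, 1, 1), (1, -1, -1), (-1, 1, -1), (-1, -1, 1)] ! i"

lemma sign_changes_cases:
  assumes "i < 4" "sign_changes i = (r, s, t)"
  shows "r \<in> {1, -1}" "s \<in> {1, -1}" "t \<in> {1, -1}" "s * t = r" "t * r = s" "r * s = t"
  using assms by (auto simp: sign_changes_def less_Suc_eq numeral_eq_Suc)

lemma sign_changes_inj:
  assumes "i < 4" "j < 4" "sign_changes i = sign_changes j"
  shows "i = j"
  using assms by (auto simp: sign_changes_def less_Suc_eq numeral_eq_Suc)

text \<open>By \<open>squares\<close> a point determines its indices modulo \<open>N\<close>, by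
  \<open>nz\<close> it determines the signs. Together they separate the vertices of one copy and
  make the four copies disjoint.\<close>

locale vieta_polygon =
  fixes p N :: nat and \<kappa> :: int and s :: "nat \<Rightarrow> int"
  assumes prime_p: "prime p" and p_gt_3: "p > 3" and N_pos: "N > 0"
    and rec: "[s (n + 2) = s 1 * s (n + 1) - s n] (mod int p)"
    and anti: "[s (n + N) = - s n] (mod int p)"
    and surf: "[2 * (s 1)\<^sup>2 + (s 0)\<^sup>2 = (s 1)\<^sup>2 * s 0 + \<kappa>] (mod int p)"
    and nz: "i < N \<Longrightarrow> \<not> int p dvd s i"
    and squares: "i < j \<Longrightarrow> j < N \<Longrightarrow> \<not> [(s i)\<^sup>2 = (s j)\<^sup>2] (mod int p)"
begin

definition point :: "nat \<Rightarrow> nat \<times> nat \<times> nat \<Rightarrow> triple" where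
  "point \<sigma> = (\<lambda>(a, b, c). case sign_changes \<sigma> of (r, t, u) \<Rightarrow>
     ((r * s a) mod int p, (t * s b) mod int p, (u * s c) mod int p))"

lemma s_mod_2N: "[s (n mod (2 * N)) = s n] (mod int p)"
proof -
  have "[s (k + 2 * N * q) = s k] (mod int p)" for k q
  proof (induction q)
    case (Suc q)
    have "[s (k + 2 * N * q + N + N) = - (- s (k + 2 * N * q))] (mod int p)"
      by (meson anti cong_minus_minus_iff cong_trans)
    with Suc show ?case by (simp add: algebra_simps) (meson cong_trans)
  qed simp
  from this[of "n mod (2 * N)" "n div (2 * N)"] show ?thesis
    by (simp add: mult.commute cong_sym)
qed

lemma s_shift: "[s ((n + N) mod (2 * N)) = - s n] (mod int p)"
  using s_mod_2N anti cong_trans by blast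

lemma sq_mod_N: "[(s (n mod N))\<^sup>2 = (s n)\<^sup>2] (mod int p)"
proof -
  have "[(s (k + N * q))\<^sup>2 = (s k)\<^sup>2] (mod int p)" for k q
  proof (induction q)
    case (Suc q)
    have "[(s (k + N * q + N))\<^sup>2 = (- s (k + N * q))\<^sup>2] (mod int p)"
      by (intro cong_pow anti)
    with Suc show ?case by (simp add: algebra_simps) (meson cong_trans)
  qed simp
  from this[of "n mod N" "n div N"] show ?thesis
    by (simp add: mult.commute cong_sym)
qed

text \<open>The recurrence s_(n+2) + s_n = s_1 s_(n+1) is symmetric in its outer terms, so it runs
  around the cycle in either direction.\<close>

lemma flanking_cong:
  assumes "flanking N i j k"
  shows "[s j = s 1 * s k - s i] (mod int p)"
proof -
  have *: "[s ((k + 1) mod (2 * N)) + s j = s 1 * s k] (mod int p)" if "k = (j + 1) mod (2 * N)" for j k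
  proof -
    have "[s ((k + 1) mod (2 * N)) = s (j + 2)] (mod int p)"
      using s_mod_2N[of "j + 2"] that by (simp add: mod_simps)
    moreover have "[s k = s (j + 1)] (mod int p)" using s_mod_2N[of "j + 1"] that by simp
    ultimately have "[s ((k + 1) mod (2 * N)) + s j - s 1 * s k = s (j + 2) + s j - s 1 * s (j + 1)] (mod int p)"
      by (intro cong_add cong_diff cong_mult cong_refl)
    also have "[s (j + 2) + s j - s 1 * s (j + 1) = 0] (mod int p)"
      using rec[of j] by (simp add: cong_iff_dvd_diff algebra_simps)
    finally show ?thesis by (simp add: cong_iff_dvd_diff)
  qed
  from assms show ?thesis
    using *[of k j] *[of k i] by (auto simp: flanking_def cong_iff_dvd_diff algebra_simps)
qed

lemma index_flip_cong:
  assumes "index_flip N a a' b c"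
  shows "[s a' = s b * s c - s a] (mod int p)"
proof -
  have *: "[s a' = s (N + 1) * s b - s a] (mod int p)" if "flanking N a a' ((b + N) mod (2 * N))" for b
  proof -
    have "[s a' = s 1 * s ((b + N) mod (2 * N)) - s a] (mod int p)"
      using that by (rule flanking_cong)
    also have "[s 1 * s ((b + N) mod (2 * N)) - s a = s 1 * (- s b) - s a] (mod int p)"
      by (intro cong_diff cong_mult cong_refl s_shift)
    also have "s 1 * (- s b) - s a = (- s 1) * s b - s a" by simp
    also have "[(- s 1) * s b - s a = s (N + 1) * s b - s a] (mod int p)"
      using anti[of 1] by (intro cong_diff cong_mult cong_refl) (simp add: cong_sym add.commute)
    finally show ?thesis .
  qed
  show ?thesis
    using assms *[of b] *[of c] flanking_cong[of a a' b] flanking_cong[of a a' c]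
    by (auto simp: index_flip_def mult.commute)
qed

text \<open>The map (x, y) to (y, s_1 y - x) preserves the form x^2 + y^2 - s_1 x y, whose value at
  (s_0, s_1) is fixed by \<open>surf\<close>.\<close>

lemma quadratic_invariant:
  "[(s n)\<^sup>2 + (s (n + 1))\<^sup>2 + (s 1)\<^sup>2 = s 1 * s n * s (n + 1) + \<kappa>] (mod int p)"
proof (induction n)
  case 0
  then show ?case using surf by (simp add: power2_eq_square algebra_simps)
next
  case (Suc n)
  let ?t = "s 1 * s (n + 1) - s n"
  have "[(s (n + 1))\<^sup>2 + (s (n + 2))\<^sup>2 + (s 1)\<^sup>2 - s 1 * s (n + 1) * s (n + 2)
      = (s (n + 1))\<^sup>2 + ?t\<^sup>2 + (s 1)\<^sup>2 - s 1 * s (n + 1) * ?t] (mod int p)"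
    by (intro cong_diff cong_add cong_mult cong_pow cong_refl rec)
  also have "(s (n + 1))\<^sup>2 + ?t\<^sup>2 + (s 1)\<^sup>2 - s 1 * s (n + 1) * ?t =
     (s n)\<^sup>2 + (s (n + 1))\<^sup>2 + (s 1)\<^sup>2 - s 1 * s n * s (n + 1)"
    by (simp add: power2_eq_square algebra_simps)
  also have "[\<dots> = \<kappa>] (mod int p)"
    using Suc by (simp add: cong_iff_dvd_diff algebra_simps)
  finally show ?case by (simp add: cong_iff_dvd_diff algebra_simps)
qed

lemma consecutive_cong:
  assumes "consecutive N i j"
  shows "[(s i)\<^sup>2 + (s j)\<^sup>2 + (s 1)\<^sup>2 = s 1 * s i * s j + \<kappa>] (mod int p)"
proof -
  have *: "[(s i)\<^sup>2 + (s ((i + 1) mod (2 * N)))\<^sup>2 + (s 1)\<^sup>2 = s 1 * s i * s ((i + 1) mod (2 * N)) + \<kappa>] (mod int p)" for i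
  proof -
    have "[(s i)\<^sup>2 + (s ((i + 1) mod (2 * N)))\<^sup>2 + (s 1)\<^sup>2 = (s i)\<^sup>2 + (s (i + 1))\<^sup>2 + (s 1)\<^sup>2] (mod int p)"
      by (intro cong_add cong_pow cong_refl s_mod_2N)
    also note quadratic_invariant
    also have "[s 1 * s i * s (i + 1) + \<kappa> = s 1 * s i * s ((i + 1) mod (2 * N)) + \<kappa>] (mod int p)"
      by (intro cong_add cong_mult cong_refl cong_sym[OF s_mod_2N])
    finally show ?thesis .
  qed
  from assms *[of i] *[of j] show ?thesis
    by (auto simp: consecutive_def ac_simps)
qed

lemma index_vertex_cong:
  assumes "index_vertex N (a, b, c)"
  shows "[(s a)\<^sup>2 + (s b)\<^sup>2 + (s c)\<^sup>2 = s a * s b * s c + \<kappa>] (mod int p)"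
proof -
  consider "a = 1" "consecutive N b c" | "b = 1" "consecutive N c a"
    | "c = N + 1" "consecutive N a ((b + N) mod (2 * N))"
    using assms by (auto simp: index_vertex_def)
  then show ?thesis
  proof cases
    case 1
    then show ?thesis using consecutive_cong[of b c] by (simp add: ac_simps)
  next
    case 2
    then show ?thesis using consecutive_cong[of c a] by (simp add: ac_simps)
  next
    case 3
    \<comment> \<open>Two coordinates change sign together, the third directly and the second
      through its shift by \<open>N\<close>, so the product of all three is unaffected.\<close>
    have c: "[s c = - s 1] (mod int p)" using 3 anti[of 1] by (simp add: add.commute)
    let ?b = "s ((b + N) mod (2 * N))"
    have "[(s a)\<^sup>2 + (s b)\<^sup>2 + (s c)\<^sup>2 - s a * s b * s c =
       (s a)\<^sup>2 + (- ?b)\<^sup>2 + (- s 1)\<^sup>2 - s a * (- ?b) * (- s 1)] (mod int p)"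
      using s_shift[of b] cong_minus_minus_iff[of "?b" "- s b" "int p"]
      by (intro cong_add cong_diff cong_mult cong_pow cong_refl c) (simp_all add: cong_sym)
    also have "[(s a)\<^sup>2 + (- ?b)\<^sup>2 + (- s 1)\<^sup>2 - s a * (- ?b) * (- s 1) = \<kappa>] (mod int p)"
      using consecutive_cong[OF 3(2)] by (simp add: cong_iff_dvd_diff algebra_simps)
    finally show ?thesis by (simp add: cong_iff_dvd_diff algebra_simps)
  qed
qed

lemma point_on_surface:
  assumes "index_vertex N v" "i < 4"
  shows "point i v \<in> markoff_surface \<kappa> p"
proof -
  obtain a b c where v: "v = (a, b, c)" by (cases v)
  obtain r t u where rtu: "sign_changes i = (r, t, u)" by (cases "sign_changes i")
  note sg = sign_changes_cases[OF assms(2) rtu]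
  have "[((r * s a) mod p)\<^sup>2 + ((t * s b) mod p)\<^sup>2 + ((u * s c) mod p)\<^sup>2 =
     (r * s a)\<^sup>2 + (t * s b)\<^sup>2 + (u * s c)\<^sup>2] (mod int p)"
    by (intro cong_add cong_pow) simp_all
  also have "(r * s a)\<^sup>2 + (t * s b)\<^sup>2 + (u * s c)\<^sup>2 = (s a)\<^sup>2 + (s b)\<^sup>2 + (s c)\<^sup>2"
    using sg(1-3) by (auto simp: power_mult_distrib)
  also have "[\<dots> = s a * s b * s c + \<kappa>] (mod int p)"
    using assms(1) v by (intro index_vertex_cong) simp
  also have "s a * s b * s c = (r * s a) * (t * s b) * (u * s c)"
    using sg by auto
  also have "[(r * s a) * (t * s b) * (u * s c) + \<kappa> =
      ((r * s a) mod p) * ((t * s b) mod p) * ((u * s c) mod p) + \<kappa>] (mod int p)"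
    by (intro cong_add cong_mult cong_refl) simp_all
  finally show ?thesis
    using p_gt_3 by (simp add: markoff_surface_def point_def v rtu)
qed

lemma vieta_point:
  assumes "index_adj N v w" "i < 4"
  shows "\<exists>k. vieta p k (point i v) = point i w"
proof -
  obtain a b c where v: "v = (a, b, c)" by (cases v)
  obtain a' b' c' where w: "w = (a', b', c')" by (cases w)
  obtain r t u where rtu: "sign_changes i = (r, t, u)" by (cases "sign_changes i")
  note sg = sign_changes_cases[OF assms(2) rtu]
  have *: "((t * s b) mod p * ((u * s c) mod p) - (r * s a) mod p) mod p = (r * s a') mod p"
    if "index_flip N a a' b c" "t * u = r" for a a' b c r t u
  proof -
    have "[(t * s b) mod p * ((u * s c) mod p) - (r * s a) mod p = t * s b * (u * s c) - r * s a] (mod int p)"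
      by (intro cong_mult cong_diff) simp_all
    also have "t * s b * (u * s c) - r * s a = r * (s b * s c - s a)"
      using that(2) by (auto simp: algebra_simps)
    also have "[\<dots> = r * s a'] (mod int p)"
      by (intro cong_mult cong_refl cong_sym[OF index_flip_cong] that(1))
    finally show ?thesis by (simp add: unique_euclidean_semiring_class.cong_def)
  qed
  consider "index_flip N a a' b c" "b' = b" "c' = c" | "a' = a" "index_flip N b b' c a" "c' = c"
    | "a' = a" "b' = b" "index_flip N c c' a b"
    using assms(1) by (auto simp: index_adj_def v w)
  then show ?thesis
  proof cases
    case 1
    then show ?thesis using *[OF 1(1) sg(4)]
      by (intro exI[of _ C1]) (simp add: point_def v w rtu)
  next
    case 2
    then show ?thesis using *[OF 2(2) sg(5)]
      by (intro exI[of _ C2]) (simp add: point_def v w rtu)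
  next
    case 3
    then show ?thesis using *[OF 3(3) sg(6)]
      by (intro exI[of _ C3]) (simp add: point_def v w rtu)
  qed
qed

lemma point_eq_imp_class:
  assumes "point i v = point j w" "i < 4" "j < 4"
  shows "index_class N v = index_class N w"
proof -
  obtain a b c where v: "v = (a, b, c)" by (cases v)
  obtain a' b' c' where w: "w = (a', b', c')" by (cases w)
  obtain r t u where rtu: "sign_changes i = (r, t, u)" by (cases "sign_changes i")
  obtain r' t' u' where rtu': "sign_changes j = (r', t', u')" by (cases "sign_changes j")
  note sg = sign_changes_cases[OF assms(2) rtu] sign_changes_cases[OF assms(3) rtu']
  have *: "m mod N = n mod N" if "(e * s m) mod p = (e' * s n) mod p" "e \<in> {1, -1}" "e' \<in> {1, -1}" for m n e e'
  proof -
    \<comment> \<open>Squaring forgets the signs; \<open>sq_mod_N\<close> then brings the indices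
      below \<open>N\<close>, where the squares are distinct.\<close>
    have "[(e * s m)\<^sup>2 = (e' * s n)\<^sup>2] (mod int p)" using that(1) by (intro cong_pow) (simp add: unique_euclidean_semiring_class.cong_def)
    then have "[(s m)\<^sup>2 = (s n)\<^sup>2] (mod int p)" using that(2,3) by (auto simp: power_mult_distrib)
    then have "[(s (m mod N))\<^sup>2 = (s (n mod N))\<^sup>2] (mod int p)"
      using sq_mod_N cong_trans cong_sym by meson
    then show ?thesis
      using squares[of "m mod N" "n mod N"] squares[of "n mod N" "m mod N"] N_pos
      by (metis cong_sym mod_less_divisor nat_neq_iff)
  qed
  show ?thesis
    using assms(1) sg(1-3,7-9) *[of r a r' a'] *[of t b t' b'] *[of u c u' c']
    by (simp add: point_def v w rtu rtu' index_class_def)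
qed

lemma point_eq_imp_sign:
  assumes "point i v = point j v" "i < 4" "j < 4"
  shows "i = j"
proof -
  obtain a b c where v: "v = (a, b, c)" by (cases v)
  obtain r t u where rtu: "sign_changes i = (r, t, u)" by (cases "sign_changes i")
  obtain r' t' u' where rtu': "sign_changes j = (r', t', u')" by (cases "sign_changes j")
  note sg = sign_changes_cases[OF assms(2) rtu] sign_changes_cases[OF assms(3) rtu']
  have *: "e = e'" if "(e * s m) mod p = (e' * s m) mod p" "e \<in> {1, -1}" "e' \<in> {1, -1}" for m e e'
  proof (rule ccontr)
    assume "e \<noteq> e'"
    \<comment> \<open>Opposite signs on the same entry would make 2 s_m divisible by the odd prime
      \<open>p\<close>.\<close>
    then have ee: "e - e' = 2 \<or> e - e' = -2" using that(2,3) by auto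
    have "int p dvd (e - e') * s m"
      using that(1) by (simp add: mod_eq_dvd_iff algebra_simps)
    then have "int p dvd 2 * s m" using ee by auto
    moreover have "\<not> int p dvd 2" using p_gt_3 by (auto dest: zdvd_imp_le)
    ultimately have "int p dvd s m" using prime_p by (simp add: prime_dvd_mult_iff)
    then have "int p dvd (s m)\<^sup>2" by (simp add: prime_p prime_dvd_power_iff)
    then have "int p dvd (s (m mod N))\<^sup>2" using sq_mod_N[of m] by (metis cong_dvd_iff)
    then have "int p dvd s (m mod N)" using prime_p by (simp add: prime_dvd_power_iff)
    then show False using nz[of "m mod N"] N_pos by simp
  qed
  have "sign_changes i = sign_changes j"
    using assms(1) sg(1-3,7-9) *[of r a r'] *[of t b t'] *[of u c u']
    by (simp add: point_def v rtu rtu')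
  then show ?thesis using assms(2,3) sign_changes_inj by blast
qed

text \<open>Each entry \<open>(u, ws, v)\<close> of \<open>ps\<close> is a path from \<open>u\<close> to \<open>v\<close> with inner vertices \<open>ws\<close>.\<close>

lemma K33_primesI:
  assumes ps: "map (\<lambda>(u, ws, v). (u, v)) ps =
      [(a0, b0), (a0, b1), (a0, b2), (a1, b0), (a1, b1), (a1, b2), (a2, b0), (a2, b1), (a2, b2)]"
    and vs: "vs = [a0, a1, a2, b0, b1, b2] @ concat (map (\<lambda>(u, ws, v). ws) ps)"
    and dist: "distinct (map (index_class N) vs)"
    and vert: "list_all (index_vertex N) vs"
    and adj: "list_all (\<lambda>(u, ws, v). list_all2 (index_adj N) (u # ws) (ws @ [v])) ps"
  shows "p \<in> K33_primes \<kappa>"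
proof -
  let ?G = "markoff_graph \<kappa> p"
  let ?E = "parcs (mk_symmetric ?G)"
  have E: "path_arcs (point i u # map (point i) ws @ [point i v]) \<subseteq> ?E"
    if "(u, ws, v) \<in> set ps" "i < 4" for i u ws v
  proof -
    have mem: "set (u # ws @ [v]) \<subseteq> set vs"
    proof -
      have "(u, v) \<in> set (map (\<lambda>(u, ws, v). (u, v)) ps)" using that(1) by force
      then have "{u, v} \<subseteq> {a0, a1, a2, b0, b1, b2}" unfolding ps by auto
      moreover have "set ws \<subseteq> (\<Union>q\<in>set ps. set (fst (snd q)))" using that(1) by force
      then have "set ws \<subseteq> set vs" unfolding vs by (simp add: case_prod_unfold) blast
      ultimately show ?thesis unfolding vs by auto
    qed
    have "list_all2 (index_adj N) (u # ws) (ws @ [v])" using adj that(1) by (auto simp: list_all_iff)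
    then have *: "index_adj N x y \<and> x \<in> set (u # ws) " if "(x, y) \<in> set (zip (u # ws) (ws @ [v]))" for x y
      using that by (auto simp: list_all2_iff dest: set_zip_leftD)
    have **: "(point i x, point i y) \<in> ?E \<and> (point i y, point i x) \<in> ?E"
      if xy: "(x, y) \<in> set (zip (u # ws) (ws @ [v]))" for x y
    proof -
      obtain k where k: "vieta p k (point i x) = point i y"
        using vieta_point[of x y i] *[OF xy] \<open>i < 4\<close> by auto
      have "x \<in> set vs" using *[OF xy] mem by auto
      then have "point i x \<in> markoff_surface \<kappa> p"
        using vert \<open>i < 4\<close> by (intro point_on_surface) (auto simp: list_all_iff)
      then show ?thesis using k[symmetric]
        by (auto simp: parcs_mk_symmetric markoff_graph_def intro!: bexI[of _ "point i x"] exI[of _ k])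
    qed
    have "set (zip (point i u # map (point i) ws @ [point i v]) (map (point i) ws @ [point i v]))
        \<subseteq> map_prod (point i) (point i) ` set (zip (u # ws) (ws @ [v]))"
    proof -
      have "zip (point i u # map (point i) ws @ [point i v]) (map (point i) ws @ [point i v])
        = zip (map (point i) (u # ws)) (map (point i) (ws @ [v]))"
        using zip_append1[of "map (point i) (u # ws)" "[point i v]" "map (point i) (ws @ [v])"] by simp
      then show ?thesis by (simp only: zip_map_map) (auto simp: map_prod_def)
    qed
    then have "q \<in> ?E \<and> prod.swap q \<in> ?E"
      if "q \<in> set (zip (point i u # map (point i) ws @ [point i v]) (map (point i) ws @ [point i v]))" for q
      using ** that by (auto dest!: subsetD)
    then show ?thesis by (auto simp: path_arcs_def)
  qed
  have class_inj: "inj_on (index_class N) (set vs)" and dvs: "distinct vs"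
    using dist by (simp_all add: distinct_map)
  have inj: "inj_on (point i) (set vs)" if "i < 4" for i
    by (rule inj_onI) (blast intro: inj_onD[OF class_inj] point_eq_imp_class[OF _ that that])
  have "\<exists>H. is_K33_subdivision (with_proj H) \<and> pair_wf_digraph H \<and> parcs H \<subseteq> ?E \<and>
    pverts H = point i ` set vs" if i: "i < 4" for i
  proof -
    let ?f = "point i"
    let ?ps = "map (\<lambda>(u, ws, v). (?f u, map ?f ws, ?f v)) ps"
    have d: "distinct (map ?f vs)" using dvs inj[OF i] by (simp add: distinct_map)
    have eq: "concat (map (\<lambda>(u, ws, v). ws) ?ps) = map ?f (concat (map (\<lambda>(u, ws, v). ws) ps))"
      by (simp add: map_concat o_def case_prod_unfold)
    have "\<exists>H. is_K33_subdivision (with_proj H) \<and> pair_wf_digraph H \<and> parcs H \<subseteq> ?E \<and>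
      pverts H = {?f a0, ?f a1, ?f a2, ?f b0, ?f b1, ?f b2} \<union> (\<Union>(u, ws, v)\<in>set ?ps. set ws)"
    proof (rule K33_subdivision_of_paths)
      show "distinct [?f a0, ?f a1, ?f a2, ?f b0, ?f b1, ?f b2]"
        using d by (simp add: vs)
      have "map (\<lambda>(u, ws, v). (u, v)) ?ps = map (map_prod ?f ?f) (map (\<lambda>(u, ws, v). (u, v)) ps)"
        by (simp add: o_def case_prod_unfold)
      then show "map (\<lambda>(u, ws, v). (u, v)) ?ps = [(?f a0, ?f b0), (?f a0, ?f b1), (?f a0, ?f b2),
        (?f a1, ?f b0), (?f a1, ?f b1), (?f a1, ?f b2), (?f a2, ?f b0), (?f a2, ?f b1), (?f a2, ?f b2)]"
        unfolding ps by simp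
      show "distinct (concat (map (\<lambda>(u, ws, v). ws) ?ps))"
        unfolding eq using d by (simp add: vs)
      fix u ws v assume mem: "(u, ws, v) \<in> set ?ps"
      have "ws \<in> (\<lambda>(u, ws, v). ws) ` set ?ps"
        using imageI[OF mem, of "\<lambda>(u, ws, v). ws"] by (simp only: prod.case)
      then have "set ws \<subseteq> set (concat (map (\<lambda>(u, ws, v). ws) ?ps))"
        by (simp only: set_concat set_map) blast
      moreover have "set (concat (map (\<lambda>(u, ws, v). ws) ?ps)) \<inter> ?f ` {a0, a1, a2, b0, b1, b2} = {}"
      proof -
        have "distinct (map ?f [a0, a1, a2, b0, b1, b2] @ map ?f (concat (map (\<lambda>(u, ws, v). ws) ps)))"
          using d unfolding vs map_append .
        then have "set (map ?f [a0, a1, a2, b0, b1, b2]) \<inter> set (map ?f (concat (map (\<lambda>(u, ws, v). ws) ps))) = {}"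
          unfolding distinct_append by blast
        then show ?thesis unfolding eq by (simp only: set_map list.set Int_commute)
      qed
      ultimately show "set ws \<inter> {?f a0, ?f a1, ?f a2, ?f b0, ?f b1, ?f b2} = {}"
        by (simp only: image_insert image_empty) blast
      obtain u' ws' v' where "(u', ws', v') \<in> set ps" "u = ?f u'" "ws = map ?f ws'" "v = ?f v'"
        using mem by auto
      then show "path_arcs (u # ws @ [v]) \<subseteq> ?E" using E[OF _ i] by simp
    qed
    moreover have "(\<Union>(u, ws, v)\<in>set ?ps. set ws) = ?f ` set (concat (map (\<lambda>(u, ws, v). ws) ps))"
      by (auto simp: case_prod_unfold)
    then have "{?f a0, ?f a1, ?f a2, ?f b0, ?f b1, ?f b2} \<union> (\<Union>(u, ws, v)\<in>set ?ps. set ws) = ?f ` set vs"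
      unfolding vs by auto
    ultimately show ?thesis by simp
  qed
  then obtain H where H: "\<And>i. i < 4 \<Longrightarrow> is_K33_subdivision (with_proj (H i)) \<and> pair_wf_digraph (H i) \<and>
      parcs (H i) \<subseteq> ?E \<and> pverts (H i) = point i ` set vs"
    by metis
  have "has_disjoint_K33_subdivisions 4 ?G"
    unfolding has_disjoint_K33_subdivisions_def
  proof (intro exI conjI allI impI)
    fix i :: nat assume i: "i < 4"
    have "pverts (H i) \<subseteq> verts ?G"
      using H[OF i] point_on_surface[OF _ i] vert by (auto simp: markoff_graph_def list_all_iff)
    moreover have "pair_wf_digraph (mk_symmetric ?G)"
      by (rule wf_digraph.wellformed_mk_symmetric[OF wf_digraph_markoff_graph])
    ultimately show "subgraph (with_proj (H i)) (with_proj (mk_symmetric ?G))"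
      using H[OF i] by (simp add: subgraph_def wf_digraph_wp_iff compatible_def)
    show "is_K33_subdivision (with_proj (H i))" using H[OF i] by simp
  next
    fix i j :: nat assume ij: "i < 4" "j < 4" "i \<noteq> j"
    show "verts (with_proj (H i)) \<inter> verts (with_proj (H j)) = {}"
    proof (rule ccontr)
      assume "\<not> ?thesis"
      then obtain x where "x \<in> point i ` set vs" "x \<in> point j ` set vs"
        using H[OF ij(1)] H[OF ij(2)] by auto
      then obtain v w where "v \<in> set vs" "w \<in> set vs" "point i v = point j w" by blast
      \<comment> \<open>The index classes are distinct along \<open>vs\<close>, so a common point
        first fixes the vertex of the pattern; only then can the signs be compared.\<close>
      then have "v = w" using class_inj point_eq_imp_class[OF _ ij(1,2)] by (auto simp: inj_on_def)
      then show False using point_eq_imp_sign[OF _ ij(1,2), of v] \<open>point i v = point j w\<close> ij(3) by simp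
    qed
  qed
  then show ?thesis using prime_p p_gt_3 by (simp add: K33_primes_def)
qed

section \<open>Explicit subdivisions for N = 3 and N = 5\<close>

text \<open>Any two of the three closed walks have an edge in common, and the ends of these three
  edges are the branch vertices. Cutting each walk at its two common edges leaves two arcs; the six
  arcs and the three edges are the nine paths. The arcs join opposite sides of the bipartition,
  which is why the pattern is not a prism. Along the walks the first two indices stay odd and the
  third stays even.\<close>

lemma K33_primes_triangle:
  assumes "N = 3"
  shows "p \<in> K33_primes \<kappa>"
proof (rule K33_primesI[OF _ refl])
  let ?ps = "[((1, 1, 0), [], (1, 1, 2)), ((1, 1, 0), [(1, 5, 0)], (1, 5, 4)), ((1, 1, 0), [(5, 1, 0)], (5, 1, 4)),
    ((1, 3, 4), [(1, 3, 2)], (1, 1, 2)), ((1, 3, 4), [], (1, 5, 4)), ((1, 3, 4), [(5, 3, 4)], (5, 1, 4)),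
    ((3, 1, 4), [(3, 1, 2)], (1, 1, 2)), ((3, 1, 4), [(3, 5, 4)], (1, 5, 4)), ((3, 1, 4), [], (5, 1, 4))]
    :: ((nat \<times> nat \<times> nat) \<times> (nat \<times> nat \<times> nat) list \<times> (nat \<times> nat \<times> nat)) list"
  show "map (\<lambda>(u, ws, v). (u, v)) ?ps = [((1, 1, 0), (1, 1, 2)), ((1, 1, 0), (1, 5, 4)), ((1, 1, 0), (5, 1, 4)),
    ((1, 3, 4), (1, 1, 2)), ((1, 3, 4), (1, 5, 4)), ((1, 3, 4), (5, 1, 4)),
    ((3, 1, 4), (1, 1, 2)), ((3, 1, 4), (1, 5, 4)), ((3, 1, 4), (5, 1, 4))]" by simp
qed (simp_all add: assms index_class_def index_vertex_def consecutive_def index_adj_def index_flip_def flanking_def)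

text \<open>The same pattern on walks of length ten: removing the two common edges leaves two arcs
  of four edges, hence three inner vertices each.\<close>

lemma K33_primes_pentagon:
  assumes "N = 5"
  shows "p \<in> K33_primes \<kappa>"
proof (rule K33_primesI[OF _ refl])
  let ?ps = "[((1, 1, 0), [], (1, 1, 2)), ((1, 1, 0), [(1, 9, 0), (1, 9, 8), (1, 7, 8)], (1, 7, 6)),
    ((1, 1, 0), [(9, 1, 0), (9, 1, 8), (7, 1, 8)], (7, 1, 6)),
    ((1, 5, 6), [(1, 5, 4), (1, 3, 4), (1, 3, 2)], (1, 1, 2)), ((1, 5, 6), [], (1, 7, 6)),
    ((1, 5, 6), [(9, 5, 6), (9, 3, 6), (7, 3, 6)], (7, 1, 6)),
    ((5, 1, 6), [(5, 1, 4), (3, 1, 4), (3, 1, 2)], (1, 1, 2)),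
    ((5, 1, 6), [(5, 9, 6), (3, 9, 6), (3, 7, 6)], (1, 7, 6)), ((5, 1, 6), [], (7, 1, 6))]
    :: ((nat \<times> nat \<times> nat) \<times> (nat \<times> nat \<times> nat) list \<times> (nat \<times> nat \<times> nat)) list"
  show "map (\<lambda>(u, ws, v). (u, v)) ?ps = [((1, 1, 0), (1, 1, 2)), ((1, 1, 0), (1, 7, 6)), ((1, 1, 0), (7, 1, 6)),
    ((1, 5, 6), (1, 1, 2)), ((1, 5, 6), (1, 7, 6)), ((1, 5, 6), (7, 1, 6)),
    ((5, 1, 6), (1, 1, 2)), ((5, 1, 6), (1, 7, 6)), ((5, 1, 6), (7, 1, 6))]" by simp
qed (simp_all add: assms index_class_def index_vertex_def consecutive_def index_adj_def index_flip_def flanking_def)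

end

section \<open>Legendre and Jacobi symbols\<close>

lemma Legendre_values: "Legendre a p \<in> {-1, 0, 1}"
  by (simp add: Legendre_def)

lemma Legendre_cong:
  assumes "[a = b] (mod p)"
  shows "Legendre a p = Legendre b p"
proof -
  have "[a = 0] (mod p) \<longleftrightarrow> [b = 0] (mod p)" using assms by (simp add: unique_euclidean_semiring_class.cong_def)
  moreover have "QuadRes p a \<longleftrightarrow> QuadRes p b" using assms by (simp add: QuadRes_def unique_euclidean_semiring_class.cong_def)
  ultimately show ?thesis by (simp add: Legendre_def)
qed

lemma Legendre_eq_0_iff: "Legendre a p = 0 \<longleftrightarrow> p dvd a"
  by (simp add: Legendre_def cong_0_iff)

lemma Legendre_one [simp]: "prime p \<Longrightarrow> Legendre 1 (int p) = 1"
  using prime_gt_1_nat[of p] by (auto simp: Legendre_def QuadRes_def unique_euclidean_semiring_class.cong_def intro!: exI[of _ 1])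

lemma cong_sign_imp_eq:
  fixes x y :: int
  assumes "[x = y] (mod int p)" "x \<in> {-1, 0, 1}" "y \<in> {-1, 0, 1}" "p > 2"
  shows "x = y"
proof (rule ccontr)
  assume "x \<noteq> y"
  moreover have "int p dvd x - y" using assms(1) by (simp add: cong_iff_dvd_diff)
  ultimately have "\<bar>int p\<bar> \<le> \<bar>x - y\<bar>" by (intro dvd_imp_le_int) auto
  with assms show False by auto
qed

lemma Legendre_mult:
  assumes "prime p" "p > 2"
  shows "Legendre (a * b) (int p) = Legendre a (int p) * Legendre b (int p)"
proof (rule cong_sign_imp_eq[OF _ _ _ assms(2)])
  let ?k = "(p - 1) div 2"
  have "[Legendre (a * b) (int p) = (a * b) ^ ?k] (mod int p)"
    using euler_criterion assms by blast
  also have "(a * b) ^ ?k = a ^ ?k * b ^ ?k" by (rule power_mult_distrib)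
  also have "[\<dots> = Legendre a (int p) * Legendre b (int p)] (mod int p)"
    using euler_criterion assms by (intro cong_mult cong_sym[OF euler_criterion]) auto
  finally show "[Legendre (a * b) (int p) = Legendre a (int p) * Legendre b (int p)] (mod int p)" .
  show "Legendre a (int p) * Legendre b (int p) \<in> {-1, 0, 1}"
    using Legendre_values[of a p] Legendre_values[of b p] by auto
qed (rule Legendre_values)

lemma Legendre_minus_one:
  assumes "prime p" "p > 2"
  shows "Legendre (-1) (int p) = (-1) ^ ((p - 1) div 2)"
proof (rule cong_sign_imp_eq[OF _ _ _ assms(2)])
  show "[Legendre (-1) (int p) = (-1) ^ ((p - 1) div 2)] (mod int p)"
    using euler_criterion assms by blast
  show "(-1 :: int) ^ ((p - 1) div 2) \<in> {-1, 0, 1}"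
    by (cases "even ((p - 1) div 2)") simp_all
qed (rule Legendre_values)

text \<open>The modulus comes first, so that \<open>jacobi m\<close> is the character.\<close>

definition jacobi :: "nat \<Rightarrow> nat \<Rightarrow> int" where
  "jacobi m n = (\<Prod>q\<in>#prime_factorization m. Legendre (int n) (int q))"

lemma jacobi_values: "jacobi m n \<in> {-1, 0, 1}"
proof -
  have "(\<Prod>q\<in>#M. Legendre (int n) (int q)) \<in> {-1, 0, 1}" for M
  proof (induction M)
    case (add q M)
    then show ?case using Legendre_values[of "int n" "int q"] by auto
  qed simp
  then show ?thesis by (simp add: jacobi_def)
qed

lemma jacobi_one_right [simp]: "jacobi m (Suc 0) = 1"
proof -
  have "image_mset (\<lambda>q. Legendre (int 1) (int q)) (prime_factorization m) =
      image_mset (\<lambda>q. 1) (prime_factorization m)"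
    by (intro image_mset_cong) (auto simp: in_prime_factors_imp_prime)
  then show ?thesis unfolding jacobi_def by simp
qed

lemma jacobi_mult_right:
  assumes "odd m"
  shows "jacobi m (a * b) = jacobi m a * jacobi m b"
proof -
  have "image_mset (\<lambda>q. Legendre (int (a * b)) (int q)) (prime_factorization m) =
      image_mset (\<lambda>q. Legendre (int a) (int q) * Legendre (int b) (int q)) (prime_factorization m)"
  proof (intro image_mset_cong)
    fix q assume q: "q \<in># prime_factorization m"
    then have "prime q" "q dvd m" by auto
    then have "q > 2" using assms by (metis dvd_trans even_numeral le_neq_implies_less prime_ge_2_nat dvd_refl)
    then show "Legendre (int (a * b)) (int q) = Legendre (int a) (int q) * Legendre (int b) (int q)"
      using Legendre_mult \<open>prime q\<close> by simp
  qed
  then show ?thesis unfolding jacobi_def by (simp add: prod_mset.distrib)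
qed

lemma jacobi_cong:
  assumes "[a = b] (mod m)"
  shows "jacobi m a = jacobi m b"
proof -
  have "image_mset (\<lambda>q. Legendre (int a) (int q)) (prime_factorization m) =
      image_mset (\<lambda>q. Legendre (int b) (int q)) (prime_factorization m)"
  proof (intro image_mset_cong Legendre_cong)
    fix q assume "q \<in># prime_factorization m"
    then show "[int a = int b] (mod int q)"
      using assms by (auto simp: cong_int_iff intro: cong_dvd_modulus_nat)
  qed
  then show ?thesis unfolding jacobi_def by simp
qed

lemma jacobi_mult_left:
  assumes "a > 0" "b > 0"
  shows "jacobi (a * b) n = jacobi a n * jacobi b n"
  using assms by (simp add: jacobi_def prime_factorization_mult)

lemma jacobi_prime: "prime q \<Longrightarrow> jacobi q n = Legendre (int n) (int q)"
  by (simp add: jacobi_def prime_factorization_prime)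

lemma jacobi_one_left [simp]: "jacobi (Suc 0) n = 1"
  by (simp add: jacobi_def)

text \<open>For odd \<open>m\<close> the sign that makes its product with \<open>m\<close> congruent
  to 1 modulo 4.\<close>

definition sign_mod4 :: "nat \<Rightarrow> int" where
  "sign_mod4 m = (if m mod 4 = 1 then 1 else -1)"

lemma odd_mod_4_nat: "odd (m::nat) \<Longrightarrow> m mod 4 = 1 \<or> m mod 4 = 3"
  by presburger

lemma sign_mod4_mult:
  assumes "odd a" "odd b"
  shows "sign_mod4 (a * b) = sign_mod4 a * sign_mod4 b"
proof -
  have "a * b mod 4 = (a mod 4) * (b mod 4) mod 4" by (simp add: mod_simps)
  then show ?thesis
    using odd_mod_4_nat[OF assms(1)] odd_mod_4_nat[OF assms(2)] by (auto simp: sign_mod4_def)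
qed

text \<open>Quadratic reciprocity with the sign absorbed into \<open>q\<close>; for
  \<open>p = q\<close> both sides vanish.\<close>

lemma Legendre_sign_mod4_prime:
  assumes p: "prime p" "p > 2" and q: "prime q" "q > 2"
  shows "Legendre (sign_mod4 q * int q) (int p) = Legendre (int p) (int q)"
proof (cases "p = q")
  case True
  then show ?thesis using Legendre_eq_0_iff[of "sign_mod4 q * int q" "int p"]
    Legendre_eq_0_iff[of "int p" "int q"] by simp
next
  case False
  let ?x = "Legendre (int p) (int q)" and ?y = "Legendre (int q) (int p)"
  have rec: "?x * ?y = (-1) ^ ((p - 1) div 2 * ((q - 1) div 2))"
    using Quadratic_Reciprocity p q False by blast
  have "\<not> q dvd p" "\<not> p dvd q" using False p q by (auto dest: primes_dvd_imp_eq)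
  then have "?x \<in> {-1, 1}" "?y \<in> {-1, 1}"
    using Legendre_values[of "int p" "int q"] Legendre_values[of "int q" "int p"]
    by (auto simp: Legendre_eq_0_iff)
  have "odd q" using q prime_odd_nat by blast
  then consider "q mod 4 = 1" | "q mod 4 = 3" using odd_mod_4_nat by blast
  then show ?thesis
  proof cases
    case 1
    then have "even ((q - 1) div 2)" by presburger
    with rec have "?x * ?y = 1" by simp
    with \<open>?x \<in> _\<close> \<open>?y \<in> _\<close> 1 show ?thesis by (auto simp: sign_mod4_def)
  next
    case 2
    then have "odd ((q - 1) div 2)" by presburger
    with rec have "?x * ?y = (-1) ^ ((p - 1) div 2)" by (simp add: power_mult)
      (metis (no_types, opaque_lifting) mult.commute neg_one_odd_power power_mult power_one_right)
    then have "?x * ?y = Legendre (-1) (int p)" using Legendre_minus_one p by simp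
    moreover have "Legendre (sign_mod4 q * int q) (int p) = Legendre (-1) (int p) * ?y"
      using 2 Legendre_mult[OF p, of "-1" "int q"] by (simp add: sign_mod4_def)
    ultimately show ?thesis using \<open>?y \<in> _\<close> by auto
  qed
qed

lemma Legendre_sign_mod4:
  assumes p: "prime p" "p > 2" and m: "odd m"
  shows "Legendre (sign_mod4 m * int m) (int p) = jacobi m p"
  using m
proof (induction m rule: prime_divisors_induct)
  case (unit m)
  then show ?case using p by (simp add: sign_mod4_def)
next
  case (factor q m)
  then have odd: "odd q" "odd m" by auto
  have "q > 2" using factor(1) odd prime_ge_2_nat[of q] by (cases "q = 2") auto
  have "m > 0" using odd by (cases m) auto
  have "Legendre (sign_mod4 (q * m) * int (q * m)) (int p) =
      Legendre ((sign_mod4 q * int q) * (sign_mod4 m * int m)) (int p)"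
    using odd by (simp add: sign_mod4_mult algebra_simps)
  also have "\<dots> = Legendre (sign_mod4 q * int q) (int p) * Legendre (sign_mod4 m * int m) (int p)"
    by (rule Legendre_mult[OF p])
  also have "\<dots> = jacobi (q * m) p"
    using factor odd \<open>q > 2\<close> \<open>m > 0\<close> prime_gt_0_nat[of q]
    unfolding Legendre_sign_mod4_prime[OF p factor(1) \<open>q > 2\<close>]
    by (simp add: jacobi_mult_left jacobi_prime)
  finally show ?case .
qed simp

text \<open>An integer that is 1 modulo 4 carries exactly the sign that \<open>sign_mod4\<close>
  assigns to its absolute value. The symbol thereby becomes periodic in \<open>p\<close> with an odd
  period.\<close>

lemma Legendre_eq_jacobi:
  assumes "prime p" "p > 2" "[D = 1] (mod 4)"
  shows "Legendre D (int p) = jacobi (nat \<bar>D\<bar>) p"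
proof -
  have D: "D mod 4 = 1" using assms(3) by (simp add: unique_euclidean_semiring_class.cong_def)
  then have "odd D" by presburger
  have "sign_mod4 (nat \<bar>D\<bar>) * int (nat \<bar>D\<bar>) = D"
  proof (cases "D \<ge> 0")
    case True
    then have "int (nat \<bar>D\<bar> mod 4) = 1" using D by (simp add: zmod_int)
    then have "nat \<bar>D\<bar> mod 4 = 1" by simp
    then show ?thesis using True by (simp add: sign_mod4_def)
  next
    case False
    have "int (nat \<bar>D\<bar> mod 4) = (- D) mod 4" using False by (simp add: zmod_int)
    also have "\<dots> = 3" using D by presburger
    finally have "nat \<bar>D\<bar> mod 4 = 3" by simp
    then show ?thesis using False by (simp add: sign_mod4_def)
  qed
  moreover have "odd (nat \<bar>D\<bar>)" using \<open>odd D\<close> by (simp add: even_nat_iff)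
  ultimately show ?thesis using Legendre_sign_mod4[OF assms(1,2), of "nat \<bar>D\<bar>"] by simp
qed

text \<open>Otherwise the squares of the numbers from 1 to (q - 1) / 2, to which the symmetry of
  \<open>v\<close> and \<open>q - v\<close> reduces everything, would cover all q - 1 non-zero
  residues.\<close>

lemma exists_Legendre_minus_one:
  assumes "prime q" "q > 2"
  shows "\<exists>u. Legendre (int u) (int q) = -1"
proof (rule ccontr)
  assume "\<not> ?thesis"
  then have all: "Legendre (int u) (int q) \<noteq> -1" for u by blast
  have q: "odd q" using assms prime_odd_nat by blast
  let ?S = "{1..<q}" and ?f = "\<lambda>y. y\<^sup>2 mod q"
  have surj: "?S \<subseteq> ?f ` {1..(q - 1) div 2}"
  proof
    fix u assume u: "u \<in> ?S"
    then have "\<not> q dvd u" by (auto dest: dvd_imp_le)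
    then have "QuadRes (int q) (int u)" using all[of u]
      by (auto simp: Legendre_def cong_0_iff split: if_splits)
    then obtain y where y: "[y\<^sup>2 = int u] (mod int q)" by (auto simp: QuadRes_def)
    define v where "v = nat (y mod int q)"
    have v: "int v = y mod int q" using assms by (simp add: v_def)
    have "[(int v)\<^sup>2 = int u] (mod int q)" unfolding v using y by (simp add: unique_euclidean_semiring_class.cong_def power_mod)
    then have "[v\<^sup>2 = u] (mod q)" by (simp flip: cong_int_iff)
    then have vu: "v\<^sup>2 mod q = u" using u by (simp add: unique_euclidean_semiring_class.cong_def)
    have "v < q" using v assms by (metis pos_mod_bound of_nat_less_iff of_nat_0_less_iff prime_gt_0_nat)
    have "v > 0" using vu u by (cases v) auto
    show "u \<in> ?f ` {1..(q - 1) div 2}"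
    proof (cases "v \<le> (q - 1) div 2")
      case True
      then show ?thesis using vu \<open>v > 0\<close> by auto
    next
      case False
      have "int ((q - v)\<^sup>2) = (int q - int v)\<^sup>2" using \<open>v < q\<close> by (simp add: of_nat_diff)
      also have "\<dots> = (int v)\<^sup>2 + int q * (int q - 2 * int v)"
        by (simp add: power2_eq_square algebra_simps)
      finally have "int ((q - v)\<^sup>2) mod int q = (int v)\<^sup>2 mod int q" by simp
      then have "(q - v)\<^sup>2 mod q = u" using vu by (metis of_nat_eq_iff of_nat_mod of_nat_power)
      moreover have "q - v \<in> {1..(q - 1) div 2}" using False \<open>v < q\<close> q by auto presburger
      ultimately show ?thesis by auto
    qed
  qed
  have "q - 1 = card ?S" by simp
  also have "\<dots> \<le> card (?f ` {1..(q - 1) div 2})" by (intro card_mono surj) auto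
  also have "\<dots> \<le> (q - 1) div 2" using card_image_le[of "{1..(q - 1) div 2}" ?f] by simp
  finally show False using assms by auto
qed

lemma odd_multiplicity_of_nonsquare:
  assumes "m > 0" "\<not> is_square (m :: nat)"
  shows "\<exists>q. prime q \<and> odd (multiplicity q m)"
proof (rule ccontr)
  assume "\<not> ?thesis"
  then have "is_square m"
    using assms(1) by (auto simp: is_nth_power_conv_multiplicity_nat)
  then show False using assms(2) by simp
qed

lemma jacobi_prime_power: "prime q \<Longrightarrow> jacobi (q ^ k) n = Legendre (int n) (int q) ^ k"
  by (simp add: jacobi_def prime_factorization_prime_power)

text \<open>Some prime \<open>q\<close> has odd exponent in \<open>m\<close>. The Chinese remainder
  theorem gives a \<open>u\<close> that is a nonresidue modulo \<open>q\<close> and 1 modulo the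
  part of \<open>m\<close> prime to \<open>q\<close>; the odd exponent preserves the sign.\<close>

lemma exists_jacobi_minus_one:
  assumes m: "odd m" "\<not> is_square m"
  shows "\<exists>u. coprime u m \<and> jacobi m u = -1"
proof -
  have "m > 0" using m by (cases m) auto
  then obtain q where q: "prime q" "odd (multiplicity q m)"
    using odd_multiplicity_of_nonsquare m by blast
  let ?k = "multiplicity q m"
  obtain r where r: "m = q ^ ?k * r" "\<not> q dvd r"
    using multiplicity_decompose'[of m q] \<open>m > 0\<close> q(1) by (metis neq0_conv not_prime_unit)
  have "q dvd m" using q(2) r(1) by (metis dvd_mult2 dvd_power odd_pos)
  then have "q > 2" using m(1) q(1) prime_ge_2_nat[of q] by (cases "q = 2") auto
  have cop: "coprime (q ^ ?k) r" using q(1) r(2) by (simp add: prime_imp_coprime)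
  have "r > 0" using r \<open>m > 0\<close> by (cases r) auto
  obtain a where a: "Legendre (int a) (int q) = -1" using exists_Legendre_minus_one[OF q(1) \<open>q > 2\<close>] by blast
  then have "\<not> q dvd a" using Legendre_eq_0_iff[of "int a" "int q"] by auto
  obtain u where u: "[u = a] (mod q ^ ?k)" "[u = 1] (mod r)"
    using binary_chinese_remainder_nat[OF cop] by blast
  have "jacobi (q ^ ?k) u = (-1) ^ ?k"
    using jacobi_cong[OF u(1)] a q(1) by (simp add: jacobi_prime_power)
  moreover have "jacobi r u = 1" using jacobi_cong[OF u(2)] by simp
  ultimately have "jacobi m u = -1"
    using q prime_gt_0_nat[OF q(1)] \<open>r > 0\<close> by (subst r(1)) (simp add: jacobi_mult_left)
  moreover have "coprime u m"
  proof -
    have "coprime a (q ^ ?k)"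
      using prime_imp_coprime[OF q(1) \<open>\<not> q dvd a\<close>] by (simp add: coprime_commute)
    then have "coprime u (q ^ ?k)" using u(1) cong_imp_coprime cong_sym by blast
    moreover have "coprime u r" using u(2) cong_imp_coprime cong_sym by (metis coprime_1_left)
    ultimately show ?thesis by (subst r(1)) simp
  qed
  ultimately show ?thesis by blast
qed

text \<open>Multiplication by a unit of symbol -1 permutes the residues and negates the sum.\<close>

lemma sum_jacobi_period:
  assumes m: "odd m" "\<not> is_square m"
  shows "(\<Sum>n<m. jacobi m n) = 0"
proof -
  obtain u where u: "coprime u m" "jacobi m u = -1" using exists_jacobi_minus_one[OF m] by blast
  have "m > 0" using m by (cases m) auto
  have inj: "inj_on (\<lambda>n. u * n mod m) {..<m}"
  proof (rule inj_onI)
    fix a b assume ab: "a \<in> {..<m}" "b \<in> {..<m}" "u * a mod m = u * b mod m"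
    then have "[a = b] (mod m)" using u(1) cong_mult_lcancel_nat by (metis unique_euclidean_semiring_class.cong_def coprime_commute)
    with ab show "a = b" by (simp add: unique_euclidean_semiring_class.cong_def)
  qed
  moreover have "(\<lambda>n. u * n mod m) ` {..<m} = {..<m}"
    by (rule endo_inj_surj) (use inj \<open>m > 0\<close> in auto)
  ultimately have "bij_betw (\<lambda>n. u * n mod m) {..<m} {..<m}"
    by (simp add: bij_betw_def)
  then have "(\<Sum>n<m. jacobi m n) = (\<Sum>n<m. jacobi m (u * n mod m))"
    by (rule sum.reindex_bij_betw[symmetric])
  also have "\<dots> = (\<Sum>n<m. jacobi m (u * n))"
    by (intro sum.cong refl jacobi_cong) (simp add: unique_euclidean_semiring_class.cong_def)
  also have "\<dots> = - (\<Sum>n<m. jacobi m n)"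
    using u(2) by (simp add: jacobi_mult_right[OF m(1)] sum_negf)
  finally show ?thesis by simp
qed

text \<open>Negative \<open>D\<close> is the case at issue: its absolute value is 3 modulo 4, hence
  no square.\<close>

lemma nonsquare_abs:
  assumes "[D = 1] (mod 4)" "\<not> is_square (D :: int)"
  shows "\<not> is_square (nat \<bar>D\<bar>)"
proof
  assume "is_square (nat \<bar>D\<bar>)"
  then obtain k where k: "nat \<bar>D\<bar> = k\<^sup>2" by (auto elim: is_nth_powerE)
  then have k': "\<bar>D\<bar> = (int k)\<^sup>2" by (metis abs_ge_zero nat_eq_iff2 of_nat_power)
  show False
  proof (cases "D \<ge> 0")
    case True
    then show ?thesis using k' assms(2) by (metis abs_of_nonneg is_nth_powerI)
  next
    case False
    have "(int k)\<^sup>2 mod 4 = 0 \<or> (int k)\<^sup>2 mod 4 = 1"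
    proof (cases "even (int k)")
      case True
      then show ?thesis by (auto elim!: evenE simp: power_mult_distrib)
    next
      case False
      then obtain j where "int k = 2 * j + 1" by (auto elim: oddE)
      then have "(int k)\<^sup>2 = 4 * (j\<^sup>2 + j) + 1" by (simp add: power2_eq_square algebra_simps)
      then show ?thesis by presburger
    qed
    moreover have "D mod 4 = 1" using assms(1) by (simp add: unique_euclidean_semiring_class.cong_def)
    ultimately show ?thesis using k' False by presburger
  qed
qed

section \<open>Hexagons and decagons\<close>

fun vieta_seq :: "int \<Rightarrow> int \<Rightarrow> nat \<Rightarrow> int" where
  "vieta_seq w z 0 = z"
| "vieta_seq w z (Suc 0) = w"
| "vieta_seq w z (Suc (Suc n)) = w * vieta_seq w z (Suc n) - vieta_seq w z n"

text \<open>The recurrence is linear of order two, so the sign change has to be checked at two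
  consecutive places only.\<close>

lemma vieta_seq_anti:
  assumes "[vieta_seq w z N = - z] (mod m)" "[vieta_seq w z (Suc N) = - w] (mod m)"
  shows "[vieta_seq w z (n + N) = - vieta_seq w z n] (mod m)"
proof (induction n rule: induct_nat_012)
  case (ge2 n)
  have "[w * vieta_seq w z (Suc n + N) - vieta_seq w z (n + N) =
      w * (- vieta_seq w z (Suc n)) - (- vieta_seq w z n)] (mod m)"
    by (intro cong_diff cong_mult cong_refl ge2)
  then show ?case by simp
qed (use assms in simp_all)

lemma vieta_polygonI:
  assumes "prime p" "p > 3" "N > 0"
    and "[vieta_seq w z N = - z] (mod int p)" "[vieta_seq w z (Suc N) = - w] (mod int p)"
    and "[2 * w\<^sup>2 + z\<^sup>2 = w\<^sup>2 * z + \<kappa>] (mod int p)"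
    and "\<And>i. i < N \<Longrightarrow> \<not> int p dvd vieta_seq w z i"
    and "\<And>i j. i < j \<Longrightarrow> j < N \<Longrightarrow> \<not> [(vieta_seq w z i)\<^sup>2 = (vieta_seq w z j)\<^sup>2] (mod int p)"
  shows "vieta_polygon p N \<kappa> (vieta_seq w z)"
  using assms by unfold_locales (simp_all add: vieta_seq_anti)

lemma half_mod_odd:
  assumes "odd (p :: nat)"
  shows "\<exists>z. [2 * z = a] (mod int p)"
proof -
  have "coprime 2 (int p)" using assms by simp
  then show ?thesis using cong_solve_coprime_int[of 2 "int p"]
    by (metis cong_scalar_right mult.assoc mult_1)
qed

lemma prime_dvd_4_mult_imp:
  assumes "prime p" "p > (3 :: nat)" "int p dvd 4 * x"
  shows "int p dvd x"
proof -
  have "\<not> int p dvd 2 * 2"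
  proof
    assume "int p dvd 2 * 2"
    then have "int p dvd 2" using assms(1) by (simp only: prime_dvd_mult_iff prime_nat_int_transfer) blast
    then show False using assms(2) zdvd_imp_le[of "int p" 2] by simp
  qed
  then show ?thesis using assms by (simp add: prime_dvd_mult_iff)
qed

text \<open>The sequence is z, 1, 1 - z up to sign. A zero entry means z = 0 or z = 1, that is
  \<kappa> = 2; equal squares mean z = -1 or z = 2, that is \<kappa> = 4, or z = 0, \<kappa> = 2
  again, or 2 z = 1, where the discriminant 4 \<kappa> - 7 vanishes.\<close>

lemma vieta_polygon_triangle:
  assumes p: "prime p" "p > 3" and L: "Legendre (4 * \<kappa> - 7) (int p) = 1"
    and nd: "\<not> int p dvd \<kappa> - 2" "\<not> int p dvd \<kappa> - 4"
  shows "\<exists>z. vieta_polygon p 3 \<kappa> (vieta_seq 1 z)"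
proof -
  have "odd p" using p prime_odd_nat by simp
  have pr: "prime (int p)" using p by simp
  obtain y where y: "[y\<^sup>2 = 4 * \<kappa> - 7] (mod int p)" and y0: "\<not> int p dvd 4 * \<kappa> - 7"
    using L by (auto simp: Legendre_def QuadRes_def cong_0_iff split: if_splits)
  obtain z where z: "[2 * z = 1 + y] (mod int p)" using half_mod_odd[OF \<open>odd p\<close>] by blast
  have "int p dvd y\<^sup>2 - (4 * \<kappa> - 7)" "int p dvd 2 * z - (1 + y)"
    using y z by (simp_all add: cong_iff_dvd_diff)
  \<comment> \<open>Completing the square turns the root \<open>y\<close> of the discriminant into a
    root \<open>z\<close> of the quadratic equation.\<close>
  then have "int p dvd (2 * z - (1 + y)) * (2 * z - 1 + y) + (y\<^sup>2 - (4 * \<kappa> - 7))" by (intro dvd_add dvd_mult2)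
  also have "(2 * z - (1 + y)) * (2 * z - 1 + y) + (y\<^sup>2 - (4 * \<kappa> - 7)) = 4 * (z\<^sup>2 - z + 2 - \<kappa>)"
    by (simp add: power2_eq_square algebra_simps)
  finally have zk: "int p dvd z\<^sup>2 - z + 2 - \<kappa>" using prime_dvd_4_mult_imp[OF p] by blast
  \<comment> \<open>Division with remainder: if the linear factor \<open>d\<close> vanishes modulo
    \<open>p\<close>, so does the remainder \<open>c\<close>.\<close>
  have red: "int p dvd c" if "int p dvd d" "z\<^sup>2 - z + 2 - \<kappa> = d * e + c" for c d e
  proof -
    have "c = (z\<^sup>2 - z + 2 - \<kappa>) - d * e" using that(2) by simp
    then show ?thesis using that(1) zk by simp
  qed
  have z0: "\<not> int p dvd z" using nd(1) red[of z "z - 1" "2 - \<kappa>"]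
    by (auto simp: power2_eq_square algebra_simps dvd_diff_commute)
  have z1: "\<not> int p dvd z - 1" using nd(1) red[of "z - 1" "z" "2 - \<kappa>"]
    by (auto simp: power2_eq_square algebra_simps dvd_diff_commute)
  have zm1: "\<not> int p dvd z + 1" using nd(2) red[of "z + 1" "z - 2" "4 - \<kappa>"]
    by (auto simp: power2_eq_square algebra_simps dvd_diff_commute)
  have z2: "\<not> int p dvd z - 2" using nd(2) red[of "z - 2" "z + 1" "4 - \<kappa>"]
    by (auto simp: power2_eq_square algebra_simps dvd_diff_commute)
  have zh: "\<not> int p dvd 2 * z - 1"
  proof
    assume "int p dvd 2 * z - 1"
    then have "int p dvd (2 * z - 1) * (2 * z - 1) - 4 * (z\<^sup>2 - z + 2 - \<kappa>)"
      using zk by (metis dvd_diff dvd_mult)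
    then show False using y0 by (simp add: power2_eq_square algebra_simps)
  qed
  have not_sq: "\<not> [a\<^sup>2 = b\<^sup>2] (mod int p)" if "\<not> int p dvd a - b" "\<not> int p dvd a + b" for a b
    using that pr by (simp add: cong_iff_dvd_diff power2_eq_square square_diff_square_factored prime_dvd_mult_iff)
  have "vieta_polygon p 3 \<kappa> (vieta_seq 1 z)"
  proof (rule vieta_polygonI)
    show "[2 * 1\<^sup>2 + z\<^sup>2 = 1\<^sup>2 * z + \<kappa>] (mod int p)"
      using zk by (simp add: cong_iff_dvd_diff algebra_simps)
    show "\<not> int p dvd vieta_seq 1 z i" if "i < 3" for i
      using that z0 z1 p by (auto simp: less_Suc_eq numeral_eq_Suc dvd_diff_commute)
    show "\<not> [(vieta_seq 1 z i)\<^sup>2 = (vieta_seq 1 z j)\<^sup>2] (mod int p)" if "i < j" "j < 3" for i j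
    proof -
      have "i = 0 \<and> j = 1 \<or> i = 0 \<and> j = 2 \<or> i = 1 \<and> j = 2" using that by auto
      then consider "i = 0" "j = 1" | "i = 0" "j = 2" | "i = 1" "j = 2" by blast
      then show ?thesis
      proof cases
        case 1
        then show ?thesis using not_sq[of z 1] z1 zm1 by simp
      next
        case 2
        then show ?thesis using not_sq[of z "1 - z"] zh p by (simp add: numeral_2_eq_2)
      next
        case 3
        then show ?thesis using not_sq[of 1 "1 - z"] z0 z2 by (simp add: numeral_2_eq_2 dvd_diff_commute)
      qed
    qed
  qed (use p in \<open>simp_all add: numeral_eq_Suc\<close>)
  then show ?thesis by blast
qed

lemma K33_primes_of_Legendre_triangle:
  assumes "prime p" "p > 3" "Legendre (4 * \<kappa> - 7) (int p) = 1"
    and "\<not> int p dvd \<kappa> - 2" "\<not> int p dvd \<kappa> - 4"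
  shows "p \<in> K33_primes \<kappa>"
  using vieta_polygon_triangle[OF assms] vieta_polygon.K33_primes_triangle by blast

text \<open>
  With \<open>w\<^sup>2 = w + 1\<close>, eliminating \<open>z\<close> from \<open>(a\<^sub>0 + a\<^sub>1 w) z + b\<^sub>0 + b\<^sub>1 w = 0\<close> and
  \<open>z\<^sup>2 - w\<^sup>2 z + 2 w\<^sup>2 = \<kappa>\<close> leaves an equation \<open>A + B w = 0\<close>; this is its norm from
  \<open>\<rat>(\<surd>5)\<close> to \<open>\<rat>\<close>.
\<close>

definition norm_form :: "int \<Rightarrow> int \<Rightarrow> int \<Rightarrow> int \<Rightarrow> int \<Rightarrow> int" where
  "norm_form a\<^sub>0 a\<^sub>1 b\<^sub>0 b\<^sub>1 \<kappa> = (let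
     c\<^sub>0 = a\<^sub>0\<^sup>2 + a\<^sub>1\<^sup>2; c\<^sub>1 = 2 * a\<^sub>0 * a\<^sub>1 + a\<^sub>1\<^sup>2;
     d\<^sub>0 = a\<^sub>0 * b\<^sub>0 + a\<^sub>1 * b\<^sub>1; d\<^sub>1 = a\<^sub>0 * b\<^sub>1 + a\<^sub>1 * b\<^sub>0 + a\<^sub>1 * b\<^sub>1;
     e\<^sub>0 = b\<^sub>0\<^sup>2 + b\<^sub>1\<^sup>2; e\<^sub>1 = 2 * b\<^sub>0 * b\<^sub>1 + b\<^sub>1\<^sup>2;
     A = e\<^sub>0 + d\<^sub>0 + d\<^sub>1 + (2 - \<kappa>) * c\<^sub>0 + 2 * c\<^sub>1;
     B = e\<^sub>1 + d\<^sub>0 + 2 * d\<^sub>1 + 2 * c\<^sub>0 + (4 - \<kappa>) * c\<^sub>1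
   in A\<^sup>2 + A * B - B\<^sup>2)"

lemma dvd_norm_form:
  assumes w: "[w\<^sup>2 = w + 1] (mod m)" and z: "[2 * w\<^sup>2 + z\<^sup>2 = w\<^sup>2 * z + \<kappa>] (mod m)"
    and dvd: "m dvd (a\<^sub>0 + a\<^sub>1 * w) * z + (b\<^sub>0 + b\<^sub>1 * w)"
  shows "m dvd norm_form a\<^sub>0 a\<^sub>1 b\<^sub>0 b\<^sub>1 \<kappa>"
proof -
  define a b where "a = a\<^sub>0 + a\<^sub>1 * w" and "b = b\<^sub>0 + b\<^sub>1 * w"
  define c\<^sub>0 c\<^sub>1 d\<^sub>0 d\<^sub>1 e\<^sub>0 e\<^sub>1 where "c\<^sub>0 = a\<^sub>0\<^sup>2 + a\<^sub>1\<^sup>2" and "c\<^sub>1 = 2 * a\<^sub>0 * a\<^sub>1 + a\<^sub>1\<^sup>2"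
    and "d\<^sub>0 = a\<^sub>0 * b\<^sub>0 + a\<^sub>1 * b\<^sub>1" and "d\<^sub>1 = a\<^sub>0 * b\<^sub>1 + a\<^sub>1 * b\<^sub>0 + a\<^sub>1 * b\<^sub>1"
    and "e\<^sub>0 = b\<^sub>0\<^sup>2 + b\<^sub>1\<^sup>2" and "e\<^sub>1 = 2 * b\<^sub>0 * b\<^sub>1 + b\<^sub>1\<^sup>2"
  define A B where "A = e\<^sub>0 + d\<^sub>0 + d\<^sub>1 + (2 - \<kappa>) * c\<^sub>0 + 2 * c\<^sub>1"
    and "B = e\<^sub>1 + d\<^sub>0 + 2 * d\<^sub>1 + 2 * c\<^sub>0 + (4 - \<kappa>) * c\<^sub>1"
  define D where "D = w\<^sup>2 - w - 1"
  have D: "m dvd D" using w by (simp add: D_def cong_iff_dvd_diff algebra_simps)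
  have Y: "m dvd z\<^sup>2 - w\<^sup>2 * z + 2 * w\<^sup>2 - \<kappa>" using z by (simp add: cong_iff_dvd_diff algebra_simps)
  \<comment> \<open>Polynomial division in \<open>z\<close> by the linear form
    \<open>a * z + b\<close>. Scaling by the square of \<open>a\<close> avoids inverting
    \<open>a\<close>, and the remainder is free of \<open>z\<close>.\<close>
  have "m dvd a\<^sup>2 * (z\<^sup>2 - w\<^sup>2 * z + 2 * w\<^sup>2 - \<kappa>) - (a * z + b) * (a * z - b - a * w\<^sup>2)"
    using dvd_diff[OF dvd_mult[OF Y, of "a\<^sup>2"] dvd_mult2[of m "a * z + b" "a * z - b - a * w\<^sup>2"]] dvd
    by (simp only: a_def b_def)
  also have "a\<^sup>2 * (z\<^sup>2 - w\<^sup>2 * z + 2 * w\<^sup>2 - \<kappa>) - (a * z + b) * (a * z - b - a * w\<^sup>2)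
      = b\<^sup>2 + w\<^sup>2 * (a * b) + a\<^sup>2 * (2 * w\<^sup>2 - \<kappa>)"
    by (simp add: power2_eq_square algebra_simps)
  finally have G: "m dvd b\<^sup>2 + w\<^sup>2 * (a * b) + a\<^sup>2 * (2 * w\<^sup>2 - \<kappa>)" .
  have a2: "a\<^sup>2 = c\<^sub>0 + c\<^sub>1 * w + D * a\<^sub>1\<^sup>2"
    by (simp add: a_def c\<^sub>0_def c\<^sub>1_def D_def power2_eq_square algebra_simps)
  have ab: "a * b = d\<^sub>0 + d\<^sub>1 * w + D * (a\<^sub>1 * b\<^sub>1)"
    by (simp add: a_def b_def d\<^sub>0_def d\<^sub>1_def D_def power2_eq_square algebra_simps)
  have b2: "b\<^sup>2 = e\<^sub>0 + e\<^sub>1 * w + D * b\<^sub>1\<^sup>2"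
    by (simp add: b_def e\<^sub>0_def e\<^sub>1_def D_def power2_eq_square algebra_simps)
  have red: "[x + D * y = x] (mod m)" for x y using D by (simp add: cong_iff_dvd_diff)
  have w2: "w\<^sup>2 = w + 1 + D * 1" by (simp add: D_def)
  have "[b\<^sup>2 + w\<^sup>2 * (a * b) + a\<^sup>2 * (2 * w\<^sup>2 - \<kappa>) = (e\<^sub>0 + e\<^sub>1 * w) + (w + 1) * (d\<^sub>0 + d\<^sub>1 * w)
      + (c\<^sub>0 + c\<^sub>1 * w) * (2 * (w + 1) - \<kappa>)] (mod m)"
    unfolding a2 ab b2 using w by (intro cong_add cong_mult cong_diff cong_refl red) auto
  also have "(e\<^sub>0 + e\<^sub>1 * w) + (w + 1) * (d\<^sub>0 + d\<^sub>1 * w) + (c\<^sub>0 + c\<^sub>1 * w) * (2 * (w + 1) - \<kappa>)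
      = A + B * w + D * (d\<^sub>1 + 2 * c\<^sub>1)"
    by (simp add: A_def B_def D_def power2_eq_square algebra_simps)
  also have "[\<dots> = A + B * w] (mod m)" by (rule red)
  finally have "m dvd A + B * w" using G by (metis cong_dvd_iff)
  \<comment> \<open>\<open>A + B - B * w\<close> is the conjugate of \<open>A + B * w\<close> under
    the exchange of \<open>w\<close> and \<open>1 - w\<close>.\<close>
  then have "m dvd (A + B * w) * (A + B - B * w) + D * B\<^sup>2"
    using D by simp
  also have "(A + B * w) * (A + B - B * w) + D * B\<^sup>2 = A\<^sup>2 + A * B - B\<^sup>2"
    by (simp add: D_def power2_eq_square algebra_simps)
  also have "\<dots> = norm_form a\<^sub>0 a\<^sub>1 b\<^sub>0 b\<^sub>1 \<kappa>"
    by (simp add: norm_form_def Let_def A_def B_def c\<^sub>0_def c\<^sub>1_def d\<^sub>0_def d\<^sub>1_def e\<^sub>0_def e\<^sub>1_def)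
  finally show ?thesis .
qed

text \<open>The 25 argument lists are the five terms of the sequence for N = 5, written as linear
  forms in \<open>z\<close> over the integers extended by \<open>w\<close>, and the ten sums and ten
  differences of two terms. The value 1 belongs to combinations in which \<open>z\<close> cancels,
  leaving a unit. The form 2 z - w^2 vanishes at a double root, so its norm is the norm of the
  discriminant.\<close>

lemma norm_form_values:
  "norm_form 1 0 0 0 \<kappa> = \<kappa>\<^sup>2 - 6 * \<kappa> + 4"
  "norm_form (-1) 0 1 1 \<kappa> = \<kappa>\<^sup>2 - 6 * \<kappa> + 4"
  "norm_form 1 (-1) 0 1 \<kappa> = \<kappa>\<^sup>2 - 6 * \<kappa> + 4"
  "norm_form 0 (-1) 1 2 \<kappa> = \<kappa>\<^sup>2 - 6 * \<kappa> + 4"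
  "norm_form 0 1 0 0 \<kappa> = \<kappa>\<^sup>2 - 6 * \<kappa> + 4"
  "norm_form (-1) 1 0 0 \<kappa> = \<kappa>\<^sup>2 - 6 * \<kappa> + 4"
  "norm_form 0 (-1) 1 1 \<kappa> = \<kappa>\<^sup>2 - 5 * \<kappa> + 5"
  "norm_form 0 (-1) 0 1 \<kappa> = \<kappa>\<^sup>2 - 5 * \<kappa> + 5"
  "norm_form 1 0 0 (-1) \<kappa> = \<kappa>\<^sup>2 - 5 * \<kappa> + 5"
  "norm_form 1 1 (-1) (-1) \<kappa> = \<kappa>\<^sup>2 - 5 * \<kappa> + 5"
  "norm_form 1 0 (-1) 0 \<kappa> = \<kappa>\<^sup>2 - 5 * \<kappa> + 5"
  "norm_form (-1) (-1) 1 2 \<kappa> = \<kappa>\<^sup>2 - 5 * \<kappa> + 5"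
  "norm_form 1 0 0 1 \<kappa> = \<kappa>\<^sup>2 - 13 * \<kappa> + 11"
  "norm_form 1 (-1) 1 1 \<kappa> = \<kappa>\<^sup>2 - 13 * \<kappa> + 11"
  "norm_form (-1) 0 1 2 \<kappa> = \<kappa>\<^sup>2 - 13 * \<kappa> + 11"
  "norm_form (-1) 1 1 0 \<kappa> = \<kappa>\<^sup>2 - 13 * \<kappa> + 11"
  "norm_form 2 0 (-1) (-1) \<kappa> = 16 * \<kappa>\<^sup>2 - 68 * \<kappa> + 41"
  "norm_form 0 (-2) 1 2 \<kappa> = 16 * \<kappa>\<^sup>2 - 68 * \<kappa> + 41"
  "norm_form 1 1 0 (-1) \<kappa> = (\<kappa> - 4)\<^sup>2"
  "norm_form 0 1 (-1) 0 \<kappa> = (\<kappa> - 4)\<^sup>2"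
  "norm_form 0 (-1) 0 2 \<kappa> = (\<kappa> - 4)\<^sup>2"
  "norm_form (-1) (-1) 2 2 \<kappa> = (\<kappa> - 4)\<^sup>2"
  "norm_form 0 0 0 1 \<kappa> = 1"
  "norm_form 0 0 1 1 \<kappa> = 1"
  "norm_form 0 0 1 0 \<kappa> = 1"
  by (simp_all add: norm_form_def Let_def power2_eq_square algebra_simps)

text \<open>A vanishing term, or two terms with equal squares, makes a term or a sum or difference
  of terms vanish; its norm in \<kappa> is then divisible by \<open>p\<close>. The excluded
  polynomials are exactly the norms that occur.\<close>

lemma vieta_polygon_pentagon:
  assumes p: "prime p" "p > 3" and w: "[w\<^sup>2 = w + 1] (mod int p)"
    and z: "[2 * w\<^sup>2 + z\<^sup>2 = w\<^sup>2 * z + \<kappa>] (mod int p)"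
    and nd: "\<not> int p dvd \<kappa> - 4" "\<not> int p dvd \<kappa>\<^sup>2 - 6 * \<kappa> + 4" "\<not> int p dvd \<kappa>\<^sup>2 - 5 * \<kappa> + 5"
      "\<not> int p dvd \<kappa>\<^sup>2 - 13 * \<kappa> + 11" "\<not> int p dvd 16 * \<kappa>\<^sup>2 - 68 * \<kappa> + 41"
  shows "vieta_polygon p 5 \<kappa> (vieta_seq w z)"
proof (rule vieta_polygonI)
  have pr: "prime (int p)" using p by simp
  have n1: "\<not> int p dvd (\<kappa> - 4)\<^sup>2" using nd(1) pr by (simp add: prime_dvd_power_iff)
  note nd = nd(2-5) n1 p(2)
  let ?s = "vieta_seq w z"
  let ?lin = "\<lambda>a\<^sub>0 a\<^sub>1 b\<^sub>0 b\<^sub>1. (a\<^sub>0 + a\<^sub>1 * w) * z + (b\<^sub>0 + b\<^sub>1 * w)"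
  define D where "D = w\<^sup>2 - w - 1"
  have D: "int p dvd D" using w by (simp add: D_def cong_iff_dvd_diff algebra_simps)
  \<comment> \<open>The witnesses given for \<open>c\<close> below are the quotients on division by
    \<open>w\<^sup>2 - w - 1\<close>.\<close>
  have congD: "[x = y] (mod int p)" if "x - y = D * c" for x y c
    using D that by (simp add: cong_iff_dvd_diff)
  have s0: "[?s 0 = ?lin 1 0 0 0] (mod int p)" by simp
  have s1: "[?s 1 = ?lin 0 0 0 1] (mod int p)" by simp
  have s2: "[?s 2 = ?lin (-1) 0 1 1] (mod int p)"
    by (rule congD[of _ _ 1]) (simp add: numeral_eq_Suc D_def power2_eq_square algebra_simps)
  have s3: "[?s 3 = ?lin 0 (-1) 1 1] (mod int p)"
    by (rule congD[of _ _ "w + 1"]) (simp add: numeral_eq_Suc D_def power2_eq_square algebra_simps)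
  have s4: "[?s 4 = ?lin 0 (-1) 0 1] (mod int p)"
    by (rule congD[of _ _ "w\<^sup>2 + w - z"]) (simp add: numeral_eq_Suc D_def power2_eq_square algebra_simps)
  show "[?s 5 = - z] (mod int p)"
    by (rule congD[of _ _ "w * (w\<^sup>2 + w - 1) - z * (w + 1)"])
      (simp add: numeral_eq_Suc D_def power2_eq_square algebra_simps)
  show "[?s (Suc 5) = - w] (mod int p)"
    by (rule congD[of _ _ "w * (w ^ 3 + w\<^sup>2 - 2 * w - 1) - z * (w\<^sup>2 + w - 1)"])
      (simp add: numeral_eq_Suc D_def power2_eq_square power3_eq_cube algebra_simps)
  have not_sq: "\<not> [(?s i)\<^sup>2 = (?s j)\<^sup>2] (mod int p)"
    if "[?s i = ?lin a\<^sub>0 a\<^sub>1 b\<^sub>0 b\<^sub>1] (mod int p)" "[?s j = ?lin c\<^sub>0 c\<^sub>1 d\<^sub>0 d\<^sub>1] (mod int p)"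
      "\<not> int p dvd norm_form (a\<^sub>0 - c\<^sub>0) (a\<^sub>1 - c\<^sub>1) (b\<^sub>0 - d\<^sub>0) (b\<^sub>1 - d\<^sub>1) \<kappa>"
      "\<not> int p dvd norm_form (a\<^sub>0 + c\<^sub>0) (a\<^sub>1 + c\<^sub>1) (b\<^sub>0 + d\<^sub>0) (b\<^sub>1 + d\<^sub>1) \<kappa>"
    for i j a\<^sub>0 a\<^sub>1 b\<^sub>0 b\<^sub>1 c\<^sub>0 c\<^sub>1 d\<^sub>0 d\<^sub>1
  proof
    assume "[(?s i)\<^sup>2 = (?s j)\<^sup>2] (mod int p)"
    moreover have "[(?s i)\<^sup>2 - (?s j)\<^sup>2 = (?lin a\<^sub>0 a\<^sub>1 b\<^sub>0 b\<^sub>1)\<^sup>2 - (?lin c\<^sub>0 c\<^sub>1 d\<^sub>0 d\<^sub>1)\<^sup>2] (mod int p)"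
      by (intro cong_diff cong_pow that(1,2))
    ultimately have "int p dvd (?lin a\<^sub>0 a\<^sub>1 b\<^sub>0 b\<^sub>1)\<^sup>2 - (?lin c\<^sub>0 c\<^sub>1 d\<^sub>0 d\<^sub>1)\<^sup>2"
      by (metis cong_dvd_iff cong_iff_dvd_diff)
    also have "(?lin a\<^sub>0 a\<^sub>1 b\<^sub>0 b\<^sub>1)\<^sup>2 - (?lin c\<^sub>0 c\<^sub>1 d\<^sub>0 d\<^sub>1)\<^sup>2 =
      ?lin (a\<^sub>0 - c\<^sub>0) (a\<^sub>1 - c\<^sub>1) (b\<^sub>0 - d\<^sub>0) (b\<^sub>1 - d\<^sub>1) * ?lin (a\<^sub>0 + c\<^sub>0) (a\<^sub>1 + c\<^sub>1) (b\<^sub>0 + d\<^sub>0) (b\<^sub>1 + d\<^sub>1)"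
      by (simp add: power2_eq_square algebra_simps)
    finally show False
      using dvd_norm_form[OF w z] that(3,4) pr by (auto simp: prime_dvd_mult_iff)
  qed
  have not_0: "\<not> int p dvd ?s i"
    if "[?s i = ?lin a\<^sub>0 a\<^sub>1 b\<^sub>0 b\<^sub>1] (mod int p)" "\<not> int p dvd norm_form a\<^sub>0 a\<^sub>1 b\<^sub>0 b\<^sub>1 \<kappa>" for i a\<^sub>0 a\<^sub>1 b\<^sub>0 b\<^sub>1
    using dvd_norm_form[OF w z] that cong_dvd_iff by blast
  show "\<not> int p dvd ?s i" if "i < 5" for i
  proof -
    have "i = 0 \<or> i = 1 \<or> i = 2 \<or> i = 3 \<or> i = 4" using that by auto
    then consider "i = 0" | "i = 1" | "i = 2" | "i = 3" | "i = 4" by blast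
    then show ?thesis
    proof cases
      case 1 show ?thesis unfolding 1 by (rule not_0[OF s0]) (use nd in \<open>simp add: norm_form_values\<close>)
    next
      case 2 show ?thesis unfolding 2 by (rule not_0[OF s1]) (use nd in \<open>simp add: norm_form_values\<close>)
    next
      case 3 show ?thesis unfolding 3 by (rule not_0[OF s2]) (use nd in \<open>simp add: norm_form_values\<close>)
    next
      case 4 show ?thesis unfolding 4 by (rule not_0[OF s3]) (use nd in \<open>simp add: norm_form_values\<close>)
    next
      case 5 show ?thesis unfolding 5 by (rule not_0[OF s4]) (use nd in \<open>simp add: norm_form_values\<close>)
    qed
  qed
  show "\<not> [(?s i)\<^sup>2 = (?s j)\<^sup>2] (mod int p)" if "i < j" "j < 5" for i j
  proof -
    have "i = 0 \<and> j = 1 \<or> i = 0 \<and> j = 2 \<or> i = 0 \<and> j = 3 \<or> i = 0 \<and> j = 4 \<or> i = 1 \<and> j = 2 \<or>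
      i = 1 \<and> j = 3 \<or> i = 1 \<and> j = 4 \<or> i = 2 \<and> j = 3 \<or> i = 2 \<and> j = 4 \<or> i = 3 \<and> j = 4"
      using that by presburger
    then consider "i = 0" "j = 1" | "i = 0" "j = 2" | "i = 0" "j = 3" | "i = 0" "j = 4" | "i = 1" "j = 2"
      | "i = 1" "j = 3" | "i = 1" "j = 4" | "i = 2" "j = 3" | "i = 2" "j = 4" | "i = 3" "j = 4"
      by blast
    then show ?thesis
    proof cases
      case 1 show ?thesis unfolding 1 by (rule not_sq[OF s0 s1]) (use nd in \<open>simp_all add: norm_form_values\<close>)
    next
      case 2 show ?thesis unfolding 2 by (rule not_sq[OF s0 s2]) (use nd in \<open>simp_all add: norm_form_values\<close>)
    next
      case 3 show ?thesis unfolding 3 by (rule not_sq[OF s0 s3]) (use nd in \<open>simp_all add: norm_form_values\<close>)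
    next
      case 4 show ?thesis unfolding 4 by (rule not_sq[OF s0 s4]) (use nd in \<open>simp_all add: norm_form_values\<close>)
    next
      case 5 show ?thesis unfolding 5 by (rule not_sq[OF s1 s2]) (use nd in \<open>simp_all add: norm_form_values\<close>)
    next
      case 6 show ?thesis unfolding 6 by (rule not_sq[OF s1 s3]) (use nd in \<open>simp_all add: norm_form_values\<close>)
    next
      case 7 show ?thesis unfolding 7 by (rule not_sq[OF s1 s4]) (use nd in \<open>simp_all add: norm_form_values\<close>)
    next
      case 8 show ?thesis unfolding 8 by (rule not_sq[OF s2 s3]) (use nd in \<open>simp_all add: norm_form_values\<close>)
    next
      case 9 show ?thesis unfolding 9 by (rule not_sq[OF s2 s4]) (use nd in \<open>simp_all add: norm_form_values\<close>)
    next
      case 10 show ?thesis unfolding 10 by (rule not_sq[OF s3 s4]) (use nd in \<open>simp_all add: norm_form_values\<close>)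
    qed
  qed
qed (use p z in simp_all)

lemma K33_primes_of_Legendre_pentagon:
  assumes p: "prime p" "p > 3" and L5: "Legendre 5 (int p) = 1"
    and L: "Legendre (16 * \<kappa>\<^sup>2 - 68 * \<kappa> + 41) (int p) = -1"
    and not_dvd: "\<not> int p dvd (\<kappa> - 4) * (\<kappa>\<^sup>2 - 6 * \<kappa> + 4) * (\<kappa>\<^sup>2 - 5 * \<kappa> + 5) * (\<kappa>\<^sup>2 - 13 * \<kappa> + 11)"
  shows "p \<in> K33_primes \<kappa>"
proof -
  have nd: "\<not> int p dvd \<kappa> - 4" "\<not> int p dvd \<kappa>\<^sup>2 - 6 * \<kappa> + 4" "\<not> int p dvd \<kappa>\<^sup>2 - 5 * \<kappa> + 5"
      "\<not> int p dvd \<kappa>\<^sup>2 - 13 * \<kappa> + 11"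
    using not_dvd by auto
  have "odd p" using p prime_odd_nat by simp
  have pr: "prime (int p)" using p by simp
  obtain y where y: "[y\<^sup>2 = 5] (mod int p)"
    using L5 by (auto simp: Legendre_def QuadRes_def split: if_splits)
  obtain w where w: "[2 * w = 1 + y] (mod int p)" using half_mod_odd[OF \<open>odd p\<close>] by blast
  have "int p dvd y\<^sup>2 - 5" "int p dvd 2 * w - (1 + y)"
    using y w by (simp_all add: cong_iff_dvd_diff)
  then have "int p dvd (2 * w - (1 + y)) * (2 * w - 1 + y) + (y\<^sup>2 - 5)" by (intro dvd_add dvd_mult2)
  also have "(2 * w - (1 + y)) * (2 * w - 1 + y) + (y\<^sup>2 - 5) = 4 * (w\<^sup>2 - w - 1)"
    by (simp add: power2_eq_square algebra_simps)
  finally have D: "int p dvd w\<^sup>2 - w - 1" using prime_dvd_4_mult_imp[OF p] by blast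
  let ?d = "\<lambda>w. 4 * \<kappa> - 6 - 5 * w"
  have "[?d w * ?d (1 - w) = 16 * \<kappa>\<^sup>2 - 68 * \<kappa> + 41] (mod int p)"
  proof -
    have "?d w * ?d (1 - w) - (16 * \<kappa>\<^sup>2 - 68 * \<kappa> + 41) = (-25) * (w\<^sup>2 - w - 1)"
      by (simp add: power2_eq_square algebra_simps)
    then show ?thesis using D by (simp only: cong_iff_dvd_diff dvd_mult)
  qed
  then have "Legendre (?d w * ?d (1 - w)) (int p) = -1" using L by (simp only: Legendre_cong)
  then have "Legendre (?d w) (int p) * Legendre (?d (1 - w)) (int p) = -1"
    using Legendre_mult[of p "?d w" "?d (1 - w)"] p by (simp only:)
  \<comment> \<open>The product of the two symbols is -1, so one of them is 1; \<open>1 - w\<close>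
    is a root as good as \<open>w\<close>.\<close>
  then have "Legendre (?d w) (int p) = 1 \<or> Legendre (?d (1 - w)) (int p) = 1"
    using Legendre_values[of "?d w" p] Legendre_values[of "?d (1 - w)" p] by auto
  moreover have "int p dvd (1 - w)\<^sup>2 - (1 - w) - 1"
    using D by (simp add: power2_eq_square algebra_simps)
  ultimately obtain w where D: "int p dvd w\<^sup>2 - w - 1" and Lw: "Legendre (?d w) (int p) = 1"
    using D by blast
  obtain y where y: "[y\<^sup>2 = ?d w] (mod int p)"
    using Lw by (auto simp: Legendre_def QuadRes_def split: if_splits)
  obtain z where z: "[2 * z = w\<^sup>2 + y] (mod int p)" using half_mod_odd[OF \<open>odd p\<close>] by blast
  have "int p dvd y\<^sup>2 - ?d w" "int p dvd 2 * z - (w\<^sup>2 + y)"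
    using y z by (simp_all add: cong_iff_dvd_diff)
  \<comment> \<open>The equation for \<open>z\<close> has discriminant w^4 - 8 w^2 + 4 \<kappa>;
    subtracting the displayed multiple of w^2 - w - 1 reduces it to \<open>?d w\<close>.\<close>
  then have "int p dvd (2 * z - (w\<^sup>2 + y)) * (2 * z - w\<^sup>2 + y) + (y\<^sup>2 - ?d w) -
      (w\<^sup>2 - w - 1) * (w\<^sup>2 + w - 6)"
    using D dvd_add dvd_diff dvd_mult2 by meson
  also have "(2 * z - (w\<^sup>2 + y)) * (2 * z - w\<^sup>2 + y) + (y\<^sup>2 - ?d w) - (w\<^sup>2 - w - 1) * (w\<^sup>2 + w - 6)
      = 4 * (z\<^sup>2 - w\<^sup>2 * z + 2 * w\<^sup>2 - \<kappa>)"
    by (simp add: power2_eq_square algebra_simps)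
  finally have "int p dvd z\<^sup>2 - w\<^sup>2 * z + 2 * w\<^sup>2 - \<kappa>" using prime_dvd_4_mult_imp[OF p] by blast
  then have "[2 * w\<^sup>2 + z\<^sup>2 = w\<^sup>2 * z + \<kappa>] (mod int p)"
    by (simp add: cong_iff_dvd_diff algebra_simps)
  moreover have "[w\<^sup>2 = w + 1] (mod int p)" using D by (simp add: cong_iff_dvd_diff algebra_simps)
  moreover have "\<not> int p dvd 16 * \<kappa>\<^sup>2 - 68 * \<kappa> + 41"
    using L Legendre_eq_0_iff[of "16 * \<kappa>\<^sup>2 - 68 * \<kappa> + 41" "int p"] by auto
  ultimately have "vieta_polygon p 5 \<kappa> (vieta_seq w z)"
    using vieta_polygon_pentagon[OF p] nd by blast
  then show ?thesis by (rule vieta_polygon.K33_primes_pentagon) simp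
qed

section \<open>Newman's Tauberian theorem\<close>

lemma powr_diff_mvt:
  fixes a b c :: real
  assumes "0 < a" "a < b"
  obtains \<xi> where "a < \<xi>" "\<xi> < b" "b powr c - a powr c = (b - a) * (c * \<xi> powr (c - 1))"
proof -
  have "\<exists>\<xi>>a. \<xi> < b \<and> b powr c - a powr c = (b - a) * (c * \<xi> powr (c - 1))"
    using assms by (intro MVT2) (auto intro!: derivative_eq_intros)
  then show ?thesis using that by blast
qed

text \<open>The mean value theorem bounds each term by a difference of powers, and the differences
  telescope; this takes the place of comparison with an integral.\<close>

lemma sum_powr_neg_le:
  fixes x :: real
  assumes "x > 0" "N \<ge> 1" "N \<le> M"
  shows "(\<Sum>n\<in>{N<..M}. real n powr (- 1 - x)) \<le> real N powr (- x) / x"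
proof -
  have "(\<Sum>n\<in>{N<..M}. real n powr (- 1 - x)) \<le> (real N powr (- x) - real M powr (- x)) / x"
    using assms(3)
  proof (induction M rule: dec_induct)
    case (step M)
    have "M \<ge> 1" using step assms by simp
    obtain \<xi> where \<xi>: "real M < \<xi>" "\<xi> < real (Suc M)"
      "real (Suc M) powr (- x) - real M powr (- x) = (real (Suc M) - real M) * (- x * \<xi> powr (- x - 1))"
      using powr_diff_mvt[of "real M" "real (Suc M)" "- x"] \<open>M \<ge> 1\<close> by auto
    have "real (Suc M) powr (- x - 1) \<le> \<xi> powr (- x - 1)"
      using \<xi> \<open>M \<ge> 1\<close> assms by (intro powr_mono2') auto
    then have "x * real (Suc M) powr (- x - 1) \<le> x * \<xi> powr (- x - 1)"
      using assms by (intro mult_left_mono) auto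
    then have "x * real (Suc M) powr (- 1 - x) \<le> real M powr (- x) - real (Suc M) powr (- x)"
      using \<xi>(3) by (simp add: minus_diff_commute)
    then have "real (Suc M) powr (- 1 - x) \<le> (real M powr (- x) - real (Suc M) powr (- x)) / x"
      using assms by (simp add: field_simps)
    moreover have "{N<..Suc M} = insert (Suc M) {N<..M}" using step by auto
    ultimately show ?case using step by (simp add: diff_divide_distrib)
  qed simp
  also have "\<dots> \<le> real N powr (- x) / x"
    using assms by (intro divide_right_mono) auto
  finally show ?thesis .
qed

text \<open>For \<open>y > 1\<close> the terms increase, so the telescoping comparison stops short
  of \<open>N\<close> and the last term is counted separately.\<close>

lemma sum_powr_le:
  fixes y :: real
  assumes "y > 0" "N \<ge> 1"
  shows "(\<Sum>n=1..N. real n powr (y - 1)) \<le> real N powr (y - 1) + real N powr y / y"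
proof (cases "y \<le> 1")
  case True
  have "(\<Sum>n=1..N. real n powr (y - 1)) \<le> real N powr y / y"
    using assms(2)
  proof (induction N rule: dec_induct)
    case (step M)
    obtain \<xi> where \<xi>: "real M < \<xi>" "\<xi> < real (Suc M)"
      "real (Suc M) powr y - real M powr y = (real (Suc M) - real M) * (y * \<xi> powr (y - 1))"
      using powr_diff_mvt[of "real M" "real (Suc M)" y] step by auto
    have "real (Suc M) powr (y - 1) \<le> \<xi> powr (y - 1)"
      using \<xi> step True by (intro powr_mono2') auto
    then have "y * real (Suc M) powr (y - 1) \<le> real (Suc M) powr y - real M powr y"
      using \<xi>(3) assms by simp
    then have "real (Suc M) powr (y - 1) \<le> (real (Suc M) powr y - real M powr y) / y"
      using assms by (simp add: field_simps)
    then show ?case using step by (simp add: diff_divide_distrib)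
  qed (use True assms in simp)
  then show ?thesis by (simp add: add_increasing)
next
  case False
  have "(\<Sum>n=1..<N. real n powr (y - 1)) \<le> real N powr y / y"
    using assms(2)
  proof (induction N rule: dec_induct)
    case (step M)
    obtain \<xi> where \<xi>: "real M < \<xi>" "\<xi> < real (Suc M)"
      "real (Suc M) powr y - real M powr y = (real (Suc M) - real M) * (y * \<xi> powr (y - 1))"
      using powr_diff_mvt[of "real M" "real (Suc M)" y] step by auto
    have "real M powr (y - 1) \<le> \<xi> powr (y - 1)"
      using \<xi> step False by (intro powr_mono2) auto
    then have "y * real M powr (y - 1) \<le> real (Suc M) powr y - real M powr y"
      using \<xi>(3) assms by simp
    then have "real M powr (y - 1) \<le> (real (Suc M) powr y - real M powr y) / y"
      using assms by (simp add: field_simps)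
    then show ?case using step by (simp add: diff_divide_distrib)
  qed (use assms in simp)
  moreover have "{1..N} = insert N {1..<N}" using assms by auto
  ultimately show ?thesis by simp
qed

lemma norm_of_nat_powr: "norm ((of_nat n :: complex) powr s) = real n powr Re s"
  using norm_powr_real_powr[of "of_nat n" s] by simp

lemma has_contour_integral_inverse_part_circlepath:
  assumes "R > 0" "a < b"
  shows "((\<lambda>z. 1 / z) has_contour_integral \<i> * of_real (b - a)) (part_circlepath 0 R a b)"
proof -
  have "((\<lambda>t::real. \<i>) has_integral \<i> * of_real (b - a)) {a..b}"
    using has_integral_const_real[of \<i> a b] assms by (simp add: scaleR_conv_of_real mult.commute)
  moreover have "1 / (0 + of_real R * cis t) * of_real R * \<i> * cis t = \<i>" for t
    using assms by (simp add: divide_simps)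
  ultimately show ?thesis using assms
    by (subst has_contour_integral_part_circlepath_iff) (simp_all add: cis_conv_exp)
qed

text \<open>Subtracting \<open>G 0 * (1 / z)\<close> leaves a function holomorphic on a convex set,
  to which Cauchy's theorem applies. The value \<open>I\<close> stays a parameter: it is computed
  for the full circle, and for the other contour it is multiplied by 0.\<close>

lemma contour_integral_kernel:
  fixes G :: "complex \<Rightarrow> complex"
  assumes S: "open S" "convex S" "G holomorphic_on S"
    and g: "valid_path g" "path_image g \<subseteq> S - {0}" "pathfinish g = pathstart g"
    and one: "((\<lambda>z. 1 / z) has_contour_integral I) g"
  shows "((\<lambda>z. G z * (1 / z + z / of_real (R\<^sup>2))) has_contour_integral G 0 * I) g"
proof -
  define h where "h = (\<lambda>z. (if z = 0 then deriv G 0 else (G z - G 0) / (z - 0)) + G z * z / of_real (R\<^sup>2))"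
  have "(\<lambda>z. if z = 0 then deriv G 0 else (G z - G 0) / (z - 0)) holomorphic_on S"
    by (rule pole_lemma_open[OF S(3,1)])
  moreover have "(\<lambda>z. G z * z / of_real (R\<^sup>2)) holomorphic_on S"
    using S(3) by (cases "R = 0") (auto intro!: holomorphic_intros)
  ultimately have "h holomorphic_on S" unfolding h_def by (rule holomorphic_on_add)
  then have "(h has_contour_integral 0) g"
    using g by (intro Cauchy_theorem_convex_simple[OF _ S(2)]) auto
  then have "((\<lambda>z. h z + G 0 * (1 / z)) has_contour_integral 0 + G 0 * I) g"
    by (intro has_contour_integral_add has_contour_integral_lmul one)
  then have "((\<lambda>z. h z + G 0 * (1 / z)) has_contour_integral G 0 * I) g" by simp
  then show ?thesis
  proof (rule has_contour_integral_eq)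
    fix z assume "z \<in> path_image g"
    then have "z \<noteq> 0" using g by auto
    then show "h z + G 0 * (1 / z) = G z * (1 / z + z / of_real (R\<^sup>2))"
      by (simp add: h_def field_simps)
  qed
qed

text \<open>On the circle 1 / z is the conjugate of z divided by R^2.\<close>

lemma norm_kernel:
  assumes "norm z = R" "R > 0"
  shows "norm (1 / z + z / of_real (R\<^sup>2)) = 2 * \<bar>Re z\<bar> / R\<^sup>2"
proof -
  have "z \<noteq> 0" using assms by auto
  have "z * cnj z = of_real (R\<^sup>2)" using assms by (metis complex_norm_square)
  then have "1 / z = cnj z / of_real (R\<^sup>2)" using \<open>z \<noteq> 0\<close> assms by (simp add: field_simps)
  then have "1 / z + z / of_real (R\<^sup>2) = of_real (2 * Re z) / of_real (R\<^sup>2)"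
    by (simp add: complex_add_cnj add.commute flip: add_divide_distrib)
  then have "norm (1 / z + z / of_real (R\<^sup>2)) = norm (of_real (2 * Re z) :: complex) / norm (of_real (R\<^sup>2) :: complex)"
    by (simp add: norm_divide)
  then show ?thesis unfolding norm_of_real by (simp add: abs_mult)
qed

text \<open>Dominated convergence: the powers tend to 0 where the real part is negative and stay
  bounded by 1, and \<open>\<phi>\<close> vanishes where the path meets the imaginary axis.
  \<open>Suc N\<close> keeps the base at least 1.\<close>

lemma linepath_integral_tendsto_0:
  fixes \<phi> :: "complex \<Rightarrow> complex"
  assumes cont: "continuous_on (closed_segment a b) \<phi>"
    and Re: "\<And>z. z \<in> closed_segment a b \<Longrightarrow> Re z < 0 \<or> Re z = 0 \<and> \<phi> z = 0"
  shows "(\<lambda>N. contour_integral (linepath a b) (\<lambda>z. \<phi> z * of_nat (Suc N) powr z)) \<longlonglongrightarrow> 0"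
proof -
  let ?f = "\<lambda>N t. \<phi> (linepath a b t) * of_nat (Suc N) powr (linepath a b t) * (b - a)"
  have mem: "linepath a b t \<in> closed_segment a b" if "t \<in> {0..1}" for t
    using that by (metis linepath_image_01 imageI path_image_def path_image_linepath)
  have c1: "continuous_on {0..1} (\<lambda>t. \<phi> (linepath a b t))"
    using mem by (intro continuous_on_compose2[OF cont]) (auto intro: continuous_on_linepath)
  obtain M where M: "\<And>z. z \<in> closed_segment a b \<Longrightarrow> norm (\<phi> z) \<le> M"
    using compact_continuous_image[OF cont compact_segment] by (force dest: compact_imp_bounded simp: bounded_iff)
  have "(\<lambda>N. integral {0..1} (?f N)) \<longlonglongrightarrow> integral {0..1::real} (\<lambda>t. 0 :: complex)"
  proof (rule Equivalence_Lebesgue_Henstock_Integration.dominated_convergence(2)[where f = ?f and h = "\<lambda>t. M * norm (b - a)"])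
    show "?f N integrable_on {0..1}" for N
      by (intro integrable_continuous_real continuous_intros c1) (auto simp del: of_nat_Suc)
    show "(\<lambda>t. M * norm (b - a)) integrable_on {0..1::real}"
      by (intro integrable_continuous_real continuous_intros)
    show "norm (?f N t) \<le> M * norm (b - a)" if t: "t \<in> {0..1}" for N t
    proof -
      have "norm ((of_nat (Suc N) :: complex) powr linepath a b t) \<le> 1"
        unfolding norm_of_nat_powr using Re[OF mem[OF t]] powr_mono[of "Re (linepath a b t)" 0 "real (Suc N)"]
        by simp linarith
      then have "norm (\<phi> (linepath a b t)) * norm ((of_nat (Suc N) :: complex) powr linepath a b t) \<le> M * 1"
        using M[OF mem[OF t]] order_trans[OF norm_ge_zero M[OF mem[OF t]]] by (intro mult_mono) auto
      then show ?thesis by (simp add: norm_mult mult_right_mono)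
    qed
    show "(\<lambda>N. ?f N t) \<longlonglongrightarrow> 0" if t: "t \<in> {0..1}" for t
    proof (cases "Re (linepath a b t) < 0")
      case True
      have "(\<lambda>N. real (Suc N) powr Re (linepath a b t)) \<longlonglongrightarrow> 0"
        by (rule tendsto_neg_powr[OF True filterlim_compose[OF filterlim_real_sequentially filterlim_Suc]])
      then have "(\<lambda>N. (of_nat (Suc N) :: complex) powr linepath a b t) \<longlonglongrightarrow> 0"
        by (subst tendsto_norm_zero_iff[symmetric]) (simp only: norm_of_nat_powr)
      then have "(\<lambda>N. \<phi> (linepath a b t) * of_nat (Suc N) powr linepath a b t * (b - a)) \<longlonglongrightarrow>
          \<phi> (linepath a b t) * 0 * (b - a)"
        by (intro tendsto_intros)
      then show ?thesis by simp
    next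
      case False
      then show ?thesis using Re[OF mem[OF t]] by simp
    qed
  qed
  then show ?thesis by (simp add: contour_integral_integral)
qed

lemma box_in_open:
  assumes \<Omega>: "open \<Omega>" "{z. Re z \<ge> 0} \<subseteq> \<Omega>"
  shows "\<exists>\<delta>>0. {z. - \<delta> < Re z \<and> \<bar>Im z\<bar> < R} \<subseteq> \<Omega>"
proof -
  define K where "K = (\<lambda>t. Complex 0 t) ` {-R..R}"
  have "compact K" unfolding K_def
    by (intro compact_continuous_image continuous_intros) auto
  moreover have "K \<subseteq> \<Omega>" using \<Omega>(2) by (auto simp: K_def)
  ultimately obtain e where e: "e > 0" "(\<Union>x\<in>K. ball x e) \<subseteq> \<Omega>"
    using compact_subset_open_imp_ball_epsilon_subset[of K \<Omega>] \<Omega>(1) by blast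
  have "z \<in> \<Omega>" if "- e < Re z" "\<bar>Im z\<bar> < R" for z
  proof (cases "Re z \<ge> 0")
    case False
    have "dist (Complex 0 (Im z)) z = \<bar>Re z\<bar>"
      by (simp add: dist_norm norm_complex_def)
    then have "z \<in> ball (Complex 0 (Im z)) e" using that False by simp
    then show ?thesis using e(2) that by (force simp: K_def)
  qed (use \<Omega>(2) in auto)
  then show ?thesis using e(1) by blast
qed

text \<open>The partial sum is entire and can be integrated over the whole circle, whereas
  \<open>f\<close> is known only slightly to the left of the imaginary axis and gets a contour that
  hugs this axis. The two half circles cost about \<open>K / R\<close> each, and the rest tends to 0
  with \<open>N\<close>.\<close>

lemma newman_bound:
  fixes a :: "nat \<Rightarrow> complex" and f :: "complex \<Rightarrow> complex"
  assumes K: "\<And>n. norm (a n) \<le> K" and Kpos: "K > 0"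
    and \<Omega>: "open \<Omega>" "{z. Re z \<ge> 0} \<subseteq> \<Omega>" "f holomorphic_on \<Omega>"
    and sums: "\<And>z. Re z > 0 \<Longrightarrow> (\<lambda>n. a n * of_nat n powr (- 1 - z)) sums f z"
    and f0: "f 0 = 0" and R: "R > 0"
  shows "\<forall>\<^sub>F N in sequentially. norm (\<Sum>n\<le>N. a n * of_nat n powr (- 1)) \<le> 3 * K / R"
proof -
  have K0: "K \<ge> 0" using order_trans[OF norm_ge_zero K] .
  obtain \<delta> where \<delta>: "\<delta> > 0" "{z. - \<delta> < Re z \<and> \<bar>Im z\<bar> < R + 1} \<subseteq> \<Omega>"
    using box_in_open[OF \<Omega>(1,2)] by blast
  define S where "S = {z. - \<delta> < Re z \<and> \<bar>Im z\<bar> < R + 1}"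
  \<comment> \<open>With half of \<delta> the left side of the contour lies inside the open box
    \<open>S\<close>, just as the height \<open>R + 1\<close> leaves room for the circle and the
    horizontal sides.\<close>
  define d where "d = \<delta> / 2"
  have d: "d > 0" "d < \<delta>" using \<delta> by (auto simp: d_def)
  have S_eq: "S = {z. Re z > - \<delta>} \<inter> ({z. Im z < R + 1} \<inter> {z. Im z > - (R + 1)})"
    by (auto simp: S_def abs_less_iff)
  have "open S" unfolding S_eq
    by (intro open_Int open_halfspace_Re_gt open_halfspace_Im_gt open_halfspace_Im_lt)
  have "convex S" unfolding S_eq
    by (intro convex_Int convex_halfspace_Re_gt convex_halfspace_Im_gt convex_halfspace_Im_lt)
  have fS: "f holomorphic_on S" using \<Omega>(3) \<delta>(2) holomorphic_on_subset unfolding S_def by blast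
  define s where "s = (\<lambda>N z. \<Sum>n\<le>N. a n * of_nat n powr (- 1 - z))"
  \<comment> \<open>On the circle of radius \<open>R\<close> Newman's kernel is \<open>2 Re z / R\<^sup>2\<close>, which cancels the growth of the
    series towards the imaginary axis.\<close>
  define ker where "ker = (\<lambda>z. 1 / z + z / complex_of_real (R\<^sup>2))"
  \<comment> \<open>\<open>A\<close> and \<open>A'\<close> are the right and the left half of the
    circle; \<open>B\<close> joins the ends of \<open>A\<close> through three sides of a rectangle
    in the region where \<open>f\<close> is holomorphic.\<close>
  define A where "A = part_circlepath 0 R (- (pi / 2)) (pi / 2)"
  define A' where "A' = part_circlepath 0 R (pi / 2) (pi + pi / 2)"
  define p q where "p = \<i> * complex_of_real R" and "q = - (\<i> * complex_of_real R)"
  define c1 c2 where "c1 = Complex (- d) R" and "c2 = Complex (- d) (- R)"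
  define B where "B = linepath p c1 +++ linepath c1 c2 +++ linepath c2 q"
  have e: "exp (\<i> * complex_of_real (pi / 2)) = \<i>" "exp (\<i> * complex_of_real (- (pi / 2))) = - \<i>"
      "exp (\<i> * complex_of_real (pi + pi / 2)) = - \<i>"
  proof -
    have exp_eq: "exp (\<i> * complex_of_real x) = cis x" for x by (simp add: cis_conv_exp)
    show "exp (\<i> * complex_of_real (pi / 2)) = \<i>" "exp (\<i> * complex_of_real (- (pi / 2))) = - \<i>"
      "exp (\<i> * complex_of_real (pi + pi / 2)) = - \<i>"
      unfolding exp_eq cis_mult[symmetric] by (simp_all add: complex_eq_iff)
  qed
  have ends: "pathstart A = q" "pathfinish A = p" "pathstart A' = p" "pathfinish A' = q"
      "pathstart B = p" "pathfinish B = q"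
    unfolding A_def A'_def B_def pathstart_part_circlepath pathfinish_part_circlepath e
    by (simp_all add: p_def q_def mult.commute)
  have valid: "valid_path A" "valid_path A'" "valid_path B"
    by (auto simp: A_def A'_def B_def intro!: valid_path_join)
  have normA: "norm z = R" "Re z \<ge> 0" if z: "z \<in> path_image A" for z
  proof -
    have "\<exists>x\<in>{-(pi/2)..pi/2}. z = of_real R * cis x"
      using z R by (auto simp: A_def path_image_part_circlepath cis_conv_exp)
    then obtain x where "x \<in> {-(pi/2)..pi/2}" "z = of_real R * cis x" by blast
    then show "norm z = R" "Re z \<ge> 0" using R cos_ge_zero[of x] by (auto simp: norm_mult)
  qed
  have normA': "norm z = R" "Re z \<le> 0" if z: "z \<in> path_image A'" for z
  proof -
    have "\<exists>x\<in>{pi/2..pi + pi/2}. z = of_real R * cis x"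
      using z R by (auto simp: A'_def path_image_part_circlepath cis_conv_exp)
    then obtain x where x: "x \<in> {pi/2..pi + pi/2}" "z = of_real R * cis x" by blast
    have "cos (x - pi) \<ge> 0" using x by (intro cos_ge_zero) auto
    then have "cos x \<le> 0" by (simp add: cos_diff)
    then show "norm z = R" "Re z \<le> 0" using R x by (auto simp: norm_mult mult_nonneg_nonpos)
  qed
  have Re0: "z \<in> {p, q}" if "norm z = R" "Re z = 0" for z
    using that by (auto simp: p_def q_def complex_eq_iff norm_complex_def abs_if split: if_splits)
  have seg1: "\<bar>Im z\<bar> \<le> R \<and> - d \<le> Re z \<and> (Re z < 0 \<or> z = p)" if z: "z \<in> closed_segment p c1" for z
  proof -
    obtain u where u: "0 \<le> u" "u \<le> 1" "z = (1 - u) *\<^sub>R p + u *\<^sub>R c1"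
      using z unfolding in_segment by blast
    have "Re z = - (u * d)" "Im z = R" unfolding u(3) by (simp_all add: p_def c1_def algebra_simps)
    moreover have "u * d \<le> d" using u d by (simp add: mult_left_le_one_le)
    moreover have "Re z < 0" if "u \<noteq> 0" using that u d calculation(1) by simp
    moreover have "z = p" if "u = 0" using that u(3) by simp
    ultimately show ?thesis using R by auto
  qed
  have seg2: "\<bar>Im z\<bar> \<le> R \<and> - d \<le> Re z \<and> Re z < 0" if z: "z \<in> closed_segment c1 c2" for z
  proof -
    obtain u where u: "0 \<le> u" "u \<le> 1" "z = (1 - u) *\<^sub>R c1 + u *\<^sub>R c2"
      using z unfolding in_segment by blast
    have "Re z = - d" "Im z = R - 2 * (u * R)" unfolding u(3) by (simp_all add: c2_def c1_def algebra_simps)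
    moreover have "u * R \<le> R" "0 \<le> u * R" using u R by (simp_all add: mult_left_le_one_le)
    then have "\<bar>R - 2 * (u * R)\<bar> \<le> R" by linarith
    ultimately show ?thesis using d by simp
  qed
  have seg3: "\<bar>Im z\<bar> \<le> R \<and> - d \<le> Re z \<and> (Re z < 0 \<or> z = q)" if z: "z \<in> closed_segment c2 q" for z
  proof -
    obtain u where u: "0 \<le> u" "u \<le> 1" "z = (1 - u) *\<^sub>R c2 + u *\<^sub>R q"
      using z unfolding in_segment by blast
    have "Re z = - ((1 - u) * d)" "Im z = - R" unfolding u(3) by (simp_all add: q_def c2_def algebra_simps)
    moreover have "(1 - u) * d \<le> d" using u d by (simp add: mult_left_le_one_le)
    moreover have "Re z < 0" if "u \<noteq> 1" using that u d calculation(1) by simp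
    moreover have "z = q" if "u = 1" using that u(3) by simp
    ultimately show ?thesis using R by auto
  qed
  have imB: "path_image B = closed_segment p c1 \<union> closed_segment c1 c2 \<union> closed_segment c2 q"
    by (simp add: B_def path_image_join Un_assoc)
  have pq: "p \<in> S" "q \<in> S" "p \<noteq> 0" "q \<noteq> 0" using R \<delta>(1) by (auto simp: p_def q_def S_def)
  have BS: "path_image B \<subseteq> S - {0}"
    using seg1 seg2 seg3 d pq unfolding imB S_def by fastforce
  have AS: "path_image A \<subseteq> S - {0}"
  proof
    fix z assume z: "z \<in> path_image A"
    have "\<bar>Im z\<bar> \<le> R" using abs_Im_le_cmod[of z] normA[OF z] by simp
    then show "z \<in> S - {0}" using normA[OF z] R \<delta>(1) by (auto simp: S_def)
  qed
  have A'0: "path_image A' \<subseteq> UNIV - {0}" using normA'(1)[of 0] R by auto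
  have ker0: "ker z = 0" if "norm z = R" "Re z = 0" for z
    using norm_kernel[OF that(1) R] that(2) by (simp add: ker_def)
  have ker_pq: "ker p = 0" "ker q = 0" using R by (auto intro!: ker0 simp: p_def q_def norm_mult)
  have nz_cont: "continuous_on X ker" if "X \<subseteq> UNIV - {0}" for X
    unfolding ker_def using that R by (intro continuous_intros) auto
  have npow: "continuous_on X (\<lambda>z. (of_nat N :: complex) powr z)" for X N
    by (intro holomorphic_on_imp_continuous_on holomorphic_intros)
  have s_holo: "s N holomorphic_on X" for N X unfolding s_def by (intro holomorphic_intros)
  have s_cont: "continuous_on X (s N)" for N X
    by (intro holomorphic_on_imp_continuous_on s_holo)
  have f_cont: "continuous_on X f" if "X \<subseteq> S" for X
    using holomorphic_on_imp_continuous_on[OF fS] that continuous_on_subset by blast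
  have pA: "path_image A \<subseteq> S" "path_image A \<subseteq> UNIV - {0}" "path_image A' \<subseteq> UNIV - {0}"
      "path_image B \<subseteq> S" "path_image B \<subseteq> UNIV - {0}"
    using AS BS A'0 by auto
  define F where "F = (\<lambda>N z. f z * of_nat N powr z * ker z)"
  define H where "H = (\<lambda>N z. s N z * of_nat N powr z * ker z)"
  have int_A: "h contour_integrable_on A" if "continuous_on (path_image A) h" for h
    using that unfolding A_def by (rule contour_integrable_continuous_part_circlepath)
  have int_A': "h contour_integrable_on A'" if "continuous_on (path_image A') h" for h
    using that unfolding A'_def by (rule contour_integrable_continuous_part_circlepath)
  have int_B: "h contour_integrable_on B" if "continuous_on (path_image B) h" for h
  proof -
    have "h contour_integrable_on linepath p c1" "h contour_integrable_on linepath c1 c2"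
      "h contour_integrable_on linepath c2 q"
      using that unfolding imB
      by (auto intro!: contour_integrable_continuous_linepath elim: continuous_on_subset)
    then show ?thesis unfolding B_def
      by (intro contour_integrable_joinI valid_path_join) auto
  qed
  have F_int: "F N contour_integrable_on A" "F N contour_integrable_on B" for N
    unfolding F_def using pA
    by (auto intro!: int_A int_B continuous_intros f_cont npow nz_cont)
  have H_int: "H N contour_integrable_on A" "H N contour_integrable_on A'" for N
    unfolding H_def using pA
    by (auto intro!: int_A int_A' continuous_intros s_cont npow nz_cont)
  have inv_int: "(\<lambda>z. 1 / z) contour_integrable_on A" "(\<lambda>z. 1 / z) contour_integrable_on B"
    using pA by (auto intro!: int_A int_B continuous_intros)
  \<comment> \<open>The integral of 1 / z around this contour is multiplied by
    \<open>f 0 = 0\<close>, so its value plays no part.\<close>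
  have eq1: "contour_integral A (F N) = - contour_integral B (F N)" for N
  proof -
    have "((\<lambda>z. 1 / z) has_contour_integral (contour_integral A (\<lambda>z. 1 / z) + contour_integral B (\<lambda>z. 1 / z))) (A +++ B)"
      using inv_int valid by (intro has_contour_integral_join has_contour_integral_integral)
    moreover have "path_image (A +++ B) \<subseteq> S - {0}"
      using AS BS ends by (simp add: path_image_join)
    ultimately have "((\<lambda>z. (f z * of_nat N powr z) * (1 / z + z / of_real (R\<^sup>2))) has_contour_integral
        (f 0 * of_nat N powr 0) * (contour_integral A (\<lambda>z. 1 / z) + contour_integral B (\<lambda>z. 1 / z))) (A +++ B)"
      using \<open>open S\<close> \<open>convex S\<close> fS valid ends
      by (intro contour_integral_kernel[where S = S] holomorphic_intros) auto
    then have "(F N has_contour_integral 0) (A +++ B)" by (simp add: f0 F_def ker_def)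
    then have "contour_integral (A +++ B) (F N) = 0" by (rule contour_integral_unique)
    then show ?thesis
      using contour_integral_join[OF F_int valid(1,3)] by (simp add: eq_neg_iff_add_eq_0)
  qed
  have eq2: "contour_integral A (H N) + contour_integral A' (H N) = 2 * of_real pi * \<i> * s N 0" if "N \<ge> 1" for N
  proof -
    have "((\<lambda>z. 1 / z) has_contour_integral (\<i> * of_real (pi / 2 - (- (pi / 2))) + \<i> * of_real (pi + pi / 2 - pi / 2))) (A +++ A')"
      unfolding A_def A'_def using R pi_gt_zero
      by (intro has_contour_integral_join has_contour_integral_inverse_part_circlepath) auto
    moreover have "path_image (A +++ A') \<subseteq> UNIV - {0}"
      using pA ends by (simp add: path_image_join)
    ultimately have "((\<lambda>z. (s N z * of_nat N powr z) * (1 / z + z / of_real (R\<^sup>2))) has_contour_integral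
        (s N 0 * of_nat N powr 0) * (\<i> * of_real (pi / 2 - (- (pi / 2))) + \<i> * of_real (pi + pi / 2 - pi / 2))) (A +++ A')"
      using valid ends
      by (intro contour_integral_kernel[where S = UNIV] holomorphic_intros s_holo) auto
    then have "(H N has_contour_integral s N 0 * (2 * of_real pi * \<i>)) (A +++ A')"
      using that by (simp add: H_def ker_def algebra_simps)
    then have "contour_integral (A +++ A') (H N) = s N 0 * (2 * of_real pi * \<i>)" by (rule contour_integral_unique)
    then show ?thesis
      using contour_integral_join[OF H_int valid(1,2), of N] by (simp add: mult.commute)
  qed
  \<comment> \<open>With x = Re z > 0 the tail of the series is at most K N^(-x) / x, the power
    contributes N^x and the kernel 2 x / R^2: everything that depends on z cancels. The two points
    on the imaginary axis are left out.\<close>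
  have bA: "norm (contour_integral A (\<lambda>z. F N z - H N z)) \<le> 2 * K / R\<^sup>2 * R * (pi / 2 - (- (pi / 2)))" if N: "N \<ge> 1" for N
    unfolding A_def
  proof (rule contour_integral_bound_part_circlepath_strong[where k = "{p, q}"])
    show "(\<lambda>z. F N z - H N z) contour_integrable_on part_circlepath 0 R (- (pi / 2)) (pi / 2)"
      using contour_integrable_diff[OF F_int(1) H_int(1)] by (simp add: A_def)
    fix z assume z: "z \<in> path_image (part_circlepath 0 R (- (pi / 2)) (pi / 2)) - {p, q}"
    then have nz: "norm z = R" "Re z > 0" using normA[of z] Re0[of z] unfolding A_def by fastforce+
    have "norm (f z - s N z) \<le> K * (real N powr (- Re z) / Re z)"
    proof (rule LIMSEQ_le_const2)
      have "(\<lambda>M. s M z) \<longlonglongrightarrow> f z"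
        using sums[OF nz(2)] unfolding sums_def_le s_def .
      then show "(\<lambda>M. norm (s M z - s N z)) \<longlonglongrightarrow> norm (f z - s N z)"
        by (intro tendsto_intros)
      show "\<exists>M0. \<forall>M\<ge>M0. norm (s M z - s N z) \<le> K * (real N powr (- Re z) / Re z)"
      proof (intro exI[of _ N] allI impI)
        fix M assume "M \<ge> N"
        then have split: "{..M} = {..N} \<union> {N<..M}" by auto
        have "s M z - s N z = (\<Sum>n\<in>{N<..M}. a n * of_nat n powr (- 1 - z))"
          unfolding s_def split by (subst sum.union_disjoint) auto
        also have "norm \<dots> \<le> (\<Sum>n\<in>{N<..M}. K * real n powr (- 1 - Re z))"
          by (intro sum_norm_le) (auto simp: norm_mult norm_of_nat_powr intro!: mult_right_mono K)
        also have "\<dots> = K * (\<Sum>n\<in>{N<..M}. real n powr (- 1 - Re z))" by (simp add: sum_distrib_left)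
        also have "\<dots> \<le> K * (real N powr (- Re z) / Re z)"
          using K0 sum_powr_neg_le[OF nz(2) N \<open>M \<ge> N\<close>] by (intro mult_left_mono) auto
        finally show "norm (s M z - s N z) \<le> K * (real N powr (- Re z) / Re z)" .
      qed
    qed
    then have "norm (f z - s N z) * (real N powr Re z) * (2 * Re z / R\<^sup>2) \<le>
        K * (real N powr (- Re z) / Re z) * (real N powr Re z) * (2 * Re z / R\<^sup>2)"
      using nz by (intro mult_right_mono) auto
    also have "\<dots> = K * (real N powr (- Re z) * real N powr Re z) * 2 / R\<^sup>2"
      using nz by (simp add: field_simps)
    also have "real N powr (- Re z) * real N powr Re z = 1" using N by (simp flip: powr_add)
    finally have "norm (f z - s N z) * (real N powr Re z) * (2 * Re z / R\<^sup>2) \<le> 2 * K / R\<^sup>2" by (simp add: mult_ac)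
    moreover have "F N z - H N z = (f z - s N z) * of_nat N powr z * ker z"
      by (simp add: F_def H_def algebra_simps)
    ultimately show "norm (F N z - H N z) \<le> 2 * K / R\<^sup>2"
      using norm_kernel[OF nz(1) R] nz(2) by (simp add: norm_mult norm_of_nat_powr ker_def)
  qed (use K0 R in auto)
  \<comment> \<open>With y = - Re z > 0 the partial sum is at most K N^y (1 / N + 1 / y), which the
    factor N^(-y) and the kernel 2 y / R^2 cancel up to the term with 1 / N.\<close>
  have bA': "norm (contour_integral A' (H N)) \<le> 2 * K * (R / real N + 1) / R\<^sup>2 * R * (pi + pi / 2 - pi / 2)" if N: "N \<ge> 1" for N
    unfolding A'_def
  proof (rule contour_integral_bound_part_circlepath_strong[where k = "{p, q}"])
    show "H N contour_integrable_on part_circlepath 0 R (pi / 2) (pi + pi / 2)"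
      using H_int(2) by (simp add: A'_def)
    fix z assume z: "z \<in> path_image (part_circlepath 0 R (pi / 2) (pi + pi / 2)) - {p, q}"
    then have nz: "norm z = R" "Re z < 0" using normA'[of z] Re0[of z] unfolding A'_def by fastforce+
    define y where "y = - Re z"
    have y: "y > 0" "y \<le> R" using nz abs_Re_le_cmod[of z] by (auto simp: y_def)
    have "norm (s N z) \<le> (\<Sum>n\<le>N. K * real n powr (- 1 - Re z))"
      unfolding s_def
      by (intro sum_norm_le) (auto simp: norm_mult norm_of_nat_powr intro!: mult_right_mono K)
    also have "- 1 - Re z = y - 1" by (simp add: y_def)
    also have "(\<Sum>n\<le>N. K * real n powr (y - 1)) = K * (\<Sum>n\<le>N. real n powr (y - 1))" by (simp add: sum_distrib_left)
    also have "(\<Sum>n\<le>N. real n powr (y - 1)) = (\<Sum>n=1..N. real n powr (y - 1))"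
      by (intro sum.mono_neutral_right) auto
    also have "K * \<dots> \<le> K * (real N powr (y - 1) + real N powr y / y)"
      using K0 sum_powr_le[OF y(1) N] by (intro mult_left_mono) auto
    also have "real N powr (y - 1) = real N powr y / N" using N by (simp add: powr_diff)
    finally have "norm (s N z) * real N powr (- y) * (2 * y / R\<^sup>2) \<le>
       K * (real N powr y / N + real N powr y / y) * real N powr (- y) * (2 * y / R\<^sup>2)"
      using y by (intro mult_right_mono) auto
    also have "\<dots> = K * (real N powr y * real N powr (- y)) * (1 / N + 1 / y) * (2 * y / R\<^sup>2)"
      using y N by (simp add: field_simps)
    also have "real N powr y * real N powr (- y) = 1" using N by (simp flip: powr_add)
    also have "K * 1 * (1 / N + 1 / y) * (2 * y / R\<^sup>2) = 2 * K * (y / N + 1) / R\<^sup>2"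
      using y by (simp add: field_simps)
    also have "\<dots> \<le> 2 * K * (R / N + 1) / R\<^sup>2"
      using y K0 by (intro divide_right_mono mult_left_mono add_right_mono) auto
    finally show "norm (H N z) \<le> 2 * K * (R / real N + 1) / R\<^sup>2"
      using norm_kernel[OF nz(1) R] nz(2) by (simp add: H_def norm_mult norm_of_nat_powr ker_def y_def)
  qed (use K0 R in auto)
  have bB: "(\<lambda>N. contour_integral B (F (Suc N))) \<longlonglongrightarrow> 0"
  proof -
    let ?\<phi> = "\<lambda>z. f z * ker z"
    have ints: "F N contour_integrable_on linepath p c1" "F N contour_integrable_on linepath c1 c2"
      "F N contour_integrable_on linepath c2 q" for N
      unfolding F_def using pA unfolding imB
      by (auto intro!: contour_integrable_continuous_linepath continuous_intros f_cont npow nz_cont)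
    have eq: "contour_integral B (F N) = contour_integral (linepath p c1) (F N) +
      (contour_integral (linepath c1 c2) (F N) + contour_integral (linepath c2 q) (F N))" for N
      unfolding B_def using ints[of N] by (simp add: contour_integrable_joinI)
    have F_eq: "F N = (\<lambda>z. ?\<phi> z * of_nat N powr z)" for N by (simp add: F_def fun_eq_iff)
    have "\<And>z. z \<in> closed_segment p c1 \<Longrightarrow> Re z < 0 \<or> Re z = 0 \<and> ?\<phi> z = 0"
      using seg1 ker_pq by (force simp: p_def)
    moreover have "closed_segment p c1 \<subseteq> S" "closed_segment p c1 \<subseteq> UNIV - {0}"
      using pA unfolding imB by auto
    ultimately have 1: "(\<lambda>N. contour_integral (linepath p c1) (F (Suc N))) \<longlonglongrightarrow> 0"
      unfolding F_eq by (intro linepath_integral_tendsto_0 continuous_on_mult f_cont nz_cont)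
    have "\<And>z. z \<in> closed_segment c1 c2 \<Longrightarrow> Re z < 0 \<or> Re z = 0 \<and> ?\<phi> z = 0"
      using seg2 by blast
    moreover have "closed_segment c1 c2 \<subseteq> S" "closed_segment c1 c2 \<subseteq> UNIV - {0}"
      using pA unfolding imB by auto
    ultimately have 2: "(\<lambda>N. contour_integral (linepath c1 c2) (F (Suc N))) \<longlonglongrightarrow> 0"
      unfolding F_eq by (intro linepath_integral_tendsto_0 continuous_on_mult f_cont nz_cont)
    have "\<And>z. z \<in> closed_segment c2 q \<Longrightarrow> Re z < 0 \<or> Re z = 0 \<and> ?\<phi> z = 0"
      using seg3 ker_pq by (force simp: q_def)
    moreover have "closed_segment c2 q \<subseteq> S" "closed_segment c2 q \<subseteq> UNIV - {0}"
      using pA unfolding imB by auto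
    ultimately have 3: "(\<lambda>N. contour_integral (linepath c2 q) (F (Suc N))) \<longlonglongrightarrow> 0"
      unfolding F_eq by (intro linepath_integral_tendsto_0 continuous_on_mult f_cont nz_cont)
    show ?thesis unfolding eq using tendsto_add[OF 1 tendsto_add[OF 2 3]] by simp
  qed
  have main: "2 * pi * norm (s N 0) \<le> 2 * K * pi / R + 2 * K * pi * (R / real N + 1) / R + norm (contour_integral B (F N))"
    if N: "N \<ge> 1" for N
  proof -
    have "contour_integral A (\<lambda>z. F N z - H N z) = contour_integral A (F N) - contour_integral A (H N)"
      by (rule contour_integral_diff[OF F_int(1) H_int(1)])
    then have "2 * of_real pi * \<i> * s N 0 = contour_integral A' (H N) -
       contour_integral A (\<lambda>z. F N z - H N z) - contour_integral B (F N)"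
      unfolding eq2[OF N, symmetric] by (simp add: eq1)
    then have "norm (2 * of_real pi * \<i> * s N 0) \<le> norm (contour_integral A' (H N)) +
       norm (contour_integral A (\<lambda>z. F N z - H N z)) + norm (contour_integral B (F N))"
      using norm_triangle_ineq4[of "contour_integral A' (H N)" "contour_integral A (\<lambda>z. F N z - H N z)"]
        norm_triangle_ineq4[of "contour_integral A' (H N) - contour_integral A (\<lambda>z. F N z - H N z)" "contour_integral B (F N)"]
      by simp
    also have "\<dots> \<le> 2 * K * (R / real N + 1) / R\<^sup>2 * R * (pi + pi / 2 - pi / 2) +
      2 * K / R\<^sup>2 * R * (pi / 2 - (- (pi / 2))) + norm (contour_integral B (F N))"
      using bA[OF N] bA'[OF N] by simp
    also have "\<dots> = 2 * K * pi / R + 2 * K * pi * (R / real N + 1) / R + norm (contour_integral B (F N))"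
      using R by (simp add: power2_eq_square field_simps)
    finally show ?thesis by (simp add: norm_mult)
  qed
  have "(\<lambda>N. 2 * K * pi / R + 2 * K * pi * (R / real (Suc N) + 1) / R + norm (contour_integral B (F (Suc N))))
      \<longlonglongrightarrow> 2 * K * pi / R + 2 * K * pi * (0 + 1) / R + norm (0 :: complex)"
    by (intro tendsto_intros bB LIMSEQ_Suc[OF lim_const_over_n]) (use R in auto)
  \<comment> \<open>The limit is 4 K pi / R; comparing with 6 K pi / R leaves room for the terms
    that vanish only in the limit.\<close>
  moreover have "2 * K * pi / R + 2 * K * pi * (0 + 1) / R + norm (0 :: complex) < 6 * K * pi / R"
    using R Kpos by (simp add: field_simps)
  ultimately have "\<forall>\<^sub>F N in sequentially. 2 * K * pi / R + 2 * K * pi * (R / real (Suc N) + 1) / R +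
      norm (contour_integral B (F (Suc N))) < 6 * K * pi / R"
    by (rule order_tendstoD)
  then have "\<forall>\<^sub>F N in sequentially. norm (s (Suc N) 0) \<le> 3 * K / R"
  proof eventually_elim
    case (elim N)
    then have "2 * pi * norm (s (Suc N) 0) \<le> 2 * pi * (3 * K / R)"
      using main[of "Suc N"] by (simp add: mult_ac)
    then show ?case by (rule mult_left_le_imp_le) simp
  qed
  then have "\<forall>\<^sub>F N in sequentially. norm (s N 0) \<le> 3 * K / R"
    by (subst (asm) eventually_sequentially_Suc)
  then show ?thesis by (simp add: s_def)
qed

text \<open>Lowering the coefficient at n = 1 by \<open>F 1\<close> lowers the sum by a constant, so
  the shifted function vanishes at 0. The bound 3 K' / R for every radius then forces the limit
  0.\<close>

theorem newman_ingham:
  fixes a :: "nat \<Rightarrow> complex"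
  assumes K: "\<And>n. norm (a n) \<le> K"
    and \<Omega>: "open \<Omega>" "{s. Re s \<ge> 1} \<subseteq> \<Omega>" "F holomorphic_on \<Omega>"
    and sums: "\<And>s. Re s > 1 \<Longrightarrow> (\<lambda>n. a n * of_nat n powr (- s)) sums F s"
  shows "(\<lambda>n. a n / of_nat n) sums F 1"
proof -
  define b where "b = (\<lambda>n. if n = 1 then a 1 - F 1 else a n)"
  define f where "f = (\<lambda>z. F (1 + z) - F 1)"
  define K' where "K' = K + norm (F 1) + 1"
  define \<Omega>' where "\<Omega>' = (\<lambda>z. 1 + z) -` \<Omega>"
  have "K \<ge> 0" using order_trans[OF norm_ge_zero K] .
  have K': "norm (b n) \<le> K'" "K' > 0" for n
    using K[of n] norm_triangle_ineq4[of "a 1" "F 1"] \<open>K \<ge> 0\<close> K[of 1] by (auto simp: b_def K'_def)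
      (smt (verit) norm_ge_zero)+
  have fsums: "(\<lambda>n. b n * of_nat n powr (- 1 - z)) sums f z" if "Re z > 0" for z
  proof -
    have "(\<lambda>n. a n * of_nat n powr (- 1 - z)) sums F (1 + z)"
      using sums[of "1 + z"] that by simp
    moreover have "(\<lambda>n. if n = 1 then - F 1 else 0) sums (- F 1)" by (rule sums_single)
    ultimately have "(\<lambda>n. a n * of_nat n powr (- 1 - z) + (if n = 1 then - F 1 else 0)) sums (F (1 + z) + - F 1)"
      by (rule sums_add)
    moreover have "(\<lambda>n. a n * of_nat n powr (- 1 - z) + (if n = 1 then - F 1 else 0)) =
        (\<lambda>n. b n * of_nat n powr (- 1 - z))"
      by (auto simp: fun_eq_iff b_def algebra_simps)
    ultimately show ?thesis by (simp add: f_def)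
  qed
  have bound: "\<forall>\<^sub>F N in sequentially. norm (\<Sum>n\<le>N. b n * of_nat n powr (- 1)) \<le> 3 * K' / R" if "R > 0" for R
  proof (rule newman_bound[OF K' _ _ _ fsums _ that])
    show "open \<Omega>'" unfolding \<Omega>'_def by (intro open_vimage \<Omega>(1) continuous_intros)
    show "{z. Re z \<ge> 0} \<subseteq> \<Omega>'" by (auto simp: \<Omega>'_def intro!: subsetD[OF \<Omega>(2)])
    have "(F \<circ> (\<lambda>z. 1 + z)) holomorphic_on \<Omega>'"
      by (rule holomorphic_on_compose_gen[OF _ \<Omega>(3)]) (auto simp: \<Omega>'_def intro!: holomorphic_intros)
    then show "f holomorphic_on \<Omega>'" unfolding f_def o_def by (intro holomorphic_intros)
  qed (auto simp: f_def)
  have "(\<lambda>N. \<Sum>n\<le>N. b n * of_nat n powr (- 1)) \<longlonglongrightarrow> 0"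
  proof (rule tendstoI, unfold dist_norm)
    fix e :: real assume "e > 0"
    \<comment> \<open>This radius turns the bound 3 K' / R into e / 2.\<close>
    then have R: "6 * K' / e > 0" using K'(2) by simp
    have "\<forall>\<^sub>F N in sequentially. norm (\<Sum>n\<le>N. b n * of_nat n powr (- 1)) \<le> 3 * K' / (6 * K' / e)"
      by (rule bound[OF R])
    then show "\<forall>\<^sub>F N in sequentially. norm ((\<Sum>n\<le>N. b n * of_nat n powr (- 1)) - 0) < e"
    proof eventually_elim
      case (elim N)
      have "3 * K' / (6 * K' / e) = e / 2" using K'(2) by simp
      with elim \<open>e > 0\<close> show ?case by simp
    qed
  qed
  then have "(\<lambda>n. b n * of_nat n powr (- 1)) sums 0" unfolding sums_def_le .
  moreover have "(\<lambda>n. if n = 1 then F 1 else 0) sums F 1" by (rule sums_single)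
  ultimately have "(\<lambda>n. b n * of_nat n powr (- 1) + (if n = 1 then F 1 else 0)) sums (0 + F 1)"
    by (rule sums_add)
  moreover have "b n * of_nat n powr (- 1) + (if n = 1 then F 1 else 0) = a n / of_nat n" for n
    by (cases "n = 0") (auto simp: b_def powr_minus divide_inverse)
  ultimately show ?thesis by simp
qed

section \<open>Dirichlet series and real characters\<close>

lemma of_nat_powr_mult:
  "(of_nat d :: complex) powr s * of_nat e powr s = of_nat (d * e) powr s"
  by (simp add: powr_times_real)

lemma powr_neg_diff_bound:
  fixes s :: complex
  assumes "0 < x" "x \<le> y" "Re s > 0"
  shows "norm (of_real x powr (- s) - of_real y powr (- s)) \<le> norm s * x powr (- Re s - 1) * (y - x)"
proof -
  have seg: "\<exists>t. z = of_real t \<and> x \<le> t" if "z \<in> closed_segment (of_real x) (of_real y :: complex)" for z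
    using that assms(2) unfolding closed_segment_of_real closed_segment_eq_real_ivl by auto
  have "norm (of_real y powr (- s) - of_real x powr (- s)) \<le>
      (norm s * x powr (- Re s - 1)) * norm (of_real y - of_real x :: complex)"
  proof (rule field_differentiable_bound)
    fix z assume z: "z \<in> closed_segment (of_real x) (of_real y :: complex)"
    then obtain t where t: "z = of_real t" "x \<le> t" using seg by blast
    then have "z \<notin> \<real>\<^sub>\<le>\<^sub>0" using assms by auto
    then show "((\<lambda>z. z powr (- s)) has_field_derivative (- s * z powr (- s - 1))) (at z within closed_segment (of_real x) (of_real y))"
      by (rule has_field_derivative_at_within[OF has_field_derivative_powr])
    have "norm (z powr (- s - 1)) = t powr (- Re s - 1)"
      using t assms norm_powr_real_powr[of z "- s - 1"] by simp
    also have "\<dots> \<le> x powr (- Re s - 1)" using t assms by (intro powr_mono2') auto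
    finally show "norm (- s * z powr (- s - 1)) \<le> norm s * x powr (- Re s - 1)"
      by (simp add: norm_mult mult_left_mono)
  qed auto
  moreover have "norm (of_real y - of_real x :: complex) = y - x"
    using assms by (simp flip: of_real_diff)
  ultimately show ?thesis by (simp only: norm_minus_commute)
qed

lemma summable_powr_neg:
  assumes "c > (1 :: real)"
  shows "summable (\<lambda>n. real n powr (- c))"
  using assms by (subst summable_real_powr_iff) simp

text \<open>The bound is summable locally uniformly: on a small ball the exponent stays away from -1
  and the monotone factor \<open>C\<close> is bounded by its value at the largest norm.\<close>

lemma holomorphic_series_powr_bound:
  fixes f :: "nat \<Rightarrow> complex \<Rightarrow> complex"
  assumes holo: "\<And>n. f n holomorphic_on {s. Re s > 0}"
    and bound: "\<And>n s. n \<ge> 1 \<Longrightarrow> Re s > 0 \<Longrightarrow> norm (f n s) \<le> C (norm s) * real n powr (- Re s - 1)"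
    and C: "mono_on {0..} C" "\<And>x. x \<ge> 0 \<Longrightarrow> C x \<ge> 0"
  obtains g where "g holomorphic_on {s. Re s > 0}" "\<And>s. Re s > 0 \<Longrightarrow> (\<lambda>n. f n s) sums g s"
proof -
  let ?S = "{s. Re s > 0}"
  have opn: "open ?S" by (rule open_halfspace_Re_gt)
  have deriv: "(f n has_field_derivative deriv (f n) s) (at s)" if "s \<in> ?S" for n s
    using holo[of n] that opn by (auto intro: holomorphic_derivI)
  have "\<exists>g g'. \<forall>s\<in>?S. (\<lambda>n. f n s) sums g s \<and> (\<lambda>n. deriv (f n) s) sums g' s \<and> (g has_field_derivative g' s) (at s)"
  proof (rule series_and_derivative_comparison_local[OF opn deriv])
    fix s assume s: "s \<in> ?S"
    \<comment> \<open>On a ball of radius Re s / 2 the real part stays above Re s / 2.\<close>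
    define d where "d = Re s / 2"
    have d: "d > 0" using s by (simp add: d_def)
    show "\<exists>d h. 0 < d \<and> summable h \<and> (\<forall>\<^sub>F n in sequentially. \<forall>y\<in>ball s d \<inter> ?S. norm (f n y) \<le> h n)"
    proof (intro exI conjI)
      show "d > 0" by fact
      show "summable (\<lambda>n. C (norm s + d) * real n powr (- (d + 1)))"
        using d by (intro summable_mult summable_powr_neg) simp
      show "\<forall>\<^sub>F n in sequentially. \<forall>y\<in>ball s d \<inter> ?S. norm (f n y) \<le> C (norm s + d) * real n powr (- (d + 1))"
        using eventually_ge_at_top[of 1]
      proof eventually_elim
        case (elim n)
        show ?case
        proof
          fix y assume y: "y \<in> ball s d \<inter> ?S"
          then have ny: "norm (s - y) < d" "Re y > 0" by (auto simp: dist_norm)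
          have "norm y \<le> norm s + d" using norm_triangle_sub[of y s] ny by (simp add: norm_minus_commute)
          moreover have "\<bar>Re (s - y)\<bar> < d" using ny abs_Re_le_cmod[of "s - y"] by linarith
          then have "Re s - Re y < d" by (simp add: abs_less_iff)
          then have "Re y \<ge> d" by (simp add: d_def field_simps)
          ultimately have "C (norm y) * real n powr (- Re y - 1) \<le> C (norm s + d) * real n powr (- (d + 1))"
            using elim C(2) d by (intro mult_mono powr_mono mono_onD[OF C(1)]) auto
          then show "norm (f n y) \<le> C (norm s + d) * real n powr (- (d + 1))"
            using bound[OF elim ny(2)] by linarith
        qed
      qed
    qed
  qed
  then obtain g g' where g: "\<And>s. s \<in> ?S \<Longrightarrow> (\<lambda>n. f n s) sums g s \<and> (g has_field_derivative g' s) (at s)"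
    by blast
  have "g holomorphic_on ?S" using g opn by (subst holomorphic_on_open) auto
  then show ?thesis using g that by auto
qed

text \<open>Abel summation: the transformed series gains a power of n from the difference of
  consecutive powers and so converges for every positive real part, while the boundary term
  vanishes.\<close>

lemma dirichlet_series_bounded_partial_sums:
  fixes a :: "nat \<Rightarrow> complex"
  assumes C: "\<And>n. norm (\<Sum>k=1..n. a k) \<le> C"
  obtains g where "g holomorphic_on {s. Re s > 0}"
    "\<And>s. Re s > 0 \<Longrightarrow> (\<lambda>n. a n * of_nat n powr (- s)) sums g s"
proof -
  define A where "A = (\<lambda>n. \<Sum>k=1..n. a k)"
  have C0: "C \<ge> 0" using C[of 0] by simp
  let ?f = "\<lambda>n s. A n * (of_nat n powr (- s) - of_nat (Suc n) powr (- s))"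
  obtain g where g: "g holomorphic_on {s. Re s > 0}" "\<And>s. Re s > 0 \<Longrightarrow> (\<lambda>n. ?f n s) sums g s"
  proof (rule holomorphic_series_powr_bound[of ?f "\<lambda>x. C * x"])
    show "?f n holomorphic_on {s. Re s > 0}" for n
      by (intro holomorphic_intros)
    show "norm (?f n s) \<le> C * norm s * real n powr (- Re s - 1)" if "n \<ge> 1" "Re s > 0" for n s
    proof -
      have "norm ((of_nat n :: complex) powr (- s) - of_nat (Suc n) powr (- s)) \<le> norm s * real n powr (- Re s - 1)"
        using powr_neg_diff_bound[of "real n" "real (Suc n)" s] that by simp
      then have "norm (A n) * norm ((of_nat n :: complex) powr (- s) - of_nat (Suc n) powr (- s)) \<le>
          C * (norm s * real n powr (- Re s - 1))"
        using C[of n] C0 by (intro mult_mono) (auto simp: A_def)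
      then show ?thesis by (simp add: norm_mult mult_ac)
    qed
  qed (use C0 in \<open>auto intro!: mono_onI mult_left_mono\<close>)
  have "(\<lambda>n. a n * of_nat n powr (- s)) sums g s" if s: "Re s > 0" for s
  proof -
    have abel: "(\<Sum>n\<le>N. a n * of_nat n powr (- s)) = A N * of_nat (Suc N) powr (- s) + (\<Sum>n\<le>N. ?f n s)" for N
      by (induction N) (simp_all add: A_def algebra_simps)
    have "(\<lambda>N. real (Suc N) powr (- Re s)) \<longlonglongrightarrow> 0"
      by (rule tendsto_neg_powr[OF _ filterlim_compose[OF filterlim_real_sequentially filterlim_Suc]]) (use s in simp)
    then have "(\<lambda>N. C * real (Suc N) powr (- Re s)) \<longlonglongrightarrow> 0" by (rule tendsto_mult_right_zero)
    then have "(\<lambda>N. A N * of_nat (Suc N) powr (- s)) \<longlonglongrightarrow> 0"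
    proof (rule Lim_null_comparison[rotated])
      have "norm (A N * of_nat (Suc N) powr (- s)) = norm (A N) * real (Suc N) powr (- Re s)" for N
        by (simp only: norm_mult norm_of_nat_powr uminus_complex.sel)
      then show "\<forall>\<^sub>F N in sequentially. norm (A N * of_nat (Suc N) powr (- s)) \<le> C * real (Suc N) powr (- Re s)"
        using C by (intro always_eventually allI) (simp add: A_def mult_right_mono)
    qed
    moreover have "(\<lambda>N. \<Sum>n\<le>N. ?f n s) \<longlonglongrightarrow> g s" using g(2)[OF s] unfolding sums_def_le .
    ultimately have "(\<lambda>N. A N * of_nat (Suc N) powr (- s) + (\<Sum>n\<le>N. ?f n s)) \<longlonglongrightarrow> 0 + g s"
      by (rule tendsto_add)
    then show ?thesis unfolding sums_def_le abel by simp
  qed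
  then show ?thesis using g(1) that by blast
qed

text \<open>\<open>Z\<close> is (s - 1) times the zeta function. From each term (s - 1) n^(-s) its
  integral over [n, n + 1] is subtracted, which leaves a term small enough for Re s > 0; the
  subtracted integrals telescope.\<close>

lemma zeta_minus_pole:
  obtains Z where "Z holomorphic_on {s. Re s > 0}" "Z 1 = 1"
    "\<And>s. Re s > 1 \<Longrightarrow> (\<lambda>n. of_nat n powr (- s)) sums (Z s / (s - 1))"
proof -
  let ?f = "\<lambda>n s. (s - 1) * of_nat n powr (- s) + (of_nat (Suc n) powr (1 - s) - of_nat n powr (1 - s)) :: complex"
  obtain Z where Z: "Z holomorphic_on {s. Re s > 0}" "\<And>s. Re s > 0 \<Longrightarrow> (\<lambda>n. ?f n s) sums Z s"
  proof (rule holomorphic_series_powr_bound[of ?f "\<lambda>x. (x + 1) * x"])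
    show "?f n holomorphic_on {s. Re s > 0}" for n
      by (intro holomorphic_intros)
    show "norm (?f n s) \<le> (norm s + 1) * norm s * real n powr (- Re s - 1)" if n: "n \<ge> 1" and s: "Re s > 0" for n s
    proof -
      \<comment> \<open>The increment of \<open>?g\<close> over the segment is the term itself, and
        subtracting the linear part makes its derivative small there.\<close>
      let ?g = "\<lambda>z. z powr (1 - s) - (1 - s) * of_nat n powr (- s) * z"
      let ?seg = "closed_segment (of_nat n) (of_nat (Suc n) :: complex)"
      have "norm (?g (of_nat (Suc n)) - ?g (of_nat n)) \<le>
          (norm (1 - s) * (norm s * real n powr (- Re s - 1))) * norm (of_nat (Suc n) - of_nat n :: complex)"
      proof (rule field_differentiable_bound)
        fix z assume "z \<in> ?seg"
        then have "z \<in> closed_segment (of_real (real n)) (of_real (real (Suc n)) :: complex)" by simp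
        then obtain t where t: "z = of_real t" "real n \<le> t" "t \<le> real (Suc n)"
          unfolding closed_segment_of_real closed_segment_eq_real_ivl by auto
        then have "z \<notin> \<real>\<^sub>\<le>\<^sub>0" using n by auto
        then show "(?g has_field_derivative (1 - s) * z powr (1 - s - 1) - (1 - s) * of_nat n powr (- s)) (at z within ?seg)"
          by (auto intro!: derivative_eq_intros has_field_derivative_at_within[OF has_field_derivative_powr])
        have "norm (of_real (real n) powr (- s) - of_real t powr (- s)) \<le> norm s * real n powr (- Re s - 1) * (t - real n)"
          using t n s by (intro powr_neg_diff_bound) auto
        also have "\<dots> \<le> norm s * real n powr (- Re s - 1) * 1"
          using t by (intro mult_left_mono) auto
        finally have "norm (z powr (- s) - of_nat n powr (- s)) \<le> norm s * real n powr (- Re s - 1)"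
          using t by (simp add: norm_minus_commute)
        then have "norm (1 - s) * norm (z powr (- s) - of_nat n powr (- s)) \<le> norm (1 - s) * (norm s * real n powr (- Re s - 1))"
          by (intro mult_left_mono) auto
        then show "norm ((1 - s) * z powr (1 - s - 1) - (1 - s) * of_nat n powr (- s)) \<le> norm (1 - s) * (norm s * real n powr (- Re s - 1))"
          by (simp flip: norm_mult right_diff_distrib)
      qed auto
      also have "?g (of_nat (Suc n)) - ?g (of_nat n) = ?f n s" by (simp add: algebra_simps)
      finally have "norm (?f n s) \<le> norm (1 - s) * (norm s * real n powr (- Re s - 1))" by simp
      moreover have "norm (1 - s) \<le> norm s + 1" using norm_triangle_ineq4[of 1 s] by simp
      then have "norm (1 - s) * (norm s * real n powr (- Re s - 1)) \<le> (norm s + 1) * (norm s * real n powr (- Re s - 1))"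
        by (intro mult_right_mono) auto
      ultimately show ?thesis by (simp add: mult_ac)
    qed
  qed (auto intro!: mono_onI mult_mono)
  have "(\<lambda>n. ?f n 1) sums 1"
  proof -
    \<comment> \<open>The term at n = 0 supplies the value 1: \<open>0 powr 0\<close> is 0 by
      convention while \<open>1 powr 0\<close> is 1.\<close>
    have "(\<lambda>n. ?f n 1) = (\<lambda>n. if n = 0 then 1 else 0)" by (auto simp: fun_eq_iff simp del: of_nat_Suc)
    then show ?thesis using sums_single[of 0 "\<lambda>_. 1 :: complex"] by simp
  qed
  then have "Z 1 = 1" using Z(2)[of 1] sums_unique2 by auto
  moreover have "(\<lambda>n. of_nat n powr (- s)) sums (Z s / (s - 1))" if s: "Re s > 1" for s
  proof -
    have "(\<Sum>n\<le>N. ?f n s) = (s - 1) * (\<Sum>n\<le>N. of_nat n powr (- s)) + of_nat (Suc N) powr (1 - s)" for N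
      by (induction N) (simp_all add: algebra_simps)
    moreover have "s - 1 \<noteq> 0" using s by auto
    ultimately have eq: "(\<Sum>n\<le>N. of_nat n powr (- s)) = ((\<Sum>n\<le>N. ?f n s) - of_nat (Suc N) powr (1 - s)) / (s - 1)" for N
      by (simp only: add_diff_cancel_right' nonzero_mult_div_cancel_left simp_thms)
    have "(\<lambda>N. real (Suc N) powr (1 - Re s)) \<longlonglongrightarrow> 0"
      by (rule tendsto_neg_powr[OF _ filterlim_compose[OF filterlim_real_sequentially filterlim_Suc]]) (use s in simp)
    then have "(\<lambda>N. (of_nat (Suc N) :: complex) powr (1 - s)) \<longlonglongrightarrow> 0"
      by (subst tendsto_norm_zero_iff[symmetric]) (simp only: norm_of_nat_powr minus_complex.sel one_complex.sel)
    moreover have "(\<lambda>N. \<Sum>n\<le>N. ?f n s) \<longlonglongrightarrow> Z s" using Z(2)[of s] s unfolding sums_def_le by simp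
    ultimately have "(\<lambda>N. ((\<Sum>n\<le>N. ?f n s) - of_nat (Suc N) powr (1 - s)) / (s - 1)) \<longlonglongrightarrow> (Z s - 0) / (s - 1)"
      using s by (intro tendsto_intros) auto
    then show ?thesis unfolding sums_def_le eq by simp
  qed
  ultimately show ?thesis using Z(1) that by blast
qed

section \<open>Dirichlet convolution\<close>

lemma has_sum_pairs_divisors:
  fixes u :: "nat \<times> nat \<Rightarrow> complex"
  assumes "(u has_sum S) ({1..} \<times> {1..})"
  shows "((\<lambda>n. \<Sum>d | d dvd n. u (d, n div d)) has_sum S) {1..}"
proof -
  have "((\<lambda>(n, d). u (d, n div d)) has_sum S) (Sigma {1..} (\<lambda>n. {d. d dvd n})) \<longleftrightarrow> (u has_sum S) ({1..} \<times> {1..})"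
    by (rule has_sum_reindex_bij_witness[where i = "\<lambda>(d, e). (d * e, d)" and j = "\<lambda>(n, d). (d, n div d)"])
      (auto simp: Suc_le_eq elim!: dvdE)
  with assms have "((\<lambda>(n, d). u (d, n div d)) has_sum S) (Sigma {1..} (\<lambda>n. {d. d dvd n}))" by simp
  then show ?thesis
    by (rule has_sum_SigmaD) (auto intro!: has_sum_finite simp: Suc_le_eq)
qed

lemma sums_divisor_sums:
  fixes u :: "nat \<times> nat \<Rightarrow> complex"
  assumes "(u has_sum S) ({1..} \<times> {1..})"
  shows "(\<lambda>n. \<Sum>d | d dvd n. u (d, n div d)) sums S"
proof -
  let ?f = "\<lambda>n. \<Sum>d | d dvd n. u (d, n div d)"
  \<comment> \<open>Every number divides 0, and a sum over an infinite set is 0 by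
    convention.\<close>
  have "?f 0 = 0" by (simp add: infinite_UNIV_nat)
  then have "(?f has_sum S) UNIV"
    using has_sum_pairs_divisors[OF assms]
    by (subst has_sum_cong_neutral[of "{1..}" UNIV ?f ?f]) (auto simp: not_less_eq_eq)
  then show ?thesis by (rule has_sum_imp_sums)
qed

lemma has_sum_product_pairs:
  fixes f g :: "nat \<Rightarrow> complex"
  assumes f: "summable (\<lambda>n. norm (f n))" "f sums F" "f 0 = 0"
    and g: "summable (\<lambda>n. norm (g n))" "g sums G" "g 0 = 0"
  shows "((\<lambda>(d, e). f d * g e) has_sum F * G) ({1..} \<times> {1..})"
proof -
  have restrict: "(h has_sum H) {1..}" if "summable (\<lambda>n. norm (h n))" "h sums H" "h 0 = 0" for h :: "nat \<Rightarrow> complex" and H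
    using norm_summable_imp_has_sum[OF that(1,2)] that(3)
    by (subst has_sum_cong_neutral[of UNIV "{1..}" h h]) (auto simp: not_less_eq_eq)
  have fs: "(f has_sum F) {1..}" and gs: "(g has_sum G) {1..}" using restrict f g by blast+
  have absum: "(\<lambda>n. norm (h n)) summable_on {1..}" if "summable (\<lambda>n. norm (h n))" for h :: "nat \<Rightarrow> complex"
    using that by (intro summable_on_subset_banach[OF norm_summable_imp_summable_on subset_UNIV]) simp
  have "(\<lambda>x. norm (case x of (d, e) \<Rightarrow> f d * g e)) summable_on ({1..} \<times> {1..})"
  proof (rule summable_on_SigmaI)
    show "((\<lambda>e. norm (case (d, e) of (d, e) \<Rightarrow> f d * g e)) has_sum norm (f d) * (\<Sum>\<^sub>\<infinity>e\<in>{1..}. norm (g e))) {1..}" for d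
      using has_sum_cmult_right[OF has_sum_infsum[OF absum[OF g(1)]]] by (simp add: norm_mult)
    show "(\<lambda>d. norm (f d) * (\<Sum>\<^sub>\<infinity>e\<in>{1..}. norm (g e))) summable_on {1..}"
      by (intro summable_on_cmult_left absum f)
  qed auto
  then have "(\<lambda>(d, e). f d * g e) summable_on ({1..} \<times> {1..})" by (rule abs_summable_summable)
  then show ?thesis
    using has_sum_cmult_right[OF gs] has_sum_cmult_left[OF fs]
    by (intro has_sum_SigmaI[where g = "\<lambda>d. f d * G"]) auto
qed

lemma dirichlet_product:
  fixes a b :: "nat \<Rightarrow> complex"
  assumes "summable (\<lambda>n. norm (a n * of_nat n powr (- s)))" "(\<lambda>n. a n * of_nat n powr (- s)) sums F"
    and "summable (\<lambda>n. norm (b n * of_nat n powr (- s)))" "(\<lambda>n. b n * of_nat n powr (- s)) sums G"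
  shows "(\<lambda>n. (\<Sum>d | d dvd n. a d * b (n div d)) * of_nat n powr (- s)) sums (F * G)"
proof -
  have "(\<lambda>n. \<Sum>d | d dvd n. (\<lambda>(d, e). (a d * of_nat d powr (- s)) * (b e * of_nat e powr (- s))) (d, n div d)) sums (F * G)"
    by (intro sums_divisor_sums has_sum_product_pairs assms) auto
  also have "(\<lambda>n. \<Sum>d | d dvd n. (\<lambda>(d, e). (a d * of_nat d powr (- s)) * (b e * of_nat e powr (- s))) (d, n div d)) =
      (\<lambda>n. (\<Sum>d | d dvd n. a d * b (n div d)) * of_nat n powr (- s))"
  proof
    fix n
    show "(\<Sum>d | d dvd n. (\<lambda>(d, e). (a d * of_nat d powr (- s)) * (b e * of_nat e powr (- s))) (d, n div d)) =
      (\<Sum>d | d dvd n. a d * b (n div d)) * of_nat n powr (- s)"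
    proof (cases "n = 0")
      case False
      have "(a d * of_nat d powr (- s)) * (b (n div d) * of_nat (n div d) powr (- s)) = a d * b (n div d) * of_nat n powr (- s)"
        if "d dvd n" for d
        using of_nat_powr_mult[of d "- s" "n div d", unfolded dvd_mult_div_cancel[OF that], symmetric]
        by (simp add: mult_ac)
      then show ?thesis unfolding sum_distrib_right by (intro sum.cong) simp_all
    qed (simp add: infinite_UNIV_nat)
  qed
  finally show ?thesis .
qed

section \<open>The Moebius and von Mangoldt functions\<close>

definition moebius_mu :: "nat \<Rightarrow> real" where
  "moebius_mu n = (if squarefree n then (-1) ^ card (prime_factors n) else 0)"

lemma moebius_mu_1 [simp]: "moebius_mu (Suc 0) = 1"
  by (simp add: moebius_mu_def)

lemma abs_moebius_mu_le: "\<bar>moebius_mu n\<bar> \<le> 1"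
  by (simp add: moebius_mu_def)

lemma moebius_mu_prime_mult:
  assumes "prime p" "\<not> p dvd d"
  shows "moebius_mu (p * d) = - moebius_mu d"
proof -
  have "d \<noteq> 0" using assms by (metis dvd_0_right)
  have cop: "coprime p d" using assms by (simp add: prime_imp_coprime)
  have "prime_factors (p * d) = insert p (prime_factors d)"
    using assms \<open>d \<noteq> 0\<close> prime_gt_0_nat[of p] by (simp add: prime_factors_product prime_prime_factors)
  moreover have "p \<notin> prime_factors d" using assms by auto
  moreover have "squarefree (p * d) \<longleftrightarrow> squarefree d"
    using squarefree_mult_coprime[OF cop] squarefree_multD[of p d] squarefree_prime[OF assms(1)] by blast
  ultimately show ?thesis by (simp add: moebius_mu_def)
qed

text \<open>For a fixed prime \<open>p\<close> dividing \<open>n\<close>, the squarefree divisors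
  pair up as \<open>d\<close> and \<open>p * d\<close> with opposite signs.\<close>

lemma sum_moebius_mu_divisors:
  assumes "n > 0"
  shows "(\<Sum>d | d dvd n. moebius_mu d) = (if n = 1 then 1 else 0)"
proof (cases "n = 1")
  case False
  then obtain p where p: "prime p" "p dvd n" using prime_factor_nat by blast
  let ?A = "{d. d dvd n \<and> squarefree d \<and> \<not> p dvd d}"
  have fin: "finite {d. d dvd n}" using assms by simp
  have "(\<Sum>d | d dvd n. moebius_mu d) = (\<Sum>d | d dvd n \<and> squarefree d. moebius_mu d)"
    using fin by (intro sum.mono_neutral_right) (auto simp: moebius_mu_def)
  also have "{d. d dvd n \<and> squarefree d} = ?A \<union> (\<lambda>d. p * d) ` ?A"
  proof (intro equalityI subsetI)
    fix d assume d: "d \<in> {d. d dvd n \<and> squarefree d}"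
    show "d \<in> ?A \<union> (\<lambda>d. p * d) ` ?A"
    proof (cases "p dvd d")
      case True
      then obtain e where e: "d = p * e" by blast
      have "\<not> p dvd e"
      proof
        assume "p dvd e"
        then have "p ^ 2 dvd d" unfolding e power2_eq_square by simp
        then show False using d p(1) by (auto simp: squarefree_def)
      qed
      moreover have "squarefree e" using d e squarefree_multD(2) by blast
      moreover have "e dvd n" using d e by (auto intro: dvd_trans)
      ultimately show ?thesis using e by auto
    qed (use d in auto)
  next
    fix d assume "d \<in> ?A \<union> (\<lambda>d. p * d) ` ?A"
    moreover have "p * e dvd n \<and> squarefree (p * e)" if "e \<in> ?A" for e
    proof -
      have "coprime p e" using that p by (simp add: prime_imp_coprime)
      then show ?thesis using that p divides_mult[of p n e] squarefree_mult_coprime[of p e] squarefree_prime[OF p(1)]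
        by blast
    qed
    ultimately show "d \<in> {d. d dvd n \<and> squarefree d}" by auto
  qed
  also have "(\<Sum>d\<in>?A \<union> (\<lambda>d. p * d) ` ?A. moebius_mu d) = (\<Sum>d\<in>?A. moebius_mu d) + (\<Sum>d\<in>(\<lambda>d. p * d) ` ?A. moebius_mu d)"
    using fin by (intro sum.union_disjoint) auto
  also have "(\<Sum>d\<in>(\<lambda>d. p * d) ` ?A. moebius_mu d) = (\<Sum>d\<in>?A. moebius_mu (p * d))"
    using prime_gt_0_nat[OF p(1)] by (subst sum.reindex) (auto simp: inj_on_def)
  also have "\<dots> = (\<Sum>d\<in>?A. - moebius_mu d)"
    using p by (intro sum.cong refl moebius_mu_prime_mult) auto
  finally show ?thesis using False by (simp add: sum_negf)
qed simp

text \<open>Moebius inversion of the expansion of ln as the divisor sum of \<open>mangoldt\<close>: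
  after exchanging the sums only \<open>e = n\<close> survives.\<close>

lemma sum_moebius_mu_ln:
  assumes "n > 0"
  shows "(\<Sum>d | d dvd n. moebius_mu d * ln (real (n div d))) = mangoldt n"
proof -
  have fin: "finite {d. d dvd n}" using assms by simp
  have "(\<Sum>d | d dvd n. moebius_mu d * ln (real (n div d))) =
      (\<Sum>d | d dvd n. \<Sum>e | e dvd n div d. moebius_mu d * mangoldt e)"
  proof (intro sum.cong refl)
    fix d assume "d \<in> {d. d dvd n}"
    then have "n div d \<noteq> 0" using assms by (auto elim!: dvdE)
    then show "moebius_mu d * ln (real (n div d)) = (\<Sum>e | e dvd n div d. moebius_mu d * mangoldt e)"
      using mangoldt_sum[of "n div d", where ?'a = real] by (simp flip: sum_distrib_left)
  qed
  also have "\<dots> = (\<Sum>(d, e)\<in>(SIGMA d:{d. d dvd n}. {e. e dvd n div d}). moebius_mu d * mangoldt e)"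
    using assms fin by (intro sum.Sigma) (auto elim!: dvdE)
  also have "\<dots> = (\<Sum>(e, d)\<in>(SIGMA e:{e. e dvd n}. {d. d dvd n div e}). moebius_mu d * mangoldt e)"
    using assms by (intro sum.reindex_bij_witness[of _ "\<lambda>(d, e). (e, d)" "\<lambda>(d, e). (e, d)"])
      (auto simp: dvd_div_iff_mult[symmetric] mult.commute elim!: dvdE)
  also have "\<dots> = (\<Sum>e | e dvd n. \<Sum>d | d dvd n div e. moebius_mu d * mangoldt e)"
    using assms fin by (intro sum.Sigma[symmetric]) (auto elim!: dvdE)
  also have "\<dots> = (\<Sum>e | e dvd n. mangoldt e * (if n div e = 1 then 1 else 0))"
  proof (intro sum.cong refl)
    fix e assume "e \<in> {e. e dvd n}"
    then have "n div e > 0" using assms by (auto elim!: dvdE)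
    then show "(\<Sum>d | d dvd n div e. moebius_mu d * mangoldt e) = mangoldt e * (if n div e = 1 then 1 else 0)"
      using sum_moebius_mu_divisors[of "n div e"] by (simp flip: sum_distrib_right)
  qed
  also have "\<dots> = (\<Sum>e\<in>{n}. mangoldt e * (if n div e = 1 then 1 else 0))"
    using assms fin by (intro sum.mono_neutral_right) (auto elim!: dvdE)
  finally show ?thesis using assms by simp
qed

text \<open>The bound of ln n by n^a / a uses up half of the margin by which \<open>c\<close>
  exceeds 1.\<close>

lemma summable_ln_powr:
  assumes "c > (1 :: real)"
  shows "summable (\<lambda>n. ln (real n) * real n powr (- c))"
proof -
  define a where "a = (c - 1) / 2"
  have a: "a > 0" "c - a > 1" using assms by (simp_all add: a_def field_simps)
  show ?thesis
  proof (rule summable_comparison_test)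
    show "summable (\<lambda>n. (1 / a) * real n powr (- (c - a)))"
      using a by (intro summable_mult summable_powr_neg)
    have "norm (ln (real n) * real n powr (- c)) \<le> (1 / a) * real n powr (- (c - a))" if "n \<ge> 1" for n
    proof -
      have "ln (real n) * real n powr (- c) \<le> (real n powr a / a) * real n powr (- c)"
        using that a by (intro mult_right_mono ln_powr_bound) auto
      also have "\<dots> = (1 / a) * (real n powr a * real n powr (- c))" by simp
      also have "real n powr a * real n powr (- c) = real n powr (- (c - a))" by (simp flip: powr_add)
      finally show ?thesis using that by simp
    qed
    then show "\<exists>N. \<forall>n\<ge>N. norm (ln (real n) * real n powr (- c)) \<le> (1 / a) * real n powr (- (c - a))" by blast
  qed
qed

lemma summable_dirichlet_bounded:
  fixes a :: "nat \<Rightarrow> complex"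
  assumes "\<And>n. norm (a n) \<le> K" "Re s > 1"
  shows "summable (\<lambda>n. norm (a n * of_nat n powr (- s)))"
proof (rule summable_comparison_test)
  show "summable (\<lambda>n. K * real n powr (- Re s))"
    using assms by (intro summable_mult summable_powr_neg)
  show "\<exists>N. \<forall>n\<ge>N. norm (norm (a n * of_nat n powr (- s))) \<le> K * real n powr (- Re s)"
    using assms(1) by (auto simp: norm_mult norm_of_nat_powr mult_right_mono)
qed

lemma summable_dirichlet_ln:
  fixes a :: "nat \<Rightarrow> complex"
  assumes "\<And>n. n > 0 \<Longrightarrow> norm (a n) \<le> ln (real n)" "Re s > 1"
  shows "summable (\<lambda>n. norm (a n * of_nat n powr (- s)))"
proof (rule summable_comparison_test)
  show "summable (\<lambda>n. ln (real n) * real n powr (- Re s))"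
    using assms by (intro summable_ln_powr)
  show "\<exists>N. \<forall>n\<ge>N. norm (norm (a n * of_nat n powr (- s))) \<le> ln (real n) * real n powr (- Re s)"
    using assms(1) by (auto simp: norm_mult norm_of_nat_powr intro!: exI[of _ 1] mult_right_mono)
qed

text \<open>Termwise differentiation brings in \<open>c n * ln n\<close>, which by complete
  multiplicativity is the convolution of \<open>c * mangoldt\<close> with \<open>c\<close>. The
  product form of the conclusion does not presuppose that \<open>G s\<close> is non-zero.\<close>

lemma dirichlet_log_derivative:
  fixes c :: "nat \<Rightarrow> real"
  assumes mult: "\<And>a b. c (a * b) = c a * c b" and bound: "\<And>n. \<bar>c n\<bar> \<le> 1"
    and G: "\<And>s. Re s > 1 \<Longrightarrow> (\<lambda>n. of_real (c n) * of_nat n powr (- s)) sums G s"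
    and s: "Re s > 1"
  shows "\<exists>V. (\<lambda>n. of_real (c n * mangoldt n) * of_nat n powr (- s)) sums V \<and> deriv G s = - (V * G s)"
proof -
  let ?S = "{s. Re s > 1}"
  have "\<exists>g g'. \<forall>x\<in>?S. (\<lambda>n. of_real (c n) * of_nat n powr (- x)) sums g x \<and>
      (\<lambda>n. - (of_real (c n * ln (real n)) * of_nat n powr (- x))) sums g' x \<and> (g has_field_derivative g' x) (at x)"
  proof (rule series_and_derivative_comparison_local)
    show "open ?S" by (rule open_halfspace_Re_gt)
    show "((\<lambda>x. of_real (c n) * of_nat n powr (- x)) has_field_derivative
        - (of_real (c n * ln (real n)) * of_nat n powr (- x))) (at x)" for n and x :: complex
    proof (cases "n = 0")
      case False
      have "((\<lambda>x. (of_nat n :: complex) powr (- x)) has_field_derivative (Ln (of_nat n) * of_nat n powr (- x)) * (- 1)) (at x)"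
        using False by (intro DERIV_chain2[OF has_field_derivative_powr_right]) (auto intro!: derivative_eq_intros)
      from DERIV_cmult[OF this, of "of_real (c n)"] show ?thesis
        using False by (simp add: mult_ac)
    qed simp
    fix x :: complex assume x: "x \<in> ?S"
    define d where "d = (Re x - 1) / 2"
    have d: "d > 0" using x by (simp add: d_def)
    show "\<exists>d h. 0 < d \<and> summable h \<and>
      (\<forall>\<^sub>F n in sequentially. \<forall>y\<in>ball x d \<inter> ?S. norm (of_real (c n) * of_nat n powr (- y)) \<le> h n)"
    proof (intro exI conjI)
      show "d > 0" by fact
      show "summable (\<lambda>n. real n powr (- (1 + d)))" using d by (intro summable_powr_neg) simp
      show "\<forall>\<^sub>F n in sequentially. \<forall>y\<in>ball x d \<inter> ?S. norm (of_real (c n) * of_nat n powr (- y)) \<le> real n powr (- (1 + d))"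
        using eventually_ge_at_top[of 1]
      proof eventually_elim
        case (elim n)
        show ?case
        proof
          fix y assume "y \<in> ball x d \<inter> ?S"
          then have "\<bar>Re (x - y)\<bar> < d" using abs_Re_le_cmod[of "x - y"] by (simp add: dist_norm)
          then have "Re x - Re y < d" by (simp add: abs_less_iff)
          then have "Re y \<ge> 1 + d" by (simp add: d_def field_simps)
          then have "\<bar>c n\<bar> * real n powr (- Re y) \<le> 1 * real n powr (- (1 + d))"
            using elim bound[of n] by (intro mult_mono powr_mono) auto
          then show "norm (of_real (c n) * of_nat n powr (- y)) \<le> real n powr (- (1 + d))"
            by (simp add: norm_mult norm_of_nat_powr)
        qed
      qed
    qed
  qed
  then obtain g g' where g: "\<And>x. Re x > 1 \<Longrightarrow> (\<lambda>n. of_real (c n) * of_nat n powr (- x)) sums g x"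
      "\<And>x. Re x > 1 \<Longrightarrow> (\<lambda>n. - (of_real (c n * ln (real n)) * of_nat n powr (- x))) sums g' x"
      "\<And>x. Re x > 1 \<Longrightarrow> (g has_field_derivative g' x) (at x)" by auto
  have gG: "g x = G x" if "x \<in> ?S" for x using g(1)[of x] G[of x] that sums_unique2 by blast
  have "(G has_field_derivative g' s) (at s)"
    using has_field_derivative_transform_within_open[OF g(3)[OF s] open_halfspace_Re_gt[of 1] _ gG] s by simp
  then have deriv: "deriv G s = g' s" by (rule DERIV_imp_deriv)
  have s1: "summable (\<lambda>n. norm (complex_of_real (c n * mangoldt n) * of_nat n powr (- s)))"
  proof (rule summable_dirichlet_ln[OF _ s])
    fix n :: nat assume "n > 0"
    have "\<bar>c n\<bar> * (mangoldt n :: real) \<le> 1 * ln (real n)"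
      using bound[of n] mangoldt_le[OF \<open>n > 0\<close>] mangoldt_nonneg[of n] by (intro mult_mono) auto
    then show "norm (complex_of_real (c n * mangoldt n)) \<le> ln (real n)"
      by (simp add: abs_mult mangoldt_nonneg norm_mult)
  qed
  have s2: "summable (\<lambda>n. norm (complex_of_real (c n) * of_nat n powr (- s)))"
    using bound by (intro summable_dirichlet_bounded[OF _ s, of _ 1]) simp
  define V where "V = (\<Sum>n. complex_of_real (c n * mangoldt n) * of_nat n powr (- s))"
  have V: "(\<lambda>n. complex_of_real (c n * mangoldt n) * of_nat n powr (- s)) sums V"
    unfolding V_def by (rule summable_sums[OF summable_norm_cancel[OF s1]])
  have "(\<lambda>n. (\<Sum>d | d dvd n. complex_of_real (c d * mangoldt d) * of_real (c (n div d))) * of_nat n powr (- s)) sums (V * G s)"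
    by (rule dirichlet_product[OF s1 V s2 G[OF s]])
  also have "(\<lambda>n. (\<Sum>d | d dvd n. complex_of_real (c d * mangoldt d) * of_real (c (n div d))) * of_nat n powr (- s)) =
      (\<lambda>n. of_real (c n * ln (real n)) * of_nat n powr (- s))"
  proof
    fix n :: nat
    show "(\<Sum>d | d dvd n. complex_of_real (c d * mangoldt d) * of_real (c (n div d))) * of_nat n powr (- s) =
      of_real (c n * ln (real n)) * of_nat n powr (- s)"
    proof (cases "n = 0")
      case False
      have "(\<Sum>d | d dvd n. complex_of_real (c d * mangoldt d) * of_real (c (n div d))) =
          (\<Sum>d | d dvd n. of_real (c n) * mangoldt d)"
      proof (intro sum.cong refl)
        fix d assume "d \<in> {d. d dvd n}"
        then have "c n = c d * c (n div d)" using mult[of d "n div d"] by simp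
        then show "complex_of_real (c d * mangoldt d) * of_real (c (n div d)) = of_real (c n) * mangoldt d"
          by (simp add: mult_ac)
      qed
      also have "\<dots> = of_real (c n) * of_real (ln (real n))"
        using mangoldt_sum[OF False, where ?'a = complex] by (simp flip: sum_distrib_left)
      finally show ?thesis by simp
    qed simp
  qed
  finally have "(\<lambda>n. - (of_real (c n * ln (real n)) * of_nat n powr (- s))) sums (- (V * G s))"
    by (rule sums_minus)
  then have "g' s = - (V * G s)" using g(2)[OF s] sums_unique2 by blast
  then show ?thesis using V deriv by auto
qed

text \<open>\<open>m\<close> is the order of the zero at \<open>s0\<close>: the logarithmic
  derivative has a simple pole with residue \<open>m\<close>, and multiplying by the distance
  extracts it.\<close>

lemma log_derivative_at_point:
  assumes S: "open S" "g holomorphic_on S" "s0 \<in> S"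
    and nz: "\<And>s. Re s > Re s0 \<Longrightarrow> g s \<noteq> 0"
  shows "\<exists>m::nat. (g s0 = 0 \<longrightarrow> m > 0) \<and>
    ((\<lambda>x. of_real x * deriv g (s0 + of_real x) / g (s0 + of_real x)) \<longlongrightarrow> of_nat m) (at_right 0)"
proof -
  obtain r where r: "r > 0" "ball s0 r \<subseteq> S" using S open_contains_ball by blast
  have x: "((\<lambda>x. complex_of_real x) \<longlongrightarrow> 0) (at_right 0)"
    by (auto intro!: tendsto_eq_intros)
  have pt: "((\<lambda>x. s0 + complex_of_real x) \<longlongrightarrow> s0) (at_right 0)"
    by (auto intro!: tendsto_eq_intros)
  show ?thesis
  proof (cases "g s0 = 0")
    case False
    have "isCont g s0" "isCont (deriv g) s0"
      using S holomorphic_deriv[OF S(2,1)] holomorphic_on_imp_continuous_on continuous_on_eq_continuous_at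
      by blast+
    then have "((\<lambda>x. of_real x * deriv g (s0 + of_real x) / g (s0 + of_real x)) \<longlongrightarrow> 0 * deriv g s0 / g s0) (at_right 0)"
      using False by (intro tendsto_intros x isCont_tendsto_compose[OF _ pt])
    then show ?thesis using False by (intro exI[of _ 0]) simp
  next
    case True
    \<comment> \<open>A function constant near \<open>s0\<close> would vanish to the right of
      \<open>s0\<close> as well, against \<open>nz\<close>.\<close>
    have "\<not> g constant_on ball s0 r"
    proof
      assume "g constant_on ball s0 r"
      then obtain c where c: "\<And>z. z \<in> ball s0 r \<Longrightarrow> g z = c" unfolding constant_on_def by blast
      have "g (s0 + of_real (r / 2)) = g s0" using r(1) by (subst (1 2) c) (auto simp: dist_norm)
      then show False using True nz[of "s0 + of_real (r / 2)"] r(1) by simp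
    qed
    then obtain h r' n where h: "0 < n" "0 < r'" "ball s0 r' \<subseteq> ball s0 r" "h holomorphic_on ball s0 r'"
      "\<And>w. w \<in> ball s0 r' \<Longrightarrow> g w = (w - s0) ^ n * h w" "\<And>w. w \<in> ball s0 r' \<Longrightarrow> h w \<noteq> 0"
      using holomorphic_factor_zero_nonconstant[of g "ball s0 r" s0] r S(2) True holomorphic_on_subset
      by (metis centre_in_ball connected_ball open_ball)
    have "isCont h s0" "isCont (deriv h) s0"
      using h(2,4) holomorphic_deriv[OF h(4) open_ball] holomorphic_on_imp_continuous_on
      by (metis centre_in_ball continuous_on_eq_continuous_at open_ball)+
    moreover have "h s0 \<noteq> 0" using h by simp
    ultimately have "((\<lambda>x. of_nat n + of_real x * deriv h (s0 + of_real x) / h (s0 + of_real x)) \<longlongrightarrow>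
        of_nat n + 0 * deriv h s0 / h s0) (at_right 0)"
      by (intro tendsto_intros x isCont_tendsto_compose[OF _ pt])
    moreover have "\<forall>\<^sub>F x in at_right 0. of_nat n + of_real x * deriv h (s0 + of_real x) / h (s0 + of_real x) =
        of_real x * deriv g (s0 + of_real x) / g (s0 + of_real x)"
      using eventually_at_right_real[OF h(2)]
    proof eventually_elim
      case (elim x)
      let ?w = "s0 + complex_of_real x"
      have w: "?w \<in> ball s0 r'" using elim by (auto simp: dist_norm)
      have "(h has_field_derivative deriv h ?w) (at ?w)"
        using h(4) w by (auto intro: holomorphic_derivI)
      then have "((\<lambda>w. (w - s0) ^ n * h w) has_field_derivative
          (of_nat n * (?w - s0) ^ (n - 1) * h ?w + (?w - s0) ^ n * deriv h ?w)) (at ?w)"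
        by (auto intro!: derivative_eq_intros)
      then have "(g has_field_derivative
          (of_nat n * (?w - s0) ^ (n - 1) * h ?w + (?w - s0) ^ n * deriv h ?w)) (at ?w)"
        by (rule has_field_derivative_transform_within_open[OF _ open_ball w]) (simp add: h(5))
      then have "deriv g ?w = of_nat n * of_real x ^ (n - 1) * h ?w + of_real x ^ n * deriv h ?w"
        by (simp add: DERIV_imp_deriv)
      moreover have "g ?w = of_real x ^ n * h ?w" using h(5)[OF w] by simp
      moreover have "(of_real x :: complex) ^ n = of_real x * of_real x ^ (n - 1)"
        using h(1) by (cases n) auto
      ultimately show ?case using elim h(6)[OF w] by (simp add: field_simps)
    qed
    ultimately show ?thesis using h(1)
      by (intro exI[of _ n]) (simp add: tendsto_cong)
  qed
qed

text \<open>The vanishing sum over a period says that the character is not principal, and it makes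
  all partial sums bounded.\<close>

locale real_character =
  fixes q :: nat and \<psi> :: "nat \<Rightarrow> real"
  assumes q_pos: "q > 0"
    and mult: "\<psi> (a * b) = \<psi> a * \<psi> b" and one: "\<psi> 1 = 1"
    and range: "\<psi> n \<in> {-1, 0, 1}"
    and period: "\<psi> (n + q) = \<psi> n"
    and sum_period: "(\<Sum>n<q. \<psi> n) = 0"
begin

lemma abs_le_1: "\<bar>\<psi> n\<bar> \<le> 1"
  using range[of n] by auto

text \<open>A non-zero value at 0 would force the constant 1, whose sum over a period is
  \<open>q\<close>.\<close>

lemma chi_0: "\<psi> 0 = 0"
proof (rule ccontr)
  assume "\<psi> 0 \<noteq> 0"
  then have "\<psi> n = 1" for n using mult[of 0 n] by simp
  then show False using sum_period q_pos by simp
qed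

lemma partial_sum_bound: "\<bar>\<Sum>k<n. \<psi> k\<bar> \<le> real q"
proof -
  have "(\<Sum>k<q * j + r. \<psi> k) = (\<Sum>k<r. \<psi> k)" for j r
  proof (induction j)
    case (Suc j)
    have "(\<Sum>k<q + m. \<psi> k) = (\<Sum>k<q. \<psi> k) + (\<Sum>k<m. \<psi> (k + q))" for m
      by (induction m) (simp_all add: add.commute)
    from this[of "q * j + r"] have "(\<Sum>k<q + (q * j + r). \<psi> k) = (\<Sum>k<q. \<psi> k) + (\<Sum>k<q * j + r. \<psi> (k + q))" .
    then show ?case using Suc by (simp add: sum_period period algebra_simps)
  qed simp
  from this[of "n div q" "n mod q"] have "(\<Sum>k<n. \<psi> k) = (\<Sum>k<n mod q. \<psi> k)" by simp
  also have "\<bar>\<dots>\<bar> \<le> (\<Sum>k<n mod q. 1)" by (rule order_trans[OF sum_abs sum_mono[OF abs_le_1]])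
  also have "\<dots> \<le> real q" using q_pos by (simp add: less_imp_le)
  finally show ?thesis .
qed

lemma partial_sum_bound': "\<bar>\<Sum>k=1..n. \<psi> k\<bar> \<le> real q"
proof -
  have "(\<Sum>k<Suc n. \<psi> k) = (\<Sum>k=1..n. \<psi> k)"
    by (rule sum.mono_neutral_right) (auto simp: chi_0 Suc_le_eq)
  then show ?thesis using partial_sum_bound[of "Suc n"] by simp
qed

lemma L_function:
  obtains L where "L holomorphic_on {s. Re s > 0}"
    "\<And>s. Re s > 0 \<Longrightarrow> (\<lambda>n. of_real (\<psi> n) * of_nat n powr (- s)) sums L s"
proof -
  have "norm (\<Sum>k=1..n. complex_of_real (\<psi> k)) \<le> real q" for n
    using partial_sum_bound'[of n] by (simp flip: of_real_sum)
  then show ?thesis using dirichlet_series_bounded_partial_sums that by blast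
qed

text \<open>By complete multiplicativity the convolution of \<mu> \<psi> with \<psi> is \<psi> times
  the divisor sum of \<mu>.\<close>

lemma moebius_product:
  assumes L: "(\<lambda>n. of_real (\<psi> n) * of_nat n powr (- s)) sums Ls" and s: "Re s > 1"
  shows "\<exists>M. (\<lambda>n. of_real (moebius_mu n * \<psi> n) * of_nat n powr (- s)) sums M \<and> M * Ls = 1"
proof -
  have s1: "summable (\<lambda>n. norm (complex_of_real (moebius_mu n * \<psi> n) * of_nat n powr (- s)))"
    using mult_mono[OF abs_moebius_mu_le abs_le_1]
    by (intro summable_dirichlet_bounded[OF _ s, of _ 1]) (auto simp: abs_mult norm_mult)
  have s2: "summable (\<lambda>n. norm (complex_of_real (\<psi> n) * of_nat n powr (- s)))"
    using abs_le_1 by (intro summable_dirichlet_bounded[OF _ s, of _ 1]) simp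
  define M where "M = (\<Sum>n. complex_of_real (moebius_mu n * \<psi> n) * of_nat n powr (- s))"
  have M: "(\<lambda>n. complex_of_real (moebius_mu n * \<psi> n) * of_nat n powr (- s)) sums M"
    unfolding M_def by (rule summable_sums[OF summable_norm_cancel[OF s1]])
  have "(\<lambda>n. (\<Sum>d | d dvd n. complex_of_real (moebius_mu d * \<psi> d) * of_real (\<psi> (n div d))) * of_nat n powr (- s)) sums (M * Ls)"
    by (rule dirichlet_product[OF s1 M s2 L])
  also have "(\<lambda>n. (\<Sum>d | d dvd n. complex_of_real (moebius_mu d * \<psi> d) * of_real (\<psi> (n div d))) * of_nat n powr (- s)) =
      (\<lambda>n. if n = 1 then 1 else 0)"
  proof
    fix n :: nat
    show "(\<Sum>d | d dvd n. complex_of_real (moebius_mu d * \<psi> d) * of_real (\<psi> (n div d))) * of_nat n powr (- s) =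
      (if n = 1 then 1 else 0)"
    proof (cases "n = 0")
      case False
      have "(\<Sum>d | d dvd n. complex_of_real (moebius_mu d * \<psi> d) * of_real (\<psi> (n div d))) =
          (\<Sum>d | d dvd n. of_real (\<psi> n) * of_real (moebius_mu d))"
      proof (intro sum.cong refl)
        fix d assume "d \<in> {d. d dvd n}"
        then have "\<psi> n = \<psi> d * \<psi> (n div d)" using mult[of d "n div d"] by simp
        then show "complex_of_real (moebius_mu d * \<psi> d) * of_real (\<psi> (n div d)) = of_real (\<psi> n) * of_real (moebius_mu d)"
          by (simp add: mult_ac)
      qed
      also have "\<dots> = of_real (\<psi> n * (\<Sum>d | d dvd n. moebius_mu d))"
        by (simp add: sum_distrib_left)
      finally show ?thesis using False one sum_moebius_mu_divisors[of n] by auto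
    qed simp
  qed
  also have "(\<lambda>n. if n = 1 then 1 else 0) sums (M * Ls) \<longleftrightarrow> M * Ls = 1"
    using sums_single[of 1 "\<lambda>_. 1 :: complex"] sums_unique2 by auto
  finally show ?thesis using M by blast
qed

lemma L_nonzero_right:
  assumes L: "\<And>s. Re s > 0 \<Longrightarrow> (\<lambda>n. of_real (\<psi> n) * of_nat n powr (- s)) sums L s" and s: "Re s > 1"
  shows "L s \<noteq> 0"
  using moebius_product[OF L s] s by auto

end

section \<open>Non-vanishing on the line of real part 1\<close>

lemma log_derivative_aux:
  fixes u z D V :: complex
  assumes "u \<noteq> 0" "z \<noteq> 0" "(D * u - z) / u\<^sup>2 = - (V * (z / u))"
  shows "V = 1 / u - D / z"
proof -
  have "D * u - z = - (V * (z / u)) * u\<^sup>2" using assms(1,3) by (simp add: nonzero_divide_eq_eq)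
  also have "\<dots> = - (V * (z * u))" using assms(1) by (simp add: power2_eq_square)
  finally have "V * (z * u) = z - D * u" by (simp add: algebra_simps)
  then have "V = (z - D * u) / (z * u)" using assms(1,2) by (simp add: nonzero_eq_divide_eq)
  then show ?thesis using assms(1,2) by (simp add: diff_divide_distrib)
qed

context real_character begin

text \<open>With c the cosine, 3 + 4 \<psi> c + cos of the double angle is 2 (1 + c)^2, 2 (1 - c)^2
  or 2 + 2 c^2. Since this covers \<psi> = 0, the zeta function itself can stand where the square of
  the character would give the principal one.\<close>

lemma three_four_one:
  fixes t \<sigma> :: real
  assumes "(\<lambda>n. of_real (mangoldt n) * of_nat n powr (- of_real \<sigma>)) sums V0"
    and "(\<lambda>n. of_real (\<psi> n * mangoldt n) * of_nat n powr (- (of_real \<sigma> + \<i> * of_real t))) sums V1"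
    and "(\<lambda>n. of_real (mangoldt n) * of_nat n powr (- (of_real \<sigma> + \<i> * of_real (2 * t)))) sums V2"
  shows "3 * Re V0 + 4 * Re V1 + Re V2 \<ge> 0"
proof -
  let ?r = "\<lambda>n \<tau>. Re ((of_nat n :: complex) powr (- (of_real \<sigma> + \<i> * of_real \<tau>)))"
  have re: "?r n \<tau> = real n powr (- \<sigma>) * cos (\<tau> * ln (real n))" for n \<tau>
  proof (cases "n = 0")
    case False
    then show ?thesis
      by (simp add: powr_def Re_exp cos_minus[of "\<tau> * ln (real n)", symmetric] mult.commute del: cos_minus)
  qed simp
  have S: "(\<lambda>n. 3 * (mangoldt n * ?r n 0) + 4 * (\<psi> n * mangoldt n * ?r n t) + mangoldt n * ?r n (2 * t))
      sums (3 * Re V0 + 4 * Re V1 + Re V2)"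
    using sums_Re[OF assms(1)] sums_Re[OF assms(2)] sums_Re[OF assms(3)]
    by (intro sums_add sums_mult) simp_all
  have nn: "3 * (mangoldt n * ?r n 0) + 4 * (\<psi> n * mangoldt n * ?r n t) + mangoldt n * ?r n (2 * t) \<ge> 0" for n
  proof -
    let ?c = "cos (t * ln (real n))"
    have c2: "cos (2 * t * ln (real n)) = 2 * ?c\<^sup>2 - 1" using cos_double_cos[of "t * ln (real n)"] by (simp add: mult_ac)
    have "3 + 4 * \<psi> n * ?c + (2 * ?c\<^sup>2 - 1) \<ge> 0"
    proof -
      consider "\<psi> n = 0" | "\<psi> n = 1" | "\<psi> n = -1" using range[of n] by auto
      then show ?thesis
      proof cases
        case 2
        have "0 \<le> 2 * (1 + ?c)\<^sup>2" by simp
        then show ?thesis using 2 by (simp add: power2_eq_square algebra_simps)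
      next
        case 3
        have "0 \<le> 2 * (1 - ?c)\<^sup>2" by simp
        then show ?thesis using 3 by (simp add: power2_eq_square algebra_simps)
      qed simp
    qed
    then have "0 \<le> (mangoldt n * real n powr (- \<sigma>)) * (3 + 4 * \<psi> n * ?c + (2 * ?c\<^sup>2 - 1))"
      using mangoldt_nonneg[of n] by (intro mult_nonneg_nonneg) auto
    also have "\<dots> = 3 * (mangoldt n * ?r n 0) + 4 * (\<psi> n * mangoldt n * ?r n t) + mangoldt n * ?r n (2 * t)"
      unfolding re c2 by (simp add: algebra_simps)
    finally show ?thesis .
  qed
  show ?thesis using sums_le[OF nn sums_zero S] .
qed

text \<open>A zero of order m at 1 + i t and one of order k of \<open>Z\<close> at 1 + 2 i t would
  give 3 - 4 m - k \<ge> 0 with m \<ge> 1. For t = 0 the pole of zeta would enter a second time and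
  leave no contradiction, so the point 1 needs another argument.\<close>

lemma L_nonzero_line:
  assumes Lh: "L holomorphic_on {s. Re s > 0}"
    and L: "\<And>s. Re s > 0 \<Longrightarrow> (\<lambda>n. of_real (\<psi> n) * of_nat n powr (- s)) sums L s"
    and t: "t \<noteq> 0"
  shows "L (1 + \<i> * of_real t) \<noteq> 0"
proof
  assume zero: "L (1 + \<i> * of_real t) = 0"
  obtain Z where Z: "Z holomorphic_on {s. Re s > 0}" "Z 1 = 1"
    "\<And>s. Re s > 1 \<Longrightarrow> (\<lambda>n. of_nat n powr (- s)) sums (Z s / (s - 1))"
    using zeta_minus_pole by blast
  have opn: "open {s. Re s > 0}" by (rule open_halfspace_Re_gt)
  have zeta: "\<exists>V. (\<lambda>n. of_real (mangoldt n) * of_nat n powr (- s)) sums V \<and> V = 1 / (s - 1) - deriv Z s / Z s \<and> Z s \<noteq> 0"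
    if s: "Re s > 1" for s
  proof -
    let ?G = "\<lambda>s. Z s / (s - 1)"
    \<comment> \<open>The Moebius series inverts the zeta series, hence \<open>Z s\<close> is not
      0.\<close>
    have "\<exists>M. (\<lambda>n. (if n = 1 then 1 else 0)) sums (M * ?G s)"
    proof -
      have s1: "summable (\<lambda>n. norm (complex_of_real (moebius_mu n) * of_nat n powr (- s)))"
        using abs_moebius_mu_le by (intro summable_dirichlet_bounded[OF _ s, of _ 1]) simp
      have s2: "summable (\<lambda>n. norm (1 * of_nat n powr (- s) :: complex))"
        by (intro summable_dirichlet_bounded[OF _ s, of _ 1]) simp
      have "(\<lambda>n. (\<Sum>d | d dvd n. complex_of_real (moebius_mu d) * 1) * of_nat n powr (- s)) sums
          ((\<Sum>n. complex_of_real (moebius_mu n) * of_nat n powr (- s)) * ?G s)"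
        using Z(3)[OF s] by (intro dirichlet_product[OF s1 summable_sums[OF summable_norm_cancel[OF s1]] s2]) simp
      also have "(\<lambda>n. (\<Sum>d | d dvd n. complex_of_real (moebius_mu d) * 1) * of_nat n powr (- s)) = (\<lambda>n. if n = 1 then 1 else 0)"
      proof
        fix n :: nat
        show "(\<Sum>d | d dvd n. complex_of_real (moebius_mu d) * 1) * of_nat n powr (- s) = (if n = 1 then 1 else 0)"
          using sum_moebius_mu_divisors[of n] by (cases "n = 0") (auto simp flip: of_real_sum)
      qed
      finally show ?thesis by blast
    qed
    then obtain M where "(\<lambda>n. (if n = 1 then 1 else 0)) sums (M * ?G s)" by blast
    then have "1 = M * ?G s" by (rule sums_unique2[OF sums_single])
    then have "Z s \<noteq> 0" by auto
    obtain V where V: "(\<lambda>n. of_real (1 * mangoldt n) * of_nat n powr (- s)) sums V" "deriv ?G s = - (V * ?G s)"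
      using dirichlet_log_derivative[of "\<lambda>_. 1" ?G s] Z(3) s by auto
    have "s \<noteq> 1" using s by auto
    have "(Z has_field_derivative deriv Z s) (at s)"
      using Z(1) opn s by (auto intro: holomorphic_derivI)
    then have "(?G has_field_derivative (deriv Z s * (s - 1) - Z s) / (s - 1)\<^sup>2) (at s)"
      using \<open>s \<noteq> 1\<close> by (auto intro!: derivative_eq_intros simp: power2_eq_square)
    then have "deriv ?G s = (deriv Z s * (s - 1) - Z s) / (s - 1)\<^sup>2" by (rule DERIV_imp_deriv)
    then have "V = 1 / (s - 1) - deriv Z s / Z s"
      using V(2) \<open>s \<noteq> 1\<close> \<open>Z s \<noteq> 0\<close> log_derivative_aux[of "s - 1" "Z s" "deriv Z s" V] by simp
    then show ?thesis using V(1) \<open>Z s \<noteq> 0\<close> by auto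
  qed
  have Lder: "\<exists>V. (\<lambda>n. of_real (\<psi> n * mangoldt n) * of_nat n powr (- s)) sums V \<and> V = - (deriv L s / L s)"
    if s: "Re s > 1" for s
  proof -
    obtain V where "(\<lambda>n. of_real (\<psi> n * mangoldt n) * of_nat n powr (- s)) sums V" "deriv L s = - (V * L s)"
      using dirichlet_log_derivative[of \<psi> L s, OF mult abs_le_1 L s] by auto
    then show ?thesis using L_nonzero_right[OF L s] by (auto intro!: exI[of _ V])
  qed
  let ?s1 = "1 + \<i> * complex_of_real t" and ?s2 = "1 + \<i> * complex_of_real (2 * t)"
  let ?D = "\<lambda>g s x. complex_of_real x * deriv g (s + of_real x) / g (s + of_real x)"
  obtain m where m: "m > 0" "(?D L ?s1 \<longlongrightarrow> of_nat m) (at_right 0)"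
    using log_derivative_at_point[OF opn Lh, of ?s1] L_nonzero_right[OF L] zero by auto
  obtain k where k: "(?D Z ?s2 \<longlongrightarrow> of_nat k) (at_right 0)"
    using log_derivative_at_point[OF opn Z(1), of ?s2] zeta by auto
  have iscont: "isCont Z 1" "isCont (deriv Z) 1"
    using Z(1) holomorphic_deriv[OF Z(1) opn] opn holomorphic_on_imp_continuous_on
    by (metis continuous_on_eq_continuous_at mem_Collect_eq one_complex.sel(1) zero_less_one)+
  have x: "((\<lambda>x. complex_of_real x) \<longlongrightarrow> 0) (at_right 0)"
    by (auto intro!: tendsto_eq_intros)
  have pt: "((\<lambda>x. 1 + complex_of_real x) \<longlongrightarrow> 1) (at_right 0)"
    by (auto intro!: tendsto_eq_intros)
  have D0: "(?D Z 1 \<longlongrightarrow> 0 * deriv Z 1 / Z 1) (at_right 0)"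
    using Z(2) by (intro tendsto_intros x isCont_tendsto_compose[OF _ pt] iscont) auto
  have E2: "((\<lambda>x. complex_of_real x / (of_real x + \<i> * of_real (2 * t))) \<longlongrightarrow> 0 / (0 + \<i> * of_real (2 * t))) (at_right 0)"
    using t by (intro tendsto_intros x) auto
  have "((\<lambda>x. 3 * Re (1 - ?D Z 1 x) + 4 * Re (- ?D L ?s1 x) + Re (complex_of_real x / (of_real x + \<i> * of_real (2 * t)) - ?D Z ?s2 x))
     \<longlongrightarrow> 3 * Re (1 - 0 * deriv Z 1 / Z 1) + 4 * Re (- of_nat m) + Re (0 / (0 + \<i> * of_real (2 * t)) - of_nat k)) (at_right 0)"
    by (intro tendsto_intros D0 E2 m(2) k)
  then have "0 \<le> 3 * Re (1 - 0 * deriv Z 1 / Z 1) + 4 * Re (- of_nat m) + Re (0 / (0 + \<i> * of_real (2 * t)) - of_nat k)"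
  proof (rule tendsto_lowerbound)
    show "\<forall>\<^sub>F x in at_right 0. 0 \<le> 3 * Re (1 - ?D Z 1 x) + 4 * Re (- ?D L ?s1 x) +
        Re (complex_of_real x / (of_real x + \<i> * of_real (2 * t)) - ?D Z ?s2 x)"
      using eventually_at_right_less[of 0]
    proof eventually_elim
      case (elim x)
      obtain V0 where V0: "(\<lambda>n. of_real (mangoldt n) * of_nat n powr (- of_real (1 + x))) sums V0"
          "V0 = 1 / (of_real (1 + x) - 1) - deriv Z (of_real (1 + x)) / Z (of_real (1 + x))"
        using zeta[of "of_real (1 + x)"] elim by auto
      obtain V1 where V1: "(\<lambda>n. of_real (\<psi> n * mangoldt n) * of_nat n powr (- (of_real (1 + x) + \<i> * of_real t))) sums V1"
          "V1 = - (deriv L (of_real (1 + x) + \<i> * of_real t) / L (of_real (1 + x) + \<i> * of_real t))"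
        using Lder[of "of_real (1 + x) + \<i> * of_real t"] elim by auto
      obtain V2 where V2: "(\<lambda>n. of_real (mangoldt n) * of_nat n powr (- (of_real (1 + x) + \<i> * of_real (2 * t)))) sums V2"
          "V2 = 1 / ((of_real (1 + x) + \<i> * of_real (2 * t)) - 1) -
            deriv Z (of_real (1 + x) + \<i> * of_real (2 * t)) / Z (of_real (1 + x) + \<i> * of_real (2 * t))"
        using zeta[of "of_real (1 + x) + \<i> * of_real (2 * t)"] elim by auto
      \<comment> \<open>The factor \<open>x\<close> turns the simple poles at \<open>x = 0\<close>
        into finite limits.\<close>
      have "0 \<le> x * (3 * Re V0 + 4 * Re V1 + Re V2)"
        using elim three_four_one[OF V0(1) V1(1) V2(1)] by simp
      also have "\<dots> = 3 * Re (of_real x * V0) + 4 * Re (of_real x * V1) + Re (of_real x * V2)"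
        by (simp add: algebra_simps)
      also have "of_real x * V0 = 1 - ?D Z 1 x" using elim unfolding V0(2) by (simp add: right_diff_distrib)
      also have "of_real x * V1 = - ?D L ?s1 x" unfolding V1(2) by (simp add: add_ac)
      also have "of_real x * V2 = complex_of_real x / (of_real x + \<i> * of_real (2 * t)) - ?D Z ?s2 x"
        unfolding V2(2) by (simp add: add_ac right_diff_distrib)
      finally show ?case .
    qed
  qed simp
  then show False using m(1) by simp
qed

section \<open>Non-vanishing at the point 1\<close>

text \<open>The divisor sum is multiplicative, and at a power of \<open>p\<close> with exponent k it
  is 1 + \<psi>(p) + ... + \<psi>(p)^k, which is nonnegative, and at least 1 for even k. The
  induction splits off the full power of one prime.\<close>

lemma sum_divisors_nonneg: "n > 0 \<Longrightarrow> (\<Sum>d | d dvd n. \<psi> d) \<ge> 0 \<and> (is_square n \<longrightarrow> (\<Sum>d | d dvd n. \<psi> d) \<ge> 1)"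
proof (induction n rule: less_induct)
  case (less n)
  show ?case
  proof (cases "n = 1")
    case False
    then obtain p where p: "prime p" "p dvd n" using prime_factor_nat by blast
    define k where "k = multiplicity p n"
    obtain r where r: "n = p ^ k * r" "\<not> p dvd r"
      using multiplicity_decompose'[of n p] less.prems p(1) unfolding k_def
      by (metis neq0_conv not_prime_unit)
    have "k > 0" using p less.prems prime_multiplicity_gt_zero_iff[of p n] by (simp add: k_def)
    have "r > 0" using r less.prems by (cases r) auto
    have "p ^ k > 1" using \<open>k > 0\<close> prime_gt_1_nat[OF p(1)] by (intro one_less_power)
    then have "r < n" using r(1) \<open>r > 0\<close> by simp
    have cop: "coprime p r" using r(2) p(1) by (simp add: prime_imp_coprime)
    have "(\<Sum>d | d dvd n. \<psi> d) = (\<Sum>(j, e)\<in>{..k} \<times> {e. e dvd r}. \<psi> (p ^ j * e))"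
    proof (rule sum.reindex_bij_witness[of _ "\<lambda>(j, e). p ^ j * e" "\<lambda>d. (multiplicity p d, d div p ^ multiplicity p d)"])
      fix d assume d: "d \<in> {d. d dvd n}"
      then have "d > 0" using less.prems by (auto intro: Nat.gr0I)
      obtain e where e: "d = p ^ multiplicity p d * e" "\<not> p dvd e"
        using multiplicity_decompose'[of d p] \<open>d > 0\<close> p(1) by (metis neq0_conv not_prime_unit)
      have "p ^ multiplicity p d > 0" using p(1) by (simp add: prime_gt_0_nat)
      then have de: "d div p ^ multiplicity p d = e" by (subst e(1)) simp
      show "(case (multiplicity p d, d div p ^ multiplicity p d) of (j, e) \<Rightarrow> p ^ j * e) = d" using e(1) de by simp
      have "e dvd p ^ k * r" using d e(1) r(1) by (metis dvd_mult_right mem_Collect_eq)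
      moreover have "coprime e (p ^ k)" using prime_imp_coprime[OF p(1) e(2)] by (simp add: coprime_commute)
      ultimately have "e dvd r" by (simp add: coprime_dvd_mult_right_iff)
      moreover have "multiplicity p d \<le> k"
        unfolding k_def using d less.prems by (intro dvd_imp_multiplicity_le) auto
      ultimately show "(multiplicity p d, d div p ^ multiplicity p d) \<in> {..k} \<times> {e. e dvd r}" using de by simp
      show "(case (multiplicity p d, d div p ^ multiplicity p d) of (j, e) \<Rightarrow> \<psi> (p ^ j * e)) = \<psi> d" using e(1) de by simp
    next
      fix b assume "b \<in> {..k} \<times> {e. e dvd r}"
      then obtain j e where b: "b = (j, e)" "j \<le> k" "e dvd r" by auto
      have "\<not> p dvd e" using b(3) r(2) dvd_trans by blast
      then have m: "multiplicity p (p ^ j * e) = j"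
        using prime_gt_0_nat[OF p(1)] by (intro multiplicity_decomposeI[OF refl]) auto
      then show "(multiplicity p (case b of (j, e) \<Rightarrow> p ^ j * e), (case b of (j, e) \<Rightarrow> p ^ j * e) div
          p ^ multiplicity p (case b of (j, e) \<Rightarrow> p ^ j * e)) = b"
        using b p(1) by (simp add: prime_gt_0_nat)
      show "(case b of (j, e) \<Rightarrow> p ^ j * e) \<in> {d. d dvd n}"
        using b r(1) by (auto intro: mult_dvd_mono le_imp_power_dvd)
    qed
    also have "\<dots> = (\<Sum>j\<le>k. \<Sum>e | e dvd r. \<psi> p ^ j * \<psi> e)"
    proof -
      have "\<psi> (p ^ j * e) = \<psi> p ^ j * \<psi> e" for j e
        using one by (induction j arbitrary: e) (simp_all add: mult mult.assoc)
      then show ?thesis by (simp add: sum.cartesian_product case_prod_unfold)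
    qed
    also have "\<dots> = (\<Sum>j\<le>k. \<psi> p ^ j) * (\<Sum>e | e dvd r. \<psi> e)" by (simp add: sum_product)
    finally have eq: "(\<Sum>d | d dvd n. \<psi> d) = (\<Sum>j\<le>k. \<psi> p ^ j) * (\<Sum>e | e dvd r. \<psi> e)" .
    have geo: "(\<Sum>j\<le>k. \<psi> p ^ j) \<ge> 0 \<and> (even k \<longrightarrow> (\<Sum>j\<le>k. \<psi> p ^ j) \<ge> 1)"
    proof -
      consider "\<psi> p = 0" | "\<psi> p = 1" | "\<psi> p = -1" using range[of p] by auto
      then show ?thesis
      proof cases
        case 1
        then show ?thesis by (simp add: power_0_left)
      next
        case 3
        have "(\<Sum>j\<le>k. (-1 :: real) ^ j) = (if even k then 1 else 0)" by (induction k) auto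
        then show ?thesis using 3 by simp
      qed simp
    qed
    note IH = less.IH[OF \<open>r < n\<close> \<open>r > 0\<close>]
    have "is_square r \<and> even k" if sq: "is_square n"
    proof -
      obtain m where m: "n = m ^ 2" using sq is_nth_powerE by blast
      have "m \<noteq> 0" using m less.prems by auto
      then have "even k" unfolding k_def m using p(1) by (simp add: prime_elem_multiplicity_power_distrib)
      moreover have "p ^ k = (p ^ (k div 2)) ^ 2" using \<open>even k\<close> by (simp flip: power_mult)
      then have "is_square (p ^ k)" by (rule is_nth_powerI)
      moreover have "coprime (p ^ k) r" using cop by simp
      ultimately show ?thesis using sq r(1) is_nth_power_mult_coprime_nat_iff[of "p ^ k" r 2] by auto
    qed
    then show ?thesis using eq IH geo mult_mono[of 1 "\<Sum>j\<le>k. \<psi> p ^ j" 1 "\<Sum>e | e dvd r. \<psi> e"] by auto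
  qed (use one in simp)
qed

end

text \<open>The arithmetic-geometric mean inequality for the terms at \<open>i\<close> and
  \<open>n - 1 - i\<close>, whose product does not depend on \<open>i\<close>.\<close>

lemma geometric_sum_ge:
  fixes t :: real
  assumes "0 < t"
  shows "real n * t ^ (n - 1) \<le> (\<Sum>i<n. (t\<^sup>2) ^ i)"
proof -
  have "2 * (\<Sum>i<n. (t\<^sup>2) ^ i) = (\<Sum>i<n. (t\<^sup>2) ^ i) + (\<Sum>i<n. (t\<^sup>2) ^ (n - Suc i))"
    using sum.nat_diff_reindex[of "\<lambda>i. (t\<^sup>2) ^ i" n] by simp
  also have "\<dots> = (\<Sum>i<n. (t ^ i)\<^sup>2 + (t ^ (n - Suc i))\<^sup>2)"
    by (simp add: sum.distrib flip: power_mult) (simp add: mult.commute)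
  also have "\<dots> \<ge> (\<Sum>i<n. 2 * t ^ (n - 1))"
  proof (rule sum_mono)
    fix i assume i: "i \<in> {..<n}"
    have "t ^ (n - 1) = t ^ i * t ^ (n - Suc i)" using i by (simp flip: power_add)
    then show "2 * t ^ (n - 1) \<le> (t ^ i)\<^sup>2 + (t ^ (n - Suc i))\<^sup>2"
      using sum_squares_bound[of "t ^ i" "t ^ (n - Suc i)"] by simp
  qed
  finally show ?thesis by simp
qed

text \<open>The weights of Monsky's proof that \<open>L(1, \<psi>) \<noteq> 0\<close>.\<close>

definition lambert_weight :: "real \<Rightarrow> nat \<Rightarrow> real" where
  "lambert_weight r n = 1 / (real n * (1 - r)) - r ^ n / (1 - r ^ n)"

lemma lambert_weight_eq:
  assumes "0 < r" "r < 1" "n > 0"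
  shows "lambert_weight r n = (1 / real n - r ^ n / (\<Sum>i<n. r ^ i)) / (1 - r)"
proof -
  have "1 - r ^ n = (1 - r) * (\<Sum>i<n. r ^ i)" by (rule one_diff_power_eq)
  then show ?thesis by (simp add: lambert_weight_def diff_divide_distrib mult.commute)
qed

lemma lambert_weight_1: "r < 1 \<Longrightarrow> lambert_weight r (Suc 0) = 1"
  by (simp add: lambert_weight_def flip: diff_divide_distrib)

text \<open>With S_n the geometric sum and S_(n+1) = 1 + r S_n, the claim becomes n (n + 1) r^n
  \<le> S_n S_(n+1). For t = sqrt r the mean inequality gives n (n + 1) t^(2n-1) as a lower bound of
  the right-hand side, more than enough as t < 1.\<close>

lemma lambert_weight_decreasing:
  assumes r: "0 < r" "r < 1" and n: "n > 0"
  shows "lambert_weight r (Suc n) \<le> lambert_weight r n"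
proof -
  define t where "t = sqrt r"
  have t: "0 < t" "t < 1" "r = t\<^sup>2" using r by (auto simp: t_def)
  define S where "S = (\<lambda>n. \<Sum>i<n. r ^ i)"
  have S1: "S (Suc n) = 1 + r * S n" unfolding S_def sum.lessThan_Suc_shift by (simp add: sum_distrib_left)
  have "S n > 0" unfolding S_def using n r by (intro sum_pos) auto
  then have "S (Suc n) > 0" using S1 r by (simp add: add_pos_pos)
  have "t ^ (2 * n) \<le> t ^ (n - 1 + n)" using t n by (intro power_decreasing) auto
  then have "real n * real (Suc n) * t ^ (2 * n) \<le> real n * real (Suc n) * t ^ (n - 1 + n)"
    by (intro mult_left_mono) auto
  also have "\<dots> = (real n * t ^ (n - 1)) * (real (Suc n) * t ^ (Suc n - 1))"
    by (simp add: power_add)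
  also have "\<dots> \<le> S n * S (Suc n)"
    unfolding S_def t(3) using t by (intro mult_mono geometric_sum_ge) (auto intro: sum_nonneg)
  finally have key: "real n * real (Suc n) * r ^ n \<le> S n * S (Suc n)" using t(3) by (simp add: power_mult)
  have "r ^ n / S n - r ^ Suc n / S (Suc n) = r ^ n / (S n * S (Suc n))"
    using \<open>S n > 0\<close> \<open>S (Suc n) > 0\<close> unfolding S1 by (simp add: divide_simps) (simp add: algebra_simps)
  also have "\<dots> \<le> 1 / (real n * real (Suc n))"
  proof -
    have "r ^ n \<le> S n * S (Suc n) / (real n * real (Suc n))"
      using key n by (intro mult_imp_le_div_pos) (auto simp: mult.commute)
    then show ?thesis
      using \<open>S n > 0\<close> \<open>S (Suc n) > 0\<close> by (intro mult_imp_div_pos_le) auto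
  qed
  also have "\<dots> = 1 / real n - 1 / real (Suc n)" using n by (simp add: field_simps)
  finally have "1 / real (Suc n) - r ^ Suc n / S (Suc n) \<le> 1 / real n - r ^ n / S n" by simp
  then show ?thesis using r n by (simp add: lambert_weight_eq S_def divide_right_mono)
qed

lemma lambert_weight_nonneg:
  assumes r: "0 < r" "r < 1" and n: "n > 0"
  shows "0 \<le> lambert_weight r n"
proof -
  have "real n * r ^ n = (\<Sum>i<n. r ^ n)" by simp
  also have "\<dots> \<le> (\<Sum>i<n. r ^ i)" using r by (intro sum_mono power_decreasing) auto
  finally have le: "real n * r ^ n \<le> (\<Sum>i<n. r ^ i)" .
  have "(\<Sum>i<n. r ^ i) > 0" using r n by (intro sum_pos) auto
  then have "r ^ n / (\<Sum>i<n. r ^ i) \<le> 1 / real n" using le n by (simp add: field_simps)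
  then show ?thesis using r n by (simp add: lambert_weight_eq)
qed

text \<open>After Abel summation the weights are the nonnegative differences of \<open>b\<close> and
  its last value, which add up to \<open>b 1\<close>.\<close>

lemma abel_bound_decreasing:
  fixes a b :: "nat \<Rightarrow> real"
  assumes a: "\<And>n. \<bar>\<Sum>k=1..n. a k\<bar> \<le> C"
    and b: "\<And>n. n > 0 \<Longrightarrow> b (Suc n) \<le> b n" "\<And>n. n > 0 \<Longrightarrow> b n \<ge> 0"
  shows "\<bar>\<Sum>n=1..N. a n * b n\<bar> \<le> C * b 1"
proof (cases "N = 0")
  case False
  define P where "P = (\<lambda>n. \<Sum>k=1..n. a k)"
  have C: "C \<ge> 0" using a[of 0] by simp
  have "N > 0" using False by simp
  then have "(\<Sum>n=1..N. a n * b n) = P N * b N + (\<Sum>n=1..<N. P n * (b n - b (Suc n)))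
     \<and> (\<Sum>n=1..<N. b n - b (Suc n)) = b 1 - b N"
  proof (induction N rule: nat_induct_non_zero)
    case (Suc n)
    then show ?case by (auto simp: P_def algebra_simps)
  qed (simp add: P_def)
  then have eq: "(\<Sum>n=1..N. a n * b n) = P N * b N + (\<Sum>n=1..<N. P n * (b n - b (Suc n)))"
    and tel: "(\<Sum>n=1..<N. b n - b (Suc n)) = b 1 - b N" by auto
  have "\<bar>P N * b N\<bar> \<le> C * b N" using a[of N] b(2)[of N] False C by (auto simp: abs_mult P_def mult_mono)
  moreover have "\<bar>\<Sum>n=1..<N. P n * (b n - b (Suc n))\<bar> \<le> (\<Sum>n=1..<N. C * (b n - b (Suc n)))"
    using a b(1) by (intro order_trans[OF sum_abs sum_mono]) (auto simp: abs_mult P_def mult_right_mono)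
  moreover have "(\<Sum>n=1..<N. C * (b n - b (Suc n))) = C * (b 1 - b N)"
    by (subst tel[symmetric]) (simp only: sum_distrib_left)
  ultimately show ?thesis unfolding eq by (simp add: algebra_simps)
qed (use a[of 0] b(2)[of 1] in simp)

context real_character begin

text \<open>Expanding r^d / (1 - r^d) as a geometric series gives a double series over pairs (d, e),
  which is collected by d or by the product n = d e.\<close>

lemma lambert_series:
  assumes r: "0 < r" "r < 1"
  obtains S where "(\<lambda>d. \<psi> d * (r ^ d / (1 - r ^ d))) sums S"
    "(\<lambda>n. (\<Sum>d | d dvd n. \<psi> d) * r ^ n) sums S"
proof -
  define u where "u = (\<lambda>(d, e). complex_of_real (\<psi> d * r ^ (d * e)))"
  let ?P = "{1..} \<times> {1..} :: (nat \<times> nat) set"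
  let ?f = "\<lambda>n. if n = 0 then 0 else complex_of_real r ^ n"
  have "summable (\<lambda>n. norm (?f n))"
    using r by (intro summable_comparison_test[OF _ summable_geometric[of r]]) (auto simp: norm_power)
  then have "((\<lambda>(d, e). ?f d * ?f e) has_sum suminf ?f * suminf ?f) ?P"
    by (intro has_sum_product_pairs summable_sums[OF summable_norm_cancel]) auto
  then have "(\<lambda>(d, e). ?f d * ?f e) summable_on ?P" by (auto simp: summable_on_def)
  then have "(\<lambda>x. norm (case x of (d, e) \<Rightarrow> ?f d * ?f e)) summable_on ?P"
    by (subst (asm) summable_on_iff_abs_summable_on_complex)
  then have "(\<lambda>x. norm (1 / complex_of_real r) * norm (case x of (d, e) \<Rightarrow> ?f d * ?f e)) summable_on ?P"
    by (rule summable_on_cmult_right)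
  then have "(\<lambda>x. norm ((1 / complex_of_real r) * (case x of (d, e) \<Rightarrow> ?f d * ?f e))) summable_on ?P"
    by (simp only: norm_mult)
  then have "(\<lambda>x. norm (u x)) summable_on ?P"
  proof (rule Infinite_Sum.abs_summable_on_comparison_test)
    fix x :: "nat \<times> nat" assume "x \<in> ?P"
    then obtain d e where x: "x = (d, e)" "d \<ge> 1" "e \<ge> 1" by auto
    \<comment> \<open>This is (d - 1) (e - 1) \<ge> 0; it bounds the double series by a product of
      two geometric series.\<close>
    have "d + e \<le> d * e + 1" using x(2,3) by (cases d; cases e) auto
    then have "r ^ (d * e + 1) \<le> r ^ (d + e)" using r by (intro power_decreasing) auto
    then have "r ^ (d * e) \<le> r ^ (d + e) / r" using r by (simp add: field_simps)
    moreover have "norm (u x) \<le> 1 * r ^ (d * e)"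
      using r abs_le_1[of d] by (auto simp: x u_def norm_mult norm_power intro!: mult_right_mono)
    moreover have "norm ((1 / complex_of_real r) * (case x of (d, e) \<Rightarrow> ?f d * ?f e)) = r ^ (d + e) / r"
      using r x by (simp add: norm_mult norm_divide norm_power power_add)
    ultimately show "norm (u x) \<le> norm ((1 / complex_of_real r) * (case x of (d, e) \<Rightarrow> ?f d * ?f e))" by linarith
  qed
  then have us: "(u has_sum infsum u ?P) ?P" by (rule has_sum_infsum[OF Infinite_Sum.abs_summable_summable])
  define S where "S = infsum u ?P"
  have "((\<lambda>d. complex_of_real (\<psi> d * (r ^ d / (1 - r ^ d)))) has_sum S) {1..}"
  proof (rule has_sum_SigmaD[OF us[folded S_def]])
    fix d :: nat assume d: "d \<in> {1..}"
    have "norm (complex_of_real r ^ d) < 1" using r d by (simp add: norm_power power_less_one_iff)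
    from has_sum_cmult_right[OF has_sum_geometric_from_1[OF this], of "complex_of_real (\<psi> d)"]
    show "((\<lambda>e. u (d, e)) has_sum complex_of_real (\<psi> d * (r ^ d / (1 - r ^ d)))) {1..}"
      by (simp add: u_def power_mult)
  qed
  then have "((\<lambda>d. complex_of_real (\<psi> d * (r ^ d / (1 - r ^ d)))) has_sum S) UNIV"
    by (subst has_sum_cong_neutral[of "{1..}" UNIV _ "\<lambda>d. complex_of_real (\<psi> d * (r ^ d / (1 - r ^ d)))"])
      (auto simp: not_less_eq_eq chi_0)
  then have "(\<lambda>d. complex_of_real (\<psi> d * (r ^ d / (1 - r ^ d)))) sums S" by (rule has_sum_imp_sums)
  then have 1: "(\<lambda>d. \<psi> d * (r ^ d / (1 - r ^ d))) sums Re S" using sums_Re by fastforce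
  have "(\<lambda>n. \<Sum>d | d dvd n. u (d, n div d)) sums S"
    using sums_divisor_sums[OF us] by (simp add: S_def)
  also have "(\<lambda>n. \<Sum>d | d dvd n. u (d, n div d)) = (\<lambda>n. complex_of_real ((\<Sum>d | d dvd n. \<psi> d) * r ^ n))"
  proof
    fix n :: nat
    have "(\<Sum>d | d dvd n. u (d, n div d)) = (\<Sum>d | d dvd n. complex_of_real (\<psi> d * r ^ n))"
      by (intro sum.cong refl) (auto simp: u_def)
    then show "(\<Sum>d | d dvd n. u (d, n div d)) = complex_of_real ((\<Sum>d | d dvd n. \<psi> d) * r ^ n)"
      by (simp only: sum_distrib_right of_real_sum)
  qed
  finally have "(\<lambda>n. (\<Sum>d | d dvd n. \<psi> d) * r ^ n) sums Re S" using sums_Re by fastforce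
  with 1 show ?thesis using that by blast
qed

text \<open>If l were 0, the Lambert series would equal minus the sum of
  \<open>\<psi> n * lambert_weight r n\<close>, bounded by \<open>q\<close> for every
  \<open>r\<close>. Its coefficients are nonnegative and at least 1 at squares, so it grows beyond
  any bound as \<open>r\<close> tends to 1.\<close>

lemma L_one_nonzero:
  assumes l: "(\<lambda>n. \<psi> n / real n) sums l"
  shows "l \<noteq> 0"
proof
  assume "l = 0"
  have bound: "real K * r ^ (K\<^sup>2) \<le> real q" if r: "0 < r" "r < 1" for K r
  proof -
    obtain S where S: "(\<lambda>d. \<psi> d * (r ^ d / (1 - r ^ d))) sums S" "(\<lambda>n. (\<Sum>d | d dvd n. \<psi> d) * r ^ n) sums S"
      using lambert_series[OF r] by blast
    have "(\<lambda>n. (\<psi> n / real n) * (1 / (1 - r)) - \<psi> n * (r ^ n / (1 - r ^ n))) sums (l * (1 / (1 - r)) - S)"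
      by (intro sums_diff sums_mult2 l S(1))
    moreover have "(\<psi> n / real n) * (1 / (1 - r)) - \<psi> n * (r ^ n / (1 - r ^ n)) = \<psi> n * lambert_weight r n" for n
      by (simp add: lambert_weight_def algebra_simps)
    ultimately have "(\<lambda>N. \<Sum>n\<le>N. \<psi> n * lambert_weight r n) \<longlonglongrightarrow> - S"
      using \<open>l = 0\<close> unfolding sums_def_le by simp
    then have "(\<lambda>N. \<bar>\<Sum>n\<le>N. \<psi> n * lambert_weight r n\<bar>) \<longlonglongrightarrow> \<bar>- S\<bar>" by (rule tendsto_rabs)
    moreover have "\<bar>\<Sum>n\<le>N. \<psi> n * lambert_weight r n\<bar> \<le> real q" for N
    proof -
      have "(\<Sum>n\<le>N. \<psi> n * lambert_weight r n) = (\<Sum>n=1..N. \<psi> n * lambert_weight r n)"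
        by (rule sum.mono_neutral_right) (auto simp: chi_0 not_less_eq_eq)
      then show ?thesis
        using abel_bound_decreasing[of \<psi> "real q" "lambert_weight r" N] partial_sum_bound'
          lambert_weight_decreasing[OF r] lambert_weight_nonneg[OF r] lambert_weight_1[OF r(2)] by simp
    qed
    ultimately have "\<bar>- S\<bar> \<le> real q" by (intro LIMSEQ_le_const2) auto
    moreover have "(\<Sum>n\<in>(\<lambda>m. m\<^sup>2) ` {1..K}. (\<Sum>d | d dvd n. \<psi> d) * r ^ n) \<le> S"
    proof -
      have nn: "(\<Sum>d | d dvd n. \<psi> d) * r ^ n \<ge> 0" for n
        using sum_divisors_nonneg[of n] r by (cases "n = 0") auto
      show ?thesis
        using sum_le_suminf[OF sums_summable[OF S(2)], of "(\<lambda>m. m\<^sup>2) ` {1..K}"] nn sums_unique[OF S(2)] by simp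
    qed
    moreover have "real K * r ^ (K\<^sup>2) \<le> (\<Sum>n\<in>(\<lambda>m. m\<^sup>2) ` {1..K}. (\<Sum>d | d dvd n. \<psi> d) * r ^ n)"
    proof -
      have "real K * r ^ (K\<^sup>2) = (\<Sum>m=1..K. r ^ (K\<^sup>2))" by simp
      also have "\<dots> \<le> (\<Sum>m=1..K. (\<Sum>d | d dvd m\<^sup>2. \<psi> d) * r ^ (m\<^sup>2))"
      proof (rule sum_mono)
        fix m assume m: "m \<in> {1..K}"
        have "is_square (m\<^sup>2)" by simp
        then have "(\<Sum>d | d dvd m\<^sup>2. \<psi> d) \<ge> 1" using sum_divisors_nonneg[of "m\<^sup>2"] m by simp
        moreover have "r ^ (K\<^sup>2) \<le> r ^ (m\<^sup>2)" using m r by (intro power_decreasing power_mono) auto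
        ultimately show "r ^ (K\<^sup>2) \<le> (\<Sum>d | d dvd m\<^sup>2. \<psi> d) * r ^ (m\<^sup>2)"
          using mult_mono[of 1 "\<Sum>d | d dvd m\<^sup>2. \<psi> d" "r ^ (K\<^sup>2)" "r ^ (m\<^sup>2)"] r by simp
      qed
      also have "\<dots> = (\<Sum>n\<in>(\<lambda>m. m\<^sup>2) ` {1..K}. (\<Sum>d | d dvd n. \<psi> d) * r ^ n)"
        by (subst sum.reindex) (auto simp: inj_on_def)
      finally show ?thesis .
    qed
    ultimately show ?thesis by linarith
  qed
  \<comment> \<open>One more square than the bound \<open>q\<close> allows is enough in the
    limit.\<close>
  have "((\<lambda>r. real (Suc q) * r ^ ((Suc q)\<^sup>2)) \<longlongrightarrow> real (Suc q) * 1 ^ ((Suc q)\<^sup>2)) (at_left 1)"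
    by (intro tendsto_intros)
  moreover have "\<forall>\<^sub>F r in at_left 1. real (Suc q) * r ^ ((Suc q)\<^sup>2) \<le> real q"
    using eventually_at_left_real[OF zero_less_one]
  proof eventually_elim
    case (elim r)
    then show ?case using bound[of r "Suc q"] by simp
  qed
  ultimately have "real (Suc q) * 1 ^ ((Suc q)\<^sup>2) \<le> real q" by (intro tendsto_upperbound) auto
  then show False by simp
qed

lemma moebius_psi_summable: "summable (\<lambda>n. moebius_mu n * \<psi> n / real n)"
proof -
  obtain L where Lh: "L holomorphic_on {s. Re s > 0}"
    and L: "\<And>s. Re s > 0 \<Longrightarrow> (\<lambda>n. of_real (\<psi> n) * of_nat n powr (- s)) sums L s"
    using L_function by blast
  define \<Omega> where "\<Omega> = {s. Re s > 0} \<inter> L -` (- {0})"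
  have "open \<Omega>" unfolding \<Omega>_def
    by (intro continuous_open_preimage holomorphic_on_imp_continuous_on Lh open_halfspace_Re_gt) auto
  have "L s \<noteq> 0" if s: "Re s \<ge> 1" for s
  proof -
    consider "Re s > 1" | "Re s = 1" "Im s \<noteq> 0" | "s = 1" using s
      by (metis complex_eqI one_complex.sel less_eq_real_def)
    then show ?thesis
    proof cases
      case 1
      then show ?thesis using L_nonzero_right[OF L] by blast
    next
      case 2
      then have "s = 1 + \<i> * of_real (Im s)" by (simp add: complex_eq_iff)
      then show ?thesis using L_nonzero_line[OF Lh L 2(2)] by simp
    next
      case 3
      have "(\<lambda>n. of_real (\<psi> n) * of_nat n powr (- 1)) sums L 1" using L[of 1] by simp
      also have "(\<lambda>n. of_real (\<psi> n) * of_nat n powr (- 1)) = (\<lambda>n. complex_of_real (\<psi> n / real n))"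
      proof
        show "of_real (\<psi> n) * of_nat n powr (- 1) = complex_of_real (\<psi> n / real n)" for n
          by (cases "n = 0") (auto simp: powr_minus divide_inverse)
      qed
      finally have "(\<lambda>n. \<psi> n / real n) sums Re (L 1)" using sums_Re by fastforce
      then show ?thesis using L_one_nonzero 3 by force
    qed
  qed
  then have "{s. Re s \<ge> 1} \<subseteq> \<Omega>" by (auto simp: \<Omega>_def)
  moreover have "(\<lambda>s. 1 / L s) holomorphic_on \<Omega>"
    by (intro holomorphic_intros holomorphic_on_subset[OF Lh]) (auto simp: \<Omega>_def)
  moreover have "(\<lambda>n. of_real (moebius_mu n * \<psi> n) * of_nat n powr (- s)) sums (1 / L s)" if s: "Re s > 1" for s
  proof -
    obtain M where "(\<lambda>n. of_real (moebius_mu n * \<psi> n) * of_nat n powr (- s)) sums M" "M * L s = 1"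
      using moebius_product[OF L s] s by auto
    then show ?thesis by (metis nonzero_eq_divide_eq mult_zero_right zero_neq_one)
  qed
  moreover have "norm (complex_of_real (moebius_mu n * \<psi> n)) \<le> 1" for n
    using mult_mono[OF abs_moebius_mu_le[of n] abs_le_1[of n]] by (simp add: abs_mult norm_mult)
  ultimately have "(\<lambda>n. of_real (moebius_mu n * \<psi> n) / of_nat n) sums (1 / L 1)"
    using newman_ingham[of "\<lambda>n. of_real (moebius_mu n * \<psi> n)" 1 \<Omega> "\<lambda>s. 1 / L s"] \<open>open \<Omega>\<close> by blast
  then have "(\<lambda>n. complex_of_real (moebius_mu n * \<psi> n / real n)) sums (1 / L 1)" by simp
  from sums_Re[OF this] show ?thesis by (auto simp: sums_iff)
qed

end

text \<open>Kronecker's lemma: with \<open>T\<close> the error of the partial sums, Abel summation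
  writes the sum of \<open>c\<close> as N T_N minus the sum of the earlier T_n, and \<open>T\<close>
  tends to 0.\<close>

lemma kronecker_mean:
  fixes c :: "nat \<Rightarrow> real"
  assumes "summable (\<lambda>n. c n / real n)" "e > 0"
  shows "\<exists>B. \<forall>N. \<bar>\<Sum>n=1..N. c n\<bar> \<le> e * real N + B"
proof -
  define T where "T = (\<lambda>n. (\<Sum>k\<le>n. c k / real k) - (\<Sum>k. c k / real k))"
  have "(\<lambda>n. \<Sum>k\<le>n. c k / real k) \<longlonglongrightarrow> (\<Sum>k. c k / real k)"
    using assms(1) by (rule summable_LIMSEQ')
  then have T0: "T \<longlonglongrightarrow> 0" unfolding T_def by (simp add: LIM_zero)
  then obtain n0 where n0: "\<And>n. n \<ge> n0 \<Longrightarrow> \<bar>T n\<bar> < e / 2"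
    using LIMSEQ_D[OF T0, of "e / 2"] assms(2) by auto
  obtain K where K: "\<And>n. \<bar>T n\<bar> \<le> K"
    using convergent_imp_Bseq[OF convergentI[OF T0]] by (auto simp: Bseq_def)
  have K0: "K \<ge> 0" using K[of 0] by simp
  have T_le: "\<bar>T n\<bar> \<le> e / 2 + (if n < n0 then K else 0)" for n
    using n0[of n] K[of n] assms(2) by (cases "n < n0") auto
  have eq: "(\<Sum>n=1..N. c n) = real N * T N - (\<Sum>n<N. T n)" for N
  proof (induction N)
    case (Suc N)
    have "real (Suc N) * T (Suc N) = real (Suc N) * (T N + c (Suc N) / real (Suc N))" by (simp add: T_def)
    also have "\<dots> = real (Suc N) * T N + c (Suc N)" by (simp only: distrib_left) simp
    finally show ?case using Suc by (simp add: algebra_simps)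
  qed simp
  have "\<bar>\<Sum>n=1..N. c n\<bar> \<le> e * real N + (2 * real n0 * K)" for N
  proof -
    have "real N * \<bar>T N\<bar> \<le> e / 2 * real N + real n0 * K"
    proof (cases "N < n0")
      case True
      then have "real N * \<bar>T N\<bar> \<le> real n0 * K" using K K0 by (intro mult_mono) auto
      then show ?thesis using assms(2) by (simp add: add_increasing)
    next
      case False
      then have "real N * \<bar>T N\<bar> \<le> real N * (e / 2)" using n0[of N] by (intro mult_left_mono) auto
      then show ?thesis using K0 by (simp add: mult.commute add_increasing2)
    qed
    moreover have "\<bar>\<Sum>n<N. T n\<bar> \<le> e / 2 * real N + real n0 * K"
    proof -
      have "\<bar>\<Sum>n<N. T n\<bar> \<le> (\<Sum>n<N. e / 2 + (if n < n0 then K else 0))"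
        by (rule order_trans[OF sum_abs sum_mono[OF T_le]])
      also have "\<dots> = e / 2 * real N + (\<Sum>n<N. if n < n0 then K else 0)"
        by (simp add: sum.distrib)
      also have "(\<Sum>n<N. if n < n0 then K else 0) = real (min N n0) * K"
        by (induction N) (auto simp: min_def algebra_simps)
      also have "\<dots> \<le> real n0 * K" using K0 by (intro mult_right_mono) auto
      finally show ?thesis by simp
    qed
    moreover have "\<bar>real N * T N\<bar> = real N * \<bar>T N\<bar>" by (simp add: abs_mult)
    ultimately show ?thesis unfolding eq by (simp add: algebra_simps)
  qed
  then show ?thesis by blast
qed

section \<open>Mean values of real characters over the primes\<close>

text \<open>The right-hand form has no exceptional \<open>N\<close>, so it applies to all quotients
  \<open>N div e\<close> at once.\<close>

lemma mean_tendsto_0_iff: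
  fixes f :: "nat \<Rightarrow> real"
  shows "(\<lambda>N. f N / real N) \<longlonglongrightarrow> 0 \<longleftrightarrow> (\<forall>e>0. \<exists>B. \<forall>N. \<bar>f N\<bar> \<le> e * real N + B)"
proof
  assume lim: "(\<lambda>N. f N / real N) \<longlonglongrightarrow> 0"
  show "\<forall>e>0. \<exists>B. \<forall>N. \<bar>f N\<bar> \<le> e * real N + B"
  proof (intro allI impI)
    fix e :: real assume e: "e > 0"
    obtain n0 where n0: "\<And>n. n \<ge> n0 \<Longrightarrow> \<bar>f n / real n\<bar> < e"
      using LIMSEQ_D[OF lim e] by auto
    have "\<bar>f N\<bar> \<le> e * real N + (\<Sum>n\<le>n0. \<bar>f n\<bar>)" for N
    proof (cases "N \<le> n0")
      case True
      then have "\<bar>f N\<bar> \<le> (\<Sum>n\<le>n0. \<bar>f n\<bar>)" by (intro member_le_sum) auto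
      then show ?thesis using e by (simp add: add_increasing)
    next
      case False
      then have "\<bar>f N\<bar> < e * real N" using n0[of N] by (simp add: field_simps)
      moreover have "0 \<le> (\<Sum>n\<le>n0. \<bar>f n\<bar>)" by (intro sum_nonneg) auto
      ultimately show ?thesis by linarith
    qed
    then show "\<exists>B. \<forall>N. \<bar>f N\<bar> \<le> e * real N + B" by blast
  qed
next
  assume *: "\<forall>e>0. \<exists>B. \<forall>N. \<bar>f N\<bar> \<le> e * real N + B"
  show "(\<lambda>N. f N / real N) \<longlonglongrightarrow> 0"
  proof (rule tendstoI)
    fix e :: real assume e: "e > 0"
    then obtain B where B: "\<And>N. \<bar>f N\<bar> \<le> e / 2 * real N + B" using * half_gt_zero by blast
    have "(\<lambda>N. B / real N) \<longlonglongrightarrow> 0" by (rule lim_const_over_n)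
    then have "\<forall>\<^sub>F N in sequentially. B / real N < e / 2" using e by (intro order_tendstoD) auto
    then show "\<forall>\<^sub>F N in sequentially. dist (f N / real N) 0 < e"
      using eventually_gt_at_top[of 0]
    proof eventually_elim
      case (elim N)
      have "\<bar>f N\<bar> / real N \<le> (e / 2 * real N + B) / real N" using B by (intro divide_right_mono) auto
      also have "\<dots> = e / 2 + B / real N" using elim by (simp add: field_simps)
      also have "\<dots> < e" using elim by linarith
      finally show ?case by simp
    qed
  qed
qed

section \<open>The hyperbola method\<close>

lemma sum_divisors_pairs:
  fixes F :: "nat \<Rightarrow> nat \<Rightarrow> real"
  shows "(\<Sum>n=1..N. \<Sum>d | d dvd n. F d (n div d)) = (\<Sum>d=1..N. \<Sum>e=1..N div d. F d e)"
proof -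
  have "(\<Sum>n=1..N. \<Sum>d | d dvd n. F d (n div d)) = (\<Sum>(n, d)\<in>(SIGMA n:{1..N}. {d. d dvd n}). F d (n div d))"
    by (intro sum.Sigma) auto
  also have "\<dots> = (\<Sum>(d, e)\<in>(SIGMA d:{1..N}. {1..N div d}). F d e)"
  proof (rule sum.reindex_bij_witness[of _ "\<lambda>(d, e). (d * e, d)" "\<lambda>(n, d). (d, n div d)"])
    fix a :: "nat \<times> nat" assume "a \<in> (SIGMA n:{1..N}. {d. d dvd n})"
    then obtain n d where a: "a = (n, d)" "n \<ge> 1" "n \<le> N" "d dvd n" by auto
    then have "d \<le> n" by (intro dvd_imp_le) auto
    with a have "d \<ge> 1" "n div d \<ge> 1" "d \<le> N" "n div d \<le> N div d"
      by (auto intro: Nat.gr0I dvd_imp_le div_le_mono simp: Suc_le_eq elim!: dvdE)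
    then show "(case a of (n, d) \<Rightarrow> (d, n div d)) \<in> (SIGMA d:{1..N}. {1..N div d})" using a by auto
  next
    fix b :: "nat \<times> nat" assume "b \<in> (SIGMA d:{1..N}. {1..N div d})"
    then obtain d e where b: "b = (d, e)" "d \<ge> 1" "e \<ge> 1" "e \<le> N div d" by auto
    then have "d * e \<le> N" by (simp add: less_eq_div_iff_mult_less_eq mult.commute)
    then show "(case b of (d, e) \<Rightarrow> (d * e, d)) \<in> (SIGMA n:{1..N}. {d. d dvd n})" using b by auto
  qed auto
  also have "\<dots> = (\<Sum>d=1..N. \<Sum>e=1..N div d. F d e)" by (intro sum.Sigma[symmetric]) auto
  finally show ?thesis .
qed

text \<open>For \<open>e\<close> up to the cutoff \<open>K\<close> the inner sum runs over
  \<open>d\<close>, beyond it over \<open>e\<close>; each inner sum is then one in which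
  cancellation is known.\<close>

lemma hyperbola_split:
  fixes F :: "nat \<Rightarrow> nat \<Rightarrow> real"
  shows "(\<Sum>d=1..N. \<Sum>e=1..N div d. F d e) =
    (\<Sum>e=1..K. \<Sum>d=1..N div e. F d e) + (\<Sum>d=1..N. \<Sum>e\<in>{K<..N div d}. F d e)"
proof -
  define H where "H = (\<lambda>d e. if d * e \<le> N then F d e else 0)"
  have le: "e \<le> N div d \<longleftrightarrow> d * e \<le> N" if "d > 0" for d e
    using that by (simp add: less_eq_div_iff_mult_less_eq mult.commute)
  have H_eq: "H d e = (if e \<le> N div d then F d e else 0)" if "d > 0" for d e
    using le[OF that] by (simp add: H_def)
  have range: "(\<Sum>e=1..N div d. F d e) = (\<Sum>e=1..K. H d e) + (\<Sum>e\<in>{K<..N div d}. F d e)" if d: "d \<in> {1..N}" for d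
  proof (cases "K \<le> N div d")
    case True
    have "{1..N div d} = {1..K} \<union> {K<..N div d}" using True by auto
    then have "(\<Sum>e=1..N div d. F d e) = (\<Sum>e\<in>{1..K} \<union> {K<..N div d}. F d e)" by simp
    also have "\<dots> = (\<Sum>e=1..K. F d e) + (\<Sum>e\<in>{K<..N div d}. F d e)"
      by (rule sum.union_disjoint) auto
    also have "(\<Sum>e=1..K. F d e) = (\<Sum>e=1..K. H d e)"
      using True d by (intro sum.cong) (auto simp: H_eq)
    finally show ?thesis .
  next
    case False
    have "(\<Sum>e=1..N div d. F d e) = (\<Sum>e=1..K. H d e)"
      using False d by (intro sum.mono_neutral_cong_left) (auto simp: H_eq)
    then show ?thesis using False by simp
  qed
  have swapped: "(\<Sum>d=1..N. H d e) = (\<Sum>d=1..N div e. F d e)" if e: "e \<in> {1..K}" for e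
  proof -
    have "H d e = (if d \<le> N div e then F d e else 0)" for d
      using le[of e d] e by (simp add: H_def mult.commute)
    then show ?thesis using div_le_dividend[of N e]
      by (intro sum.mono_neutral_cong_right) auto
  qed
  have "(\<Sum>d=1..N. \<Sum>e=1..K. H d e) = (\<Sum>e=1..K. \<Sum>d=1..N. H d e)" by (rule sum.swap)
  also have "\<dots> = (\<Sum>e=1..K. \<Sum>d=1..N div e. F d e)" by (rule sum.cong[OF refl swapped])
  finally show ?thesis using range by (simp add: sum.distrib)
qed

lemma sum_inverse_sqrt_le: "(\<Sum>d=1..D. 1 / sqrt (real d)) \<le> 2 * sqrt (real D)"
proof (induction D)
  case (Suc D)
  define a b where "a = sqrt (real (Suc D))" and "b = sqrt (real D)"
  have ab: "a > 0" "b \<le> a" by (simp_all add: a_def b_def)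
  have "a\<^sup>2 - b\<^sup>2 = 1" by (simp add: a_def b_def)
  then have "1 = (a - b) * (a + b)" by (simp add: power2_eq_square algebra_simps)
  also have "\<dots> \<le> (a - b) * (2 * a)" using ab by (intro mult_left_mono) auto
  finally have "1 \<le> 2 * (a - b) * a" by (simp only: mult_ac)
  then have "1 / a \<le> 2 * (a - b)" using ab(1) by (simp only: pos_divide_le_eq)
  then have "1 / sqrt (real (Suc D)) \<le> 2 * (sqrt (real (Suc D)) - sqrt (real D))"
    by (simp only: a_def b_def)
  with Suc show ?case by simp
qed simp

lemma ln_le_2_sqrt: "x > 0 \<Longrightarrow> ln x \<le> 2 * sqrt (x :: real)"
  using ln_le_minus_one[of "sqrt x"] by (simp add: ln_sqrt)

context real_character begin

text \<open>Abel's bound needs decreasing weights, so ln k is replaced by ln N - ln k, cut off at 0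
  beyond \<open>N\<close>; the difference is ln N times a bounded sum.\<close>

lemma sum_psi_ln_bound: "\<bar>\<Sum>e=1..N. \<psi> e * ln (real e)\<bar> \<le> 2 * real q * ln (real N)"
proof (cases "N = 0")
  case False
  let ?b = "\<lambda>k. max 0 (ln (real N) - ln (real k))"
  have "?b (Suc n) \<le> ?b n" if "n > 0" for n using that by (intro max.mono) auto
  then have "\<bar>\<Sum>n=1..N. \<psi> n * ?b n\<bar> \<le> real q * ?b 1"
    using partial_sum_bound' by (intro abel_bound_decreasing) auto
  moreover have "(\<Sum>n=1..N. \<psi> n * ?b n) = (\<Sum>n=1..N. \<psi> n) * ln (real N) - (\<Sum>e=1..N. \<psi> e * ln (real e))"
  proof -
    have "(\<Sum>n=1..N. \<psi> n * ?b n) = (\<Sum>n=1..N. \<psi> n * ln (real N) - \<psi> n * ln (real n))"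
      by (intro sum.cong refl) (auto simp: max_def algebra_simps)
    then show ?thesis by (simp add: sum_subtractf sum_distrib_right)
  qed
  moreover have "\<bar>(\<Sum>n=1..N. \<psi> n) * ln (real N)\<bar> \<le> real q * ln (real N)"
    using partial_sum_bound'[of N] False by (simp add: abs_mult mult_right_mono)
  ultimately show ?thesis using False by simp
qed simp

text \<open>\<psi> \<Lambda> is the convolution of \<mu> \<psi> and \<psi> ln. For e \<le> K the
  sums of \<mu> \<psi> are o(N). For e > K the sums of \<psi> ln are O(ln (N / d)), bounded by a
  multiple of sqrt (N / d); only d \<le> N / K occur, so they add up to O(N / sqrt K).\<close>

lemma mangoldt_psi_mean: "(\<lambda>N. (\<Sum>n=1..N. \<psi> n * mangoldt n) / real N) \<longlonglongrightarrow> 0"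
  unfolding mean_tendsto_0_iff
proof (intro allI impI)
  fix \<epsilon> :: real assume \<epsilon>: "\<epsilon> > 0"
  define g h where "g = (\<lambda>d. moebius_mu d * \<psi> d)" and "h = (\<lambda>e. \<psi> e * ln (real e))"
  define S where "S = (\<lambda>N. \<Sum>n=1..N. g n)"
  have g1: "\<bar>g d\<bar> \<le> 1" for d
    using mult_mono[OF abs_moebius_mu_le[of d] abs_le_1[of d]] by (simp add: g_def abs_mult)
  \<comment> \<open>Large enough for 16 q / sqrt K, the share of the pairs with e > K, to be at most
    \<epsilon> / 2.\<close>
  define K where "K = nat \<lceil>(32 * real q / \<epsilon>)\<^sup>2\<rceil> + 1"
  have K: "K \<ge> 1" "(32 * real q / \<epsilon>)\<^sup>2 \<le> real K" unfolding K_def by linarith+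
  then have "32 * real q / \<epsilon> \<le> sqrt (real K)" by (intro real_le_rsqrt)
  then have K': "16 * real q / sqrt (real K) \<le> \<epsilon> / 2" using \<epsilon> K(1) by (simp add: field_simps)
  \<comment> \<open>There are \<open>K\<close> values of \<open>e\<close>, each weighted by at most
    \<open>K\<close>; together they contribute \<epsilon> / 2.\<close>
  define \<epsilon>' where "\<epsilon>' = \<epsilon> / (2 * (real K)\<^sup>2)"
  have \<epsilon>': "\<epsilon>' > 0" using \<epsilon> K by (simp add: \<epsilon>'_def)
  obtain B where B: "\<And>N. \<bar>S N\<bar> \<le> \<epsilon>' * real N + B"
    using kronecker_mean[OF moebius_psi_summable \<epsilon>'] by (auto simp: S_def g_def)
  have B0: "B \<ge> 0" using B[of 0] by (simp add: S_def)
  have "\<bar>\<Sum>n=1..N. \<psi> n * mangoldt n\<bar> \<le> \<epsilon> * real N + (real K)\<^sup>2 * B" for N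
  proof -
    have "(\<Sum>n=1..N. \<psi> n * mangoldt n) = (\<Sum>n=1..N. \<Sum>d | d dvd n. g d * h (n div d))"
    proof (intro sum.cong refl)
      fix n assume n: "n \<in> {1..N}"
      have "(\<Sum>d | d dvd n. g d * h (n div d)) = (\<Sum>d | d dvd n. \<psi> n * (moebius_mu d * ln (real (n div d))))"
      proof (intro sum.cong refl)
        fix d assume "d \<in> {d. d dvd n}"
        then have "\<psi> n = \<psi> d * \<psi> (n div d)" using mult[of d "n div d"] by simp
        then show "g d * h (n div d) = \<psi> n * (moebius_mu d * ln (real (n div d)))" by (simp add: g_def h_def)
      qed
      also have "\<dots> = \<psi> n * mangoldt n"
        using sum_moebius_mu_ln[of n] n by (simp flip: sum_distrib_left)
      finally show "\<psi> n * mangoldt n = (\<Sum>d | d dvd n. g d * h (n div d))" ..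
    qed
    also have "\<dots> = (\<Sum>e=1..K. \<Sum>d=1..N div e. g d * h e) + (\<Sum>d=1..N. \<Sum>e\<in>{K<..N div d}. g d * h e)"
      unfolding sum_divisors_pairs[of "\<lambda>d e. g d * h e"] by (rule hyperbola_split)
    finally have eq: "(\<Sum>n=1..N. \<psi> n * mangoldt n) =
      (\<Sum>e=1..K. \<Sum>d=1..N div e. g d * h e) + (\<Sum>d=1..N. \<Sum>e\<in>{K<..N div d}. g d * h e)" .
    have "\<bar>\<Sum>e=1..K. \<Sum>d=1..N div e. g d * h e\<bar> \<le> (\<Sum>e=1..K. real K * (\<epsilon>' * real N + B))"
    proof (rule order_trans[OF sum_abs sum_mono])
      fix e assume e: "e \<in> {1..K}"
      have "\<bar>h e\<bar> \<le> 1 * real e" unfolding h_def abs_mult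
        using e abs_le_1[of e] ln_le_minus_one[of "real e"] by (intro mult_mono) auto
      then have h: "\<bar>h e\<bar> \<le> real K" using e by simp
      have "\<bar>S (N div e)\<bar> \<le> \<epsilon>' * real (N div e) + B" by (rule B)
      also have "\<dots> \<le> \<epsilon>' * real N + B" using \<epsilon>' by (simp add: div_le_dividend)
      finally have "\<bar>h e\<bar> * \<bar>S (N div e)\<bar> \<le> real K * (\<epsilon>' * real N + B)" using h by (intro mult_mono) auto
      moreover have "(\<Sum>d=1..N div e. g d * h e) = h e * S (N div e)"
        by (simp add: S_def sum_distrib_left mult.commute)
      ultimately show "\<bar>\<Sum>d=1..N div e. g d * h e\<bar> \<le> real K * (\<epsilon>' * real N + B)" by (simp add: abs_mult)
    qed
    also have "\<dots> = \<epsilon> / 2 * real N + (real K)\<^sup>2 * B"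
      using K(1) by (simp add: \<epsilon>'_def power2_eq_square field_simps)
    finally have 1: "\<bar>\<Sum>e=1..K. \<Sum>d=1..N div e. g d * h e\<bar> \<le> \<epsilon> / 2 * real N + (real K)\<^sup>2 * B" .
    have inner: "\<bar>\<Sum>e\<in>{K<..N div d}. g d * h e\<bar> \<le> (if d \<le> N div K then 8 * real q * sqrt (real N) * (1 / sqrt (real d)) else 0)"
      if d: "d \<in> {1..N}" for d
    proof (cases "K < N div d")
      case True
      then have "K \<le> N div d" by simp
      then have "d * K \<le> N" using d less_eq_div_iff_mult_less_eq[of d K N] by (simp add: mult.commute)
      then have dK: "d \<le> N div K" using K(1) by (simp add: less_eq_div_iff_mult_less_eq)
      have N: "N > 0" using d by simp
      have "{1..N div d} = {1..K} \<union> {K<..N div d}" using True by auto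
      then have "(\<Sum>e=1..N div d. h e) = (\<Sum>e=1..K. h e) + (\<Sum>e\<in>{K<..N div d}. h e)"
        by (simp add: sum.union_disjoint ivl_disj_int)
      then have "\<bar>\<Sum>e\<in>{K<..N div d}. h e\<bar> \<le> \<bar>\<Sum>e=1..N div d. h e\<bar> + \<bar>\<Sum>e=1..K. h e\<bar>" by linarith
      also have "\<dots> \<le> 2 * real q * ln (real (N div d)) + 2 * real q * ln (real K)"
        unfolding h_def by (intro add_mono sum_psi_ln_bound)
      also have "\<dots> \<le> 2 * real q * ln (real (N div d)) + 2 * real q * ln (real (N div d))"
        using True K(1) by (intro add_left_mono mult_left_mono) auto
      also have "\<dots> = 4 * real q * ln (real (N div d))" by simp
      also have "\<dots> \<le> 4 * real q * ln (real N / real d)"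
        using True K(1) by (intro mult_left_mono ln_mono) (auto simp: of_nat_div_le_of_nat)
      also have "\<dots> \<le> 4 * real q * (2 * sqrt (real N / real d))"
        using d N by (intro mult_left_mono ln_le_2_sqrt) auto
      also have "\<dots> = 8 * real q * sqrt (real N) * (1 / sqrt (real d))" by (simp add: real_sqrt_divide)
      finally have "\<bar>\<Sum>e\<in>{K<..N div d}. h e\<bar> \<le> 8 * real q * sqrt (real N) * (1 / sqrt (real d))" .
      moreover have "\<bar>\<Sum>e\<in>{K<..N div d}. g d * h e\<bar> \<le> 1 * \<bar>\<Sum>e\<in>{K<..N div d}. h e\<bar>"
        using g1[of d] by (simp add: abs_mult mult_left_le_one_le flip: sum_distrib_left)
      ultimately show ?thesis using dK by simp
    qed (auto simp: mult_nonneg_nonneg)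
    have "\<bar>\<Sum>d=1..N. \<Sum>e\<in>{K<..N div d}. g d * h e\<bar> \<le>
        (\<Sum>d=1..N. if d \<le> N div K then 8 * real q * sqrt (real N) * (1 / sqrt (real d)) else 0)"
      by (rule order_trans[OF sum_abs sum_mono[OF inner]])
    also have "\<dots> = (\<Sum>d=1..N div K. 8 * real q * sqrt (real N) * (1 / sqrt (real d)))"
      using div_le_dividend[of N K] by (intro sum.mono_neutral_cong_right) auto
    also have "\<dots> = 8 * real q * sqrt (real N) * (\<Sum>d=1..N div K. 1 / sqrt (real d))"
      by (simp only: sum_distrib_left)
    also have "\<dots> \<le> 8 * real q * sqrt (real N) * (2 * sqrt (real (N div K)))"
      by (intro mult_left_mono sum_inverse_sqrt_le) auto
    also have "\<dots> \<le> 8 * real q * sqrt (real N) * (2 * sqrt (real N / real K))"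
      by (intro mult_left_mono real_sqrt_le_mono) (auto simp: of_nat_div_le_of_nat)
    also have "\<dots> = 16 * real q / sqrt (real K) * real N"
      by (simp add: real_sqrt_divide)
    also have "\<dots> \<le> \<epsilon> / 2 * real N" using K' by (intro mult_right_mono) auto
    finally show ?thesis using 1 unfolding eq by linarith
  qed
  then show "\<exists>B. \<forall>N. \<bar>\<Sum>n=1..N. \<psi> n * mangoldt n\<bar> \<le> \<epsilon> * real N + B" by blast
qed

end

section \<open>From von Mangoldt weights to primes\<close>

text \<open>A proper prime power up to \<open>N\<close> has base at most sqrt N and exponent at most
  ln N / ln 2.\<close>

lemma nonprime_mangoldt_sum:
  "(\<Sum>n=1..N. if prime n then 0 else mangoldt n :: real) \<le> sqrt (real N) * (ln (real N) / ln 2) * ln (real N)"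
proof (cases "N = 0")
  case False
  define A where "A = {n \<in> {1..N}. primepow n \<and> \<not> prime n}"
  have "(\<Sum>n=1..N. if prime n then 0 else mangoldt n :: real) = (\<Sum>n\<in>A. mangoldt n)"
    unfolding A_def by (intro sum.mono_neutral_cong_right) (auto simp: mangoldt_def)
  also have "\<dots> \<le> (\<Sum>n\<in>A. ln (real N))"
  proof (rule sum_mono)
    fix n assume n: "n \<in> A"
    then have "mangoldt n \<le> ln (real n)" by (intro mangoldt_le) (auto simp: A_def)
    also have "\<dots> \<le> ln (real N)" using n by (auto simp: A_def)
    finally show "mangoldt n \<le> ln (real N)" .
  qed
  also have "\<dots> = real (card A) * ln (real N)" by simp
  also have "\<dots> \<le> (sqrt (real N) * (ln (real N) / ln 2)) * ln (real N)"
  proof (rule mult_right_mono)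
    define P where "P = nat \<lfloor>sqrt (real N)\<rfloor>"
    define Q where "Q = nat \<lfloor>ln (real N) / ln 2\<rfloor>"
    have lnN: "ln (real N) / ln 2 \<ge> 0" using False by simp
    have "A \<subseteq> (\<lambda>(p, k). p ^ k) ` ({1..P} \<times> {1..Q})"
    proof
      fix n assume n: "n \<in> A"
      then obtain p k where pk: "n = p ^ k" "prime p" "k > 0"
        by (auto simp: A_def primepow_def)
      have "k \<noteq> 1" using n pk by (auto simp: A_def)
      then have "k \<ge> 2" using pk by simp
      have "n \<le> N" using n by (simp add: A_def)
      have "p \<ge> 2" using pk prime_ge_2_nat by blast
      have "p ^ 2 \<le> p ^ k" using \<open>k \<ge> 2\<close> \<open>p \<ge> 2\<close> by (intro power_increasing) auto
      then have "(real p)\<^sup>2 \<le> real N" using pk(1) \<open>n \<le> N\<close> by (metis le_trans of_nat_le_iff of_nat_power)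
      then have "real p \<le> sqrt (real N)" by (rule real_le_rsqrt)
      then have "p \<le> P" unfolding P_def by (simp add: le_nat_floor)
      have "2 ^ k \<le> p ^ k" using \<open>p \<ge> 2\<close> by (rule power_mono) simp
      then have "2 ^ k \<le> N" using pk(1) \<open>n \<le> N\<close> by simp
      then have "real (2 ^ k) \<le> real N" by (simp only: of_nat_le_iff)
      then have "2 ^ k \<le> real N" by simp
      then have "ln (2 ^ k) \<le> ln (real N)" using False by (subst ln_le_cancel_iff) auto
      then have "real k \<le> ln (real N) / ln 2" by (simp add: ln_realpow field_simps)
      then have "k \<le> Q" unfolding Q_def by (simp add: le_nat_floor)
      then show "n \<in> (\<lambda>(p, k). p ^ k) ` ({1..P} \<times> {1..Q})"
        using pk \<open>p \<le> P\<close> \<open>p \<ge> 2\<close> by (auto intro!: image_eqI[of _ _ "(p, k)"])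
    qed
    then have "card A \<le> card ((\<lambda>(p, k). p ^ k) ` ({1..P} \<times> {1..Q}) :: nat set)" by (intro card_mono) auto
    also have "\<dots> \<le> card ({1..P} \<times> {1..Q})" by (rule card_image_le) simp
    also have "\<dots> = P * Q" by (simp add: card_cartesian_product)
    finally have "real (card A) \<le> real P * real Q" by (metis of_nat_le_iff of_nat_mult)
    also have "\<dots> \<le> sqrt (real N) * (ln (real N) / ln 2)"
      using lnN unfolding P_def Q_def by (intro mult_mono) (auto simp: of_nat_floor)
    finally show "real (card A) \<le> sqrt (real N) * (ln (real N) / ln 2)" .
    show "0 \<le> ln (real N)" using False by simp
  qed
  finally show ?thesis .
qed simp

lemma nonprime_mangoldt_mean: "(\<lambda>N. (\<Sum>n=1..N. if prime n then 0 else mangoldt n :: real) / real N) \<longlonglongrightarrow> 0"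
proof (rule tendsto_sandwich[of "\<lambda>_. 0"])
  have "(\<lambda>N. sqrt (real N) * (ln (real N) / ln 2) * ln (real N) / real N) \<longlonglongrightarrow> 0" by real_asymp
  then show "(\<lambda>N. sqrt (real N) * (ln (real N) / ln 2) * ln (real N) / real N) \<longlonglongrightarrow> 0" .
  show "\<forall>\<^sub>F N in sequentially. (\<Sum>n=1..N. if prime n then 0 else mangoldt n :: real) / real N \<le>
      sqrt (real N) * (ln (real N) / ln 2) * ln (real N) / real N"
    using nonprime_mangoldt_sum by (intro always_eventually allI divide_right_mono) auto
  show "\<forall>\<^sub>F N in sequentially. 0 \<le> (\<Sum>n=1..N. if prime n then 0 else mangoldt n :: real) / real N"
    using mangoldt_nonneg by (intro always_eventually allI divide_nonneg_nonneg sum_nonneg) auto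
qed simp

lemma abel_nonneg:
  fixes a b :: "nat \<Rightarrow> real"
  assumes a: "\<And>n. (\<Sum>k=1..n. a k) \<ge> 0"
    and b: "\<And>n. n > 0 \<Longrightarrow> b (Suc n) \<le> b n" "\<And>n. n > 0 \<Longrightarrow> b n \<ge> 0"
  shows "(\<Sum>n=1..N. a n * b n) \<ge> 0"
proof (cases "N = 0")
  case False
  define P where "P = (\<lambda>n. \<Sum>k=1..n. a k)"
  have "N > 0" using False by simp
  then have "(\<Sum>n=1..N. a n * b n) = P N * b N + (\<Sum>n=1..<N. P n * (b n - b (Suc n)))"
  proof (induction N rule: nat_induct_non_zero)
    case (Suc n)
    then show ?case by (auto simp: P_def algebra_simps)
  qed (simp add: P_def)
  also have "\<dots> \<ge> 0"
    using a b \<open>N > 0\<close> by (intro add_nonneg_nonneg mult_nonneg_nonneg sum_nonneg) (auto simp: P_def)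
  finally show ?thesis .
qed simp

text \<open>Applied to c - a and c + a, whose partial sums are nonnegative,
  \<open>abel_nonneg\<close> gives both inequalities.\<close>

lemma abel_compare:
  fixes a c b :: "nat \<Rightarrow> real"
  assumes "\<And>n. \<bar>\<Sum>k=1..n. a k\<bar> \<le> (\<Sum>k=1..n. c k)"
    and b: "\<And>n. n > 0 \<Longrightarrow> b (Suc n) \<le> b n" "\<And>n. n > 0 \<Longrightarrow> b n \<ge> 0"
  shows "\<bar>\<Sum>n=1..N. a n * b n\<bar> \<le> (\<Sum>n=1..N. c n * b n)"
proof -
  have le: "(\<Sum>k=1..n. a k) \<le> (\<Sum>k=1..n. c k)" "- (\<Sum>k=1..n. a k) \<le> (\<Sum>k=1..n. c k)" for n
    using assms(1)[of n] by linarith+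
  have nn: "(\<Sum>k=1..n. c k - a k) \<ge> 0" "(\<Sum>k=1..n. c k + a k) \<ge> 0" for n
    unfolding sum_subtractf sum.distrib using le[of n] by linarith+
  have "(\<Sum>n=1..N. (c n - a n) * b n) \<ge> 0" "(\<Sum>n=1..N. (c n + a n) * b n) \<ge> 0"
    using abel_nonneg[of "\<lambda>n. c n - a n" b N, OF nn(1) b] abel_nonneg[of "\<lambda>n. c n + a n" b N, OF nn(2) b] by blast+
  then show ?thesis by (simp add: left_diff_distrib distrib_right sum_subtractf sum.distrib abs_le_iff)
qed

text \<open>Terms up to sqrt N are at most 1 / ln 2, the later ones at most 2 / ln N.\<close>

lemma sum_inverse_ln_le:
  assumes "N \<ge> 2"
  shows "(\<Sum>n=2..N. 1 / ln (real n)) \<le> sqrt (real N) / ln 2 + 2 * real N / ln (real N)"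
proof -
  have lnN: "ln (real N) > 0" using assms by simp
  have "(\<Sum>n=2..N. 1 / ln (real n)) \<le> (\<Sum>n=2..N. (if real n \<le> sqrt (real N) then 1 / ln 2 else 0) + 2 / ln (real N))"
  proof (rule sum_mono)
    fix n assume n: "n \<in> {2..N}"
    show "1 / ln (real n) \<le> (if real n \<le> sqrt (real N) then 1 / ln 2 else 0) + 2 / ln (real N)"
    proof (cases "real n \<le> sqrt (real N)")
      case True
      have "1 / ln (real n) \<le> 1 / ln 2" using n by (intro divide_left_mono) auto
      then show ?thesis using True lnN by (simp add: add_increasing2)
    next
      case False
      have "ln (real N) / 2 = ln (sqrt (real N))" using assms by (simp add: ln_sqrt)
      also have "\<dots> \<le> ln (real n)" using False assms n by (subst ln_le_cancel_iff) auto
      finally have "1 / ln (real n) \<le> 1 / (ln (real N) / 2)"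
        using lnN n by (intro divide_left_mono) auto
      then show ?thesis using False by simp
    qed
  qed
  also have "\<dots> = real (card {n \<in> {2..N}. real n \<le> sqrt (real N)}) / ln 2 + real (card {2..N}) * (2 / ln (real N))"
    by (simp add: sum.distrib flip: sum.inter_filter)
  also have "\<dots> \<le> sqrt (real N) / ln 2 + real N * (2 / ln (real N))"
  proof (intro add_mono divide_right_mono mult_right_mono)
    have "{n \<in> {2..N}. real n \<le> sqrt (real N)} \<subseteq> {1..nat \<lfloor>sqrt (real N)\<rfloor>}"
      by (auto simp: le_nat_floor)
    then have "card {n \<in> {2..N}. real n \<le> sqrt (real N)} \<le> card {1..nat \<lfloor>sqrt (real N)\<rfloor>}"
      by (intro card_mono) auto
    also have "\<dots> = nat \<lfloor>sqrt (real N)\<rfloor>" by simp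
    finally have "real (card {n \<in> {2..N}. real n \<le> sqrt (real N)}) \<le> real (nat \<lfloor>sqrt (real N)\<rfloor>)"
      by (rule of_nat_mono)
    also have "\<dots> \<le> sqrt (real N)" by (rule of_nat_floor) simp
    finally show "real (card {n \<in> {2..N}. real n \<le> sqrt (real N)}) \<le> sqrt (real N)" .
  qed (use lnN in auto)
  finally show ?thesis by (simp add: mult.commute)
qed

text \<open>Partial summation with the weights 1 / ln n against a majorant \<open>c\<close> whose
  partial sums are \<epsilon> n + B. The weight at 1 is set to that at 2, so that the weights
  decrease throughout.\<close>

lemma prime_sum_of_log_weighted:
  fixes w :: "nat \<Rightarrow> real"
  assumes "(\<lambda>N. (\<Sum>n=1..N. if prime n then w n * ln (real n) else 0) / real N) \<longlonglongrightarrow> 0"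
  shows "(\<lambda>N. (\<Sum>n=1..N. if prime n then w n else 0) * ln (real N) / real N) \<longlonglongrightarrow> 0"
proof (rule tendstoI)
  fix e :: real assume e: "e > 0"
  define a where "a = (\<lambda>n. if prime n then w n * ln (real n) else 0)"
  define b where "b = (\<lambda>n::nat. if n \<le> 1 then 1 / ln 2 else 1 / ln (real n))"
  define \<epsilon> where "\<epsilon> = e / 4"
  have \<epsilon>: "\<epsilon> > 0" using e by (simp add: \<epsilon>_def)
  obtain B where B: "\<And>N. \<bar>\<Sum>n=1..N. a n\<bar> \<le> \<epsilon> * real N + B"
    using assms \<epsilon> unfolding mean_tendsto_0_iff a_def by blast
  have B0: "B \<ge> 0" using B[of 0] by simp
  \<comment> \<open>The constant \<open>B\<close> is placed on the first term.\<close>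
  define c where "c = (\<lambda>n::nat. if n = 1 then \<epsilon> + B else \<epsilon>)"
  have c_sum: "(\<Sum>k=1..n. c k) = \<epsilon> * real n + (if n = 0 then 0 else B)" for n
    by (induction n) (auto simp: c_def algebra_simps)
  have b_dec: "b (Suc n) \<le> b n" if "n > 0" for n
    using that by (auto simp: b_def intro!: divide_left_mono)
  have b_nn: "b n \<ge> 0" if "n > 0" for n
    using that by (auto simp: b_def)
  have main: "\<bar>\<Sum>n=1..N. if prime n then w n else 0\<bar> \<le> (\<epsilon> + B) / ln 2 + \<epsilon> * (sqrt (real N) / ln 2 + 2 * real N / ln (real N))"
    if N: "N \<ge> 2" for N
  proof -
    have "(\<Sum>n=1..N. if prime n then w n else 0) = (\<Sum>n=1..N. a n * b n)"
      by (intro sum.cong refl) (auto simp: a_def b_def dest: prime_gt_1_nat)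
    also have "\<bar>\<dots>\<bar> \<le> (\<Sum>n=1..N. c n * b n)"
    proof (rule abel_compare)
      show "\<bar>\<Sum>k=1..n. a k\<bar> \<le> (\<Sum>k=1..n. c k)" for n
        unfolding c_sum using B[of n] by (cases "n = 0") auto
    qed (use b_dec b_nn in auto)
    also have "{1..N} = insert 1 {2..N}" using N by auto
    then have "(\<Sum>n=1..N. c n * b n) = c 1 * b 1 + (\<Sum>n=2..N. c n * b n)" by simp
    also have "(\<Sum>n=2..N. c n * b n) = \<epsilon> * (\<Sum>n=2..N. 1 / ln (real n))"
      unfolding sum_distrib_left by (intro sum.cong refl) (auto simp: c_def b_def)
    also have "\<dots> \<le> \<epsilon> * (sqrt (real N) / ln 2 + 2 * real N / ln (real N))"
      using sum_inverse_ln_le[OF N] \<epsilon> by (intro mult_left_mono) auto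
    finally show ?thesis by (simp add: c_def b_def)
  qed
  have "(\<lambda>N. ((\<epsilon> + B) / ln 2 + \<epsilon> * (sqrt (real N) / ln 2 + 2 * real N / ln (real N))) * ln (real N) / real N) \<longlonglongrightarrow> 2 * \<epsilon>"
    by real_asymp
  moreover have "2 * \<epsilon> < e" using e by (simp add: \<epsilon>_def)
  ultimately have "\<forall>\<^sub>F N in sequentially. ((\<epsilon> + B) / ln 2 + \<epsilon> * (sqrt (real N) / ln 2 + 2 * real N / ln (real N))) * ln (real N) / real N < e"
    by (rule order_tendstoD)
  then show "\<forall>\<^sub>F N in sequentially. dist ((\<Sum>n=1..N. if prime n then w n else 0) * ln (real N) / real N) 0 < e"
    using eventually_ge_at_top[of 2]
  proof eventually_elim
    case (elim N)
    have "\<bar>\<Sum>n=1..N. if prime n then w n else 0\<bar> * (ln (real N) / real N) \<le>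
        ((\<epsilon> + B) / ln 2 + \<epsilon> * (sqrt (real N) / ln 2 + 2 * real N / ln (real N))) * (ln (real N) / real N)"
      using elim by (intro mult_right_mono main) auto
    then show ?case using elim by (simp add: abs_mult)
  qed
qed

section \<open>Chebyshev's lower bound\<close>

text \<open>The logarithm of the central binomial coefficient is the sum of \<Lambda>(d) times floor
  (2 m / d) - 2 floor (m / d), and this factor is at most 1.\<close>

lemma mangoldt_sum_lower: "(\<Sum>n=1..2 * m. mangoldt n) \<ge> real m * ln 4 - ln (2 * real m)"
proof (cases "m = 0")
  case False
  have fact_eq: "ln (fact M) = (\<Sum>d=1..2 * m. mangoldt d * real (M div d))" if "M \<le> 2 * m" for M
  proof -
    have "ln (fact M :: real) = (\<Sum>n=1..M. ln (real n))"
      by (induction M) (simp_all add: ln_mult del: of_nat_Suc)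
    also have "\<dots> = (\<Sum>n=1..M. \<Sum>d | d dvd n. mangoldt d * 1)"
      using mangoldt_sum[where ?'a = real] by (intro sum.cong refl) simp
    also have "\<dots> = (\<Sum>d=1..M. \<Sum>e=1..M div d. mangoldt d * 1)" by (rule sum_divisors_pairs)
    also have "\<dots> = (\<Sum>d=1..M. mangoldt d * real (M div d))" by (simp add: mult.commute)
    also have "\<dots> = (\<Sum>d=1..2 * m. mangoldt d * real (M div d))"
      using that by (intro sum.mono_neutral_left) auto
    finally show ?thesis .
  qed
  have "4 ^ m / (2 * real m) \<le> real ((2 * m) choose m)"
    using central_binomial_lower_bound[of m] False by simp
  then have "ln (4 ^ m / (2 * real m)) \<le> ln (real ((2 * m) choose m))"
    using False by (subst ln_le_cancel_iff) auto
  then have "real m * ln 4 - ln (2 * real m) \<le> ln (real ((2 * m) choose m))"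
    using False by (simp add: ln_div ln_realpow)
  also have "real ((2 * m) choose m) = fact (2 * m) / (fact m * fact m)"
    by (subst binomial_fact) (auto simp: mult_2)
  also have "ln \<dots> = ln (fact (2 * m)) - 2 * ln (fact m)" by (simp add: ln_div ln_mult)
  also have "\<dots> = (\<Sum>d=1..2 * m. mangoldt d * (real (2 * m div d) - 2 * real (m div d)))"
    by (simp add: fact_eq sum_distrib_left right_diff_distrib mult_ac flip: sum_subtractf)
  also have "\<dots> \<le> (\<Sum>d=1..2 * m. mangoldt d * 1)"
  proof (intro sum_mono mult_left_mono mangoldt_nonneg)
    fix d assume d: "d \<in> {1..2 * m}"
    have "2 * m div d \<le> 2 * (m div d) + 1"
    proof -
      have "m < d + d * (m div d)" using d by (intro dividend_less_times_div) auto
      then have "2 * m < d * (2 * (m div d) + 2)" by (simp add: algebra_simps)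
      then have "2 * m div d < 2 * (m div d) + 2" using d by (simp add: div_less_iff_less_mult mult.commute)
      then show ?thesis by simp
    qed
    then have "real (2 * m div d) \<le> real (2 * (m div d) + 1)" by (simp only: of_nat_le_iff)
    then show "real (2 * m div d) - 2 * real (m div d) \<le> 1" by simp
  qed
  finally show ?thesis by simp
qed simp

definition prime_pi :: "nat \<Rightarrow> nat" where
  "prime_pi N = card {p. prime p \<and> p \<le> N}"

lemma prime_pi_eq_sum: "real (prime_pi N) = (\<Sum>n=1..N. if prime n then 1 else 0)"
proof -
  have "(\<Sum>n=1..N. if prime n then 1 else 0 :: real) = real (card {n \<in> {1..N}. prime n})"
    by (simp flip: sum.inter_filter)
  also have "{n \<in> {1..N}. prime n} = {p. prime p \<and> p \<le> N}" by (auto dest: prime_ge_1_nat)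
  finally show ?thesis by (simp add: prime_pi_def)
qed

text \<open>This turns an error o(N / ln N) into an error small relative to the number of
  primes.\<close>

lemma chebyshev_lower: "\<forall>\<^sub>F N in sequentially. real N / 2 \<le> real (prime_pi N) * ln (real N)"
proof -
  have split: "(\<Sum>n=1..N. mangoldt n) \<le> real (prime_pi N) * ln (real N) + (\<Sum>n=1..N. if prime n then 0 else mangoldt n)" for N
  proof -
    have "(\<Sum>n=1..N. mangoldt n) = (\<Sum>n=1..N. if prime n then ln (real n) else 0) + (\<Sum>n=1..N. if prime n then 0 else mangoldt n)"
      unfolding sum.distrib[symmetric] by (intro sum.cong refl) auto
    also have "(\<Sum>n=1..N. if prime n then ln (real n) else 0) \<le> (\<Sum>n=1..N. (if prime n then 1 else 0) * ln (real N))"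
      by (intro sum_mono) (auto dest: prime_gt_0_nat)
    also have "\<dots> = real (prime_pi N) * ln (real N)"
      by (simp add: prime_pi_eq_sum sum_distrib_right)
    finally show ?thesis by simp
  qed
  have lower: "(\<Sum>n=1..N. mangoldt n) \<ge> (real N - 1) / 2 * ln 4 - ln (real N)" if "N \<ge> 2" for N
  proof -
    let ?m = "N div 2"
    have m: "2 * ?m \<le> N" "?m > 0" "N \<le> 2 * ?m + 1" using that by linarith+
    then have "real N \<le> real (2 * ?m + 1)" by (simp only: of_nat_le_iff)
    then have m': "(real N - 1) / 2 \<le> real ?m" by simp
    have m'': "2 * real ?m \<le> real N" using m(1) by linarith
    have "(real N - 1) / 2 * ln 4 - ln (real N) \<le> real ?m * ln 4 - ln (2 * real ?m)"
      using m(2) m' m'' by (intro diff_mono mult_right_mono) auto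
    also have "\<dots> \<le> (\<Sum>n=1..2 * ?m. mangoldt n)" by (rule mangoldt_sum_lower)
    also have "\<dots> \<le> (\<Sum>n=1..N. mangoldt n)"
      using m by (intro sum_mono2) (auto simp: mangoldt_nonneg)
    finally show ?thesis .
  qed
  have "\<forall>\<^sub>F N in sequentially. (\<Sum>n=1..N. if prime n then 0 else mangoldt n) / real N < 1 / 10"
    by (rule order_tendstoD(2)[OF nonprime_mangoldt_mean]) simp
  \<comment> \<open>From ln 2 \<ge> 2/3 the main term is about 2 N / 3, which exceeds N / 2 plus the
    N / 10 granted to proper prime powers.\<close>
  moreover have "\<forall>\<^sub>F N in sequentially. real N / 2 + real N / 10 \<le> (real N - 1) / 2 * (4 / 3) - ln (real N)"
    by real_asymp
  ultimately show ?thesis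
    using eventually_ge_at_top[of 2]
  proof eventually_elim
    case (elim N)
    have "ln (4 :: real) = 2 * ln 2" using ln_realpow[of 2 2] by simp
    then have "(real N - 1) / 2 * (4 / 3) \<le> (real N - 1) / 2 * ln 4"
      using elim ln2_ge_two_thirds by (intro mult_left_mono) auto
    moreover have "(\<Sum>n=1..N. if prime n then 0 else mangoldt n :: real) < real N / 10"
      using elim by (simp add: field_simps)
    ultimately show ?case using split[of N] lower[OF elim(3)] elim(2) by linarith
  qed
qed

context real_character begin

theorem prime_character_sum: "(\<lambda>N. (\<Sum>n=1..N. if prime n then \<psi> n else 0) / real (prime_pi N)) \<longlonglongrightarrow> 0"
proof -
  have "(\<lambda>N. (\<Sum>n=1..N. if prime n then 0 else \<psi> n * mangoldt n) / real N) \<longlonglongrightarrow> 0"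
  proof (rule Lim_null_comparison[OF _ nonprime_mangoldt_mean], rule always_eventually, rule allI)
    fix N
    have "\<bar>\<Sum>n=1..N. if prime n then 0 else \<psi> n * mangoldt n\<bar> \<le> (\<Sum>n=1..N. if prime n then 0 else mangoldt n)"
      using abs_le_1 mangoldt_nonneg
      by (intro order_trans[OF sum_abs sum_mono]) (auto simp: abs_mult mult_left_le_one_le)
    then show "norm ((\<Sum>n=1..N. if prime n then 0 else \<psi> n * mangoldt n) / real N) \<le>
        (\<Sum>n=1..N. if prime n then 0 else mangoldt n) / real N"
      by (simp add: divide_right_mono)
  qed
  with mangoldt_psi_mean have "(\<lambda>N. (\<Sum>n=1..N. \<psi> n * mangoldt n) / real N -
      (\<Sum>n=1..N. if prime n then 0 else \<psi> n * mangoldt n) / real N) \<longlonglongrightarrow> 0 - 0"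
    by (rule tendsto_diff)
  moreover have "(\<Sum>n=1..N. \<psi> n * mangoldt n) / real N - (\<Sum>n=1..N. if prime n then 0 else \<psi> n * mangoldt n) / real N
      = (\<Sum>n=1..N. if prime n then \<psi> n * ln (real n) else 0) / real N" for N
    unfolding diff_divide_distrib[symmetric] sum_subtractf[symmetric]
    by (intro arg_cong2[where f = "(/)"] sum.cong refl) auto
  ultimately have "(\<lambda>N. (\<Sum>n=1..N. if prime n then \<psi> n * ln (real n) else 0) / real N) \<longlonglongrightarrow> 0" by simp
  then have lim: "(\<lambda>N. (\<Sum>n=1..N. if prime n then \<psi> n else 0) * ln (real N) / real N) \<longlonglongrightarrow> 0"
    by (rule prime_sum_of_log_weighted)
  show ?thesis
  proof (rule Lim_null_comparison)
    show "(\<lambda>N. 2 * \<bar>(\<Sum>n=1..N. if prime n then \<psi> n else 0) * ln (real N) / real N\<bar>) \<longlonglongrightarrow> 0"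
      using lim by (intro tendsto_mult_right_zero tendsto_rabs_zero)
    show "\<forall>\<^sub>F N in sequentially. norm ((\<Sum>n=1..N. if prime n then \<psi> n else 0) / real (prime_pi N)) \<le>
        2 * \<bar>(\<Sum>n=1..N. if prime n then \<psi> n else 0) * ln (real N) / real N\<bar>"
      using chebyshev_lower eventually_ge_at_top[of 2]
    proof eventually_elim
      case (elim N)
      let ?X = "\<bar>\<Sum>n=1..N. if prime n then \<psi> n else 0\<bar>"
      have pos: "real (prime_pi N) * ln (real N) > 0" using elim by linarith
      then have pi_pos: "real (prime_pi N) > 0" using elim by (simp add: zero_less_mult_iff)
      have "1 / real (prime_pi N) \<le> 2 * ln (real N) / real N"
        using elim pi_pos by (simp add: field_simps)
      then have "?X * (1 / real (prime_pi N)) \<le> ?X * (2 * ln (real N) / real N)"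
        by (intro mult_left_mono) auto
      then show ?case using elim by (simp add: abs_mult mult_ac)
    qed
  qed
qed

end

section \<open>Densities of sets of primes\<close>

lemma real_character_jacobi:
  assumes "odd m" "\<not> is_square m"
  shows "real_character m (\<lambda>n. real_of_int (jacobi m n))"
proof
  show "m > 0" using assms by (cases m) auto
  show "real_of_int (jacobi m (a * b)) = real_of_int (jacobi m a) * real_of_int (jacobi m b)" for a b
    using jacobi_mult_right[OF assms(1)] by simp
  show "real_of_int (jacobi m n) \<in> {-1, 0, 1}" for n
    using jacobi_values[of m n] by auto
  show "real_of_int (jacobi m (n + m)) = real_of_int (jacobi m n)" for n
    using jacobi_cong[of "n + m" n m] by (simp add: unique_euclidean_semiring_class.cong_def)
  show "(\<Sum>n<m. real_of_int (jacobi m n)) = 0"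
    using sum_jacobi_period[OF assms] by (simp flip: of_int_sum)
qed simp

definition prime_mean :: "(nat \<Rightarrow> real) \<Rightarrow> nat \<Rightarrow> real" where
  "prime_mean w N = (\<Sum>n=1..N. if prime n then w n else 0) / real (prime_pi N)"

lemma filterlim_prime_pi: "filterlim (\<lambda>N. real (prime_pi N)) at_top sequentially"
proof (rule filterlim_at_top_mono)
  show "filterlim (\<lambda>N. real N / 2 / ln (real N)) at_top sequentially" by real_asymp
  show "\<forall>\<^sub>F N in sequentially. real N / 2 / ln (real N) \<le> real (prime_pi N)"
    using chebyshev_lower eventually_ge_at_top[of 2]
    by eventually_elim (auto simp: pos_divide_le_eq)
qed

lemma eventually_prime_pi_pos: "\<forall>\<^sub>F N in sequentially. real (prime_pi N) > 0"
  using filterlim_prime_pi unfolding filterlim_at_top_dense by (rule spec)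

lemma prime_mean_const: "prime_mean (\<lambda>_. c) \<longlonglongrightarrow> c"
proof (rule tendsto_eventually)
  show "\<forall>\<^sub>F N in sequentially. prime_mean (\<lambda>_. c) N = c"
    using eventually_prime_pi_pos
  proof eventually_elim
    case (elim N)
    have "(\<Sum>n=1..N. if prime n then c else 0) = c * real (prime_pi N)"
      unfolding prime_pi_eq_sum sum_distrib_left by (intro sum.cong) auto
    then show ?case using elim by (simp add: prime_mean_def)
  qed
qed

lemma prime_mean_add: "prime_mean (\<lambda>p. v p + w p) = (\<lambda>N. prime_mean v N + prime_mean w N)"
  unfolding fun_eq_iff prime_mean_def add_divide_distrib[symmetric] sum.distrib[symmetric]
  by (intro allI arg_cong2[where f = "(/)"] sum.cong) auto

lemma prime_mean_cmult: "prime_mean (\<lambda>p. c * w p) = (\<lambda>N. c * prime_mean w N)"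
  unfolding fun_eq_iff prime_mean_def times_divide_eq_right sum_distrib_left
  by (intro allI arg_cong2[where f = "(/)"] sum.cong) auto

lemma prime_mean_cong_almost_all:
  assumes v: "prime_mean v \<longlonglongrightarrow> l" and fin: "finite F" and eq: "\<And>p. prime p \<Longrightarrow> p \<notin> F \<Longrightarrow> v p = w p"
  shows "prime_mean w \<longlonglongrightarrow> l"
proof -
  define C where "C = (\<Sum>p\<in>F. \<bar>w p - v p\<bar>)"
  have "(\<lambda>N. prime_mean (\<lambda>p. w p - v p) N) \<longlonglongrightarrow> 0"
  proof (rule Lim_null_comparison)
    show "(\<lambda>N. C / real (prime_pi N)) \<longlonglongrightarrow> 0"
      by (rule tendsto_divide_0[OF tendsto_const filterlim_at_top_imp_at_infinity[OF filterlim_prime_pi]])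
    show "\<forall>\<^sub>F N in sequentially. norm (prime_mean (\<lambda>p. w p - v p) N) \<le> C / real (prime_pi N)"
    proof (intro always_eventually allI)
      fix N
      have "\<bar>\<Sum>n=1..N. if prime n then w n - v n else 0\<bar> \<le> (\<Sum>n=1..N. if n \<in> F then \<bar>w n - v n\<bar> else 0)"
        using eq by (intro order_trans[OF sum_abs sum_mono]) auto
      also have "\<dots> = (\<Sum>n\<in>{1..N} \<inter> F. \<bar>w n - v n\<bar>)" by (simp add: sum.inter_restrict)
      also have "\<dots> \<le> C" unfolding C_def by (intro sum_mono2 fin) auto
      finally show "norm (prime_mean (\<lambda>p. w p - v p) N) \<le> C / real (prime_pi N)"
        by (simp add: prime_mean_def divide_right_mono)
    qed
  qed
  then have "(\<lambda>N. prime_mean v N + prime_mean (\<lambda>p. w p - v p) N) \<longlonglongrightarrow> l + 0"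
    by (intro tendsto_add v)
  then show ?thesis by (simp flip: prime_mean_add)
qed

lemma finite_prime_divisors_int:
  assumes "M \<noteq> (0 :: int)"
  shows "finite {p :: nat. int p dvd M}"
proof (rule finite_subset)
  show "{p :: nat. int p dvd M} \<subseteq> {..nat \<bar>M\<bar>}"
  proof
    fix p assume "p \<in> {p :: nat. int p dvd M}"
    then have "int p \<le> \<bar>M\<bar>" using dvd_imp_le_int[OF assms, of "int p"] by simp
    then show "p \<in> {..nat \<bar>M\<bar>}" by simp
  qed
qed simp

lemma prime_mean_Legendre_nonsquare:
  assumes "[D = 1] (mod 4)" "\<not> is_square D"
  shows "prime_mean (\<lambda>p. real_of_int (Legendre D (int p))) \<longlonglongrightarrow> 0"
proof -
  have "odd D" using assms(1) by (metis cong_dvd_iff cong_dvd_modulus dvd_trans even_numeral odd_one unique_euclidean_semiring_class.cong_def dvd_mod_iff)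
  then have "odd (nat \<bar>D\<bar>)" by (simp add: even_nat_iff)
  then interpret real_character "nat \<bar>D\<bar>" "\<lambda>n. real_of_int (jacobi (nat \<bar>D\<bar>) n)"
    using nonsquare_abs[OF assms] by (intro real_character_jacobi)
  have "prime_mean (\<lambda>n. real_of_int (jacobi (nat \<bar>D\<bar>) n)) \<longlonglongrightarrow> 0"
    using prime_character_sum unfolding prime_mean_def .
  then show ?thesis
  proof (rule prime_mean_cong_almost_all[where F = "{2}"])
    fix p :: nat assume "prime p" "p \<notin> {2}"
    then have "p > 2" using prime_ge_2_nat[of p] by simp
    then show "real_of_int (jacobi (nat \<bar>D\<bar>) p) = real_of_int (Legendre D (int p))"
      using Legendre_eq_jacobi \<open>prime p\<close> assms(1) by simp
  qed simp
qed

lemma prime_mean_Legendre_square: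
  assumes "is_square D" "D \<noteq> 0"
  shows "prime_mean (\<lambda>p. real_of_int (Legendre D (int p))) \<longlonglongrightarrow> 1"
proof (rule prime_mean_cong_almost_all[OF prime_mean_const finite_prime_divisors_int[OF assms(2)]])
  fix p :: nat assume p: "prime p" "p \<notin> {p. int p dvd D}"
  obtain k where "D = k\<^sup>2" using assms(1) is_nth_powerE by blast
  then show "1 = real_of_int (Legendre D (int p))"
    using p by (auto simp: Legendre_def cong_0_iff QuadRes_def intro: exI[of _ k])
qed

text \<open>The limit is 1 or 0 according to whether \<open>D\<close> is a square; for symbols of
  positive weight its sign is all that matters.\<close>

lemma prime_mean_Legendre:
  assumes "[D = 1] (mod 4)"
  obtains l where "0 \<le> l" "prime_mean (\<lambda>p. real_of_int (Legendre D (int p))) \<longlonglongrightarrow> l"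
proof (cases "is_square D")
  case True
  have "D \<noteq> 0" using assms by (auto simp: unique_euclidean_semiring_class.cong_def)
  then show ?thesis using prime_mean_Legendre_square[OF True] that[of 1] by simp
next
  case False
  then show ?thesis using prime_mean_Legendre_nonsquare[OF assms] that[of 0] by simp
qed

lemma primes_real_le:
  assumes "x \<ge> 0"
  shows "{p :: nat. prime p \<and> real p \<le> x \<and> P p} = {p. prime p \<and> p \<le> nat \<lfloor>x\<rfloor> \<and> P p}"
  using assms by (auto simp: le_nat_floor) (metis of_nat_floor of_nat_le_iff order_trans)

lemma prime_density_via_floor:
  fixes S :: "nat set"
  defines "r \<equiv> (\<lambda>N. real (card {p. prime p \<and> p \<le> N \<and> p \<in> S}) / real (prime_pi N))"
  shows "\<forall>x\<ge>0. real (card {p. prime p \<and> real p \<le> x \<and> p \<in> S}) / real (card {p :: nat. prime p \<and> real p \<le> x})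
     = r (nat \<lfloor>x\<rfloor>)"
  using primes_real_le[of _ "\<lambda>p. p \<in> S"] primes_real_le[of _ "\<lambda>p. True"]
  by (simp add: r_def prime_pi_def)

lemma filterlim_nat_floor: "filterlim (\<lambda>x :: real. nat \<lfloor>x\<rfloor>) sequentially at_top"
  by (rule filterlim_compose[OF filterlim_nat_sequentially filterlim_floor_sequentially])

text \<open>The function \<open>w\<close> is meant to be the indicator of a success condition
  expanded into Legendre symbols, so that its mean can be read off term by term.\<close>

lemma prime_density_at_leastI:
  assumes w: "prime_mean w \<longlonglongrightarrow> l" and fin: "finite F"
    and le: "\<And>p. prime p \<Longrightarrow> p \<notin> F \<Longrightarrow> w p \<le> (if p \<in> S then 1 else 0)" and c: "c \<le> l"
  shows "prime_density_at_least S c"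
proof -
  define r where "r = (\<lambda>N. real (card {p. prime p \<and> p \<le> N \<and> p \<in> S}) / real (prime_pi N))"
  \<comment> \<open>Capping \<open>w\<close> at 0 on the finite set makes the bound hold at every
    prime without changing the mean.\<close>
  define v where "v = (\<lambda>p. if p \<in> F then min (w p) 0 else w p)"
  have v: "prime_mean v \<longlonglongrightarrow> l"
    by (rule prime_mean_cong_almost_all[OF w fin]) (auto simp: v_def)
  have vr: "prime_mean v N \<le> r N" for N
  proof -
    have "(\<Sum>n=1..N. if prime n then v n else 0) \<le> (\<Sum>n=1..N. if prime n \<and> n \<in> S then 1 else 0)"
    proof (rule sum_mono)
      fix n
      show "(if prime n then v n else 0) \<le> (if prime n \<and> n \<in> S then 1 else 0)"
        using le[of n] by (auto simp: v_def min_def split: if_splits)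
    qed
    also have "\<dots> = real (card {n \<in> {1..N}. prime n \<and> n \<in> S})"
      by (simp flip: sum.inter_filter)
    also have "{n \<in> {1..N}. prime n \<and> n \<in> S} = {p. prime p \<and> p \<le> N \<and> p \<in> S}" by (auto dest: prime_ge_1_nat)
    finally show ?thesis by (simp add: prime_mean_def r_def divide_right_mono)
  qed
  show ?thesis
    unfolding prime_density_at_least_def le_Liminf_iff
  proof (intro allI impI)
    fix y assume y: "y < ereal c"
    then obtain z where z: "y < ereal z" "z < c" using ereal_dense2 by (metis less_ereal.simps(1))
    then have "\<forall>\<^sub>F N in sequentially. z < prime_mean v N" 
      using c by (intro order_tendstoD(1)[OF v]) auto
    then have "\<forall>\<^sub>F N in sequentially. z < r N" by eventually_elim (use vr less_le_trans in blast)
    then have "\<forall>\<^sub>F x in at_top. z < r (nat \<lfloor>x :: real\<rfloor>)"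
      by (rule eventually_compose_filterlim[OF _ filterlim_nat_floor])
    then show "\<forall>\<^sub>F x in at_top. y < ereal (real (card {p. prime p \<and> real p \<le> x \<and> p \<in> S}) /
        real (card {p :: nat. prime p \<and> real p \<le> x}))"
      using eventually_ge_at_top[of "0 :: real"]
    proof eventually_elim
      case (elim x)
      then show ?case using prime_density_via_floor[of S] z(1) less_trans[OF z(1)] by (simp add: r_def)
    qed
  qed
qed

lemma prime_density_pos_imp_infinite:
  assumes "prime_density_at_least S c" "c > 0"
  shows "infinite S"
proof
  assume fin: "finite S"
  define r where "r = (\<lambda>N. real (card {p. prime p \<and> p \<le> N \<and> p \<in> S}) / real (prime_pi N))"
  have "r \<longlonglongrightarrow> 0"
  proof (rule Lim_null_comparison)
    show "(\<lambda>N. real (card S) / real (prime_pi N)) \<longlonglongrightarrow> 0"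
      by (rule tendsto_divide_0[OF tendsto_const filterlim_at_top_imp_at_infinity[OF filterlim_prime_pi]])
    show "\<forall>\<^sub>F N in sequentially. norm (r N) \<le> real (card S) / real (prime_pi N)"
      
      by (intro always_eventually allI) (auto simp: r_def intro!: divide_right_mono card_mono fin)
  qed
  then have "((\<lambda>x :: real. r (nat \<lfloor>x\<rfloor>)) \<longlongrightarrow> 0) at_top"
    by (rule filterlim_compose[OF _ filterlim_nat_floor])
  moreover have "\<forall>\<^sub>F x in at_top. r (nat \<lfloor>x :: real\<rfloor>) = real (card {p. prime p \<and> real p \<le> x \<and> p \<in> S}) /
      real (card {p :: nat. prime p \<and> real p \<le> x})"
    using eventually_ge_at_top[of "0 :: real"]
    by eventually_elim (use prime_density_via_floor[of S] in \<open>simp add: r_def\<close>)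
  ultimately have "((\<lambda>x. real (card {p. prime p \<and> real p \<le> x \<and> p \<in> S}) /
      real (card {p :: nat. prime p \<and> real p \<le> x})) \<longlongrightarrow> 0) at_top"
    by (rule Lim_transform_eventually)
  then have "((\<lambda>x. ereal (real (card {p. prime p \<and> real p \<le> x \<and> p \<in> S}) /
      real (card {p :: nat. prime p \<and> real p \<le> x}))) \<longlongrightarrow> ereal 0) at_top"
    by (simp only: lim_ereal)
  then have "Liminf at_top (\<lambda>x. ereal (real (card {p. prime p \<and> real p \<le> x \<and> p \<in> S}) /
      real (card {p :: nat. prime p \<and> real p \<le> x}))) = ereal 0"
    by (intro lim_imp_Liminf) auto
  then show False using assms by (simp add: prime_density_at_least_def)
qed

text \<open>Parity excludes integer roots, for the first polynomial after dividing by 4. Hence only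
  finitely many primes divide these values.\<close>

lemma odd_norm_factors:
  fixes \<kappa> :: int
  shows "\<kappa>\<^sup>2 - 6 * \<kappa> + 4 \<noteq> 0" "\<kappa>\<^sup>2 - 5 * \<kappa> + 5 \<noteq> 0" "\<kappa>\<^sup>2 - 13 * \<kappa> + 11 \<noteq> 0"
    "16 * \<kappa>\<^sup>2 - 68 * \<kappa> + 41 \<noteq> 0" "4 * \<kappa> - 7 \<noteq> 0"
proof -
  show "\<kappa>\<^sup>2 - 6 * \<kappa> + 4 \<noteq> 0"
  proof
    assume eq: "\<kappa>\<^sup>2 - 6 * \<kappa> + 4 = 0"
    have "even (\<kappa>\<^sup>2)"
    proof -
      have "\<kappa>\<^sup>2 = 2 * (3 * \<kappa> - 2)" using eq by simp
      then show ?thesis by (metis dvd_triv_left)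
    qed
    then have "even \<kappa>" by simp
    then obtain j where "\<kappa> = 2 * j" by auto
    then have "j\<^sup>2 - 3 * j + 1 = 0" using eq by (simp add: power2_eq_square)
    moreover have "even (j\<^sup>2 - 3 * j)" by simp
    ultimately show False by presburger
  qed
  have "even (\<kappa>\<^sup>2 - 5 * \<kappa>)" "even (\<kappa>\<^sup>2 - 13 * \<kappa>)" "even (16 * \<kappa>\<^sup>2 - 68 * \<kappa>)" by simp_all
  then show "\<kappa>\<^sup>2 - 5 * \<kappa> + 5 \<noteq> 0" "\<kappa>\<^sup>2 - 13 * \<kappa> + 11 \<noteq> 0" "16 * \<kappa>\<^sup>2 - 68 * \<kappa> + 41 \<noteq> 0"
    by presburger+
  show "4 * \<kappa> - 7 \<noteq> 0" by presburger
qed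

lemma not_square_5: "\<not> is_square (5 :: int)"
proof
  assume "is_square (5 :: int)"
  then obtain k :: int where k: "5 = k\<^sup>2" by (auto elim: is_nth_powerE)
  then have "\<bar>k\<bar>\<^sup>2 = 5" by simp
  moreover have "\<bar>k\<bar> \<le> 2 \<or> \<bar>k\<bar> \<ge> 3" by linarith
  ultimately show False
    using power_mono[of "\<bar>k\<bar>" 2 2] power_mono[of 3 "\<bar>k\<bar>" 2] by auto
qed

lemma not_square_neg: "x < 0 \<Longrightarrow> \<not> is_square (x :: int)"
  by (auto elim: is_nth_powerE)

text \<open>The weight (1 + A) / 2, with A the symbol of 4 \<kappa> - 7, is the indicator of A = 1
  at all but finitely many primes.\<close>

theorem K33_primes_density_half:
  assumes "\<kappa> \<noteq> 4" "\<kappa> \<noteq> 2"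
  shows "prime_density_at_least (K33_primes \<kappa>) (1 / 2)"
proof -
  let ?A = "\<lambda>p. real_of_int (Legendre (4 * \<kappa> - 7) (int p))"
  have "[4 * \<kappa> - 7 = 1] (mod 4)" by (simp add: cong_iff_dvd_diff)
  then obtain l where l: "0 \<le> l" "prime_mean ?A \<longlonglongrightarrow> l" using prime_mean_Legendre by blast
  have "(\<lambda>N. prime_mean (\<lambda>_. 1 / 2) N + (1 / 2) * prime_mean ?A N) \<longlonglongrightarrow> 1 / 2 + (1 / 2) * l"
    by (intro tendsto_intros prime_mean_const l)
  then have lim: "prime_mean (\<lambda>p. 1 / 2 + (1 / 2) * ?A p) \<longlonglongrightarrow> 1 / 2 + (1 / 2) * l"
    by (simp only: prime_mean_add prime_mean_cmult)
  let ?M = "(\<kappa> - 2) * (\<kappa> - 4) * (4 * \<kappa> - 7)"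
  show ?thesis
  proof (rule prime_density_at_leastI[OF lim])
    show "finite ({..3} \<union> {p :: nat. int p dvd ?M})"
      using assms odd_norm_factors by (intro finite_UnI finite_prime_divisors_int) auto
    fix p :: nat assume p: "prime p" "p \<notin> {..3} \<union> {p. int p dvd ?M}"
    then have nd: "p > 3" "\<not> int p dvd \<kappa> - 2" "\<not> int p dvd \<kappa> - 4" "\<not> int p dvd 4 * \<kappa> - 7" by auto
    consider "Legendre (4 * \<kappa> - 7) (int p) = 1" | "Legendre (4 * \<kappa> - 7) (int p) = -1"
      using Legendre_values[of "4 * \<kappa> - 7" "int p"] nd(4) Legendre_eq_0_iff[of "4 * \<kappa> - 7" "int p"] by auto
    then show "1 / 2 + (1 / 2) * ?A p \<le> (if p \<in> K33_primes \<kappa> then 1 else 0)"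
      using K33_primes_of_Legendre_triangle[OF p(1) nd(1)] nd(2,3) by cases auto
  qed (use l in auto)
qed

text \<open>At \<kappa> = 2 the norm of the discriminant is -31. The weight is (1 + C) (1 - B) / 4
  with C and B the symbols of 5 and -31, and -155 is their product.\<close>

theorem K33_primes_density_quarter: "prime_density_at_least (K33_primes 2) (1 / 4)"
proof -
  let ?L = "\<lambda>D p. real_of_int (Legendre D (int p))"
  have "prime_mean (?L 5) \<longlonglongrightarrow> 0" "prime_mean (?L (-31)) \<longlonglongrightarrow> 0" "prime_mean (?L (-155)) \<longlonglongrightarrow> 0"
    by (intro prime_mean_Legendre_nonsquare not_square_5 not_square_neg; simp add: unique_euclidean_semiring_class.cong_def)+
  then have "(\<lambda>N. prime_mean (\<lambda>_. 1 / 4) N + ((1 / 4) * prime_mean (?L 5) N + ((- 1 / 4) * prime_mean (?L (-31)) N +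
      (- 1 / 4) * prime_mean (?L (-155)) N))) \<longlonglongrightarrow> 1 / 4 + ((1 / 4) * 0 + ((- 1 / 4) * 0 + (- 1 / 4) * 0))"
    by (intro tendsto_intros prime_mean_const)
  then have lim: "prime_mean (\<lambda>p. 1 / 4 + ((1 / 4) * ?L 5 p + ((- 1 / 4) * ?L (-31) p + (- 1 / 4) * ?L (-155) p)))
      \<longlonglongrightarrow> 1 / 4 + ((1 / 4) * 0 + ((- 1 / 4) * 0 + (- 1 / 4) * 0))"
    by (simp only: prime_mean_add prime_mean_cmult)
  let ?M = "(2 - 4) * (2\<^sup>2 - 6 * 2 + 4) * (2\<^sup>2 - 5 * 2 + 5) * (2\<^sup>2 - 13 * 2 + 11) :: int"
  show ?thesis
  proof (rule prime_density_at_leastI[OF lim])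
    show "finite ({..3} \<union> {p :: nat. int p dvd ?M * 5 * (-31)})"
      by (intro finite_UnI finite_prime_divisors_int) auto
    fix p :: nat assume p: "prime p" "p \<notin> {..3} \<union> {p. int p dvd ?M * 5 * (-31)}"
    have nd: "p > 3" "\<not> int p dvd ?M * 5 * (-31)" using p(2) by auto
    then have nd': "\<not> int p dvd ?M" "\<not> int p dvd 5" "\<not> int p dvd -31"
      by (metis dvd_mult2 dvd_mult)+
    have mult: "Legendre (-155) (int p) = Legendre 5 (int p) * Legendre (-31) (int p)"
      using Legendre_mult[of p 5 "-31"] p(1) nd(1) by simp
    have v5: "Legendre 5 (int p) = 1 \<or> Legendre 5 (int p) = -1"
      using Legendre_values[of 5 "int p"] nd'(2) Legendre_eq_0_iff[of 5 "int p"] by auto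
    have v31: "Legendre (-31) (int p) = 1 \<or> Legendre (-31) (int p) = -1"
      using Legendre_values[of "-31" "int p"] nd'(3) Legendre_eq_0_iff[of "-31" "int p"] by auto
    have "p \<in> K33_primes 2" if "Legendre 5 (int p) = 1" "Legendre (-31) (int p) = -1"
      using K33_primes_of_Legendre_pentagon[of p 2, OF p(1) nd(1) that(1) _ nd'(1)] that(2) by simp
    then show "1 / 4 + ((1 / 4) * ?L 5 p + ((- 1 / 4) * ?L (-31) p + (- 1 / 4) * ?L (-155) p)) \<le>
        (if p \<in> K33_primes 2 then 1 else 0)"
      using v5 v31 unfolding mult by auto
  qed auto
qed

lemma not_square_mult_of_ratio:
  fixes a c :: int
  assumes "\<not> is_square (rat_of_int a / rat_of_int c)"
  shows "\<not> is_square (a * c)"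
proof
  assume "is_square (a * c)"
  then obtain k where k: "a * c = k\<^sup>2" using is_nth_powerE by blast
  have "rat_of_int a / rat_of_int c = (rat_of_int k / rat_of_int c)\<^sup>2"
  proof (cases "c = 0")
    case False
    have "(rat_of_int k)\<^sup>2 = rat_of_int a * rat_of_int c" using k by (metis of_int_mult of_int_power)
    then show ?thesis using False by (simp add: power_divide power2_eq_square)
  qed simp
  then show False using assms by simp
qed

text \<open>With A, B, C the symbols of \<open>a\<close>, \<open>b\<close>, 5, the weight expands (1
  + A) / 2 + (1 - A) (1 + C) (1 - B) / 8, the indicator of A = 1 or B = -1, C = 1. The products A B
  and A B C enter with positive sign, so for them a nonnegative mean suffices.\<close>

theorem K33_primes_density_generic:
  assumes \<kappa>4: "\<kappa> \<noteq> 4" and gen: "generic_kappa \<kappa>"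
  shows "prime_density_at_least (K33_primes \<kappa>) (5 / 8)"
proof -
  define a b :: int where "a = 4 * \<kappa> - 7" and "b = 16 * \<kappa>\<^sup>2 - 68 * \<kappa> + 41"
  have sq: "\<not> is_square a" "\<not> is_square b" "\<not> is_square (a * 5)" "\<not> is_square (b * 5)"
    using gen not_square_mult_of_ratio[of a 5] not_square_mult_of_ratio[of b 5]
    unfolding generic_kappa_def Let_def a_def b_def by simp_all
  have \<kappa>2: "\<kappa> \<noteq> 2" using sq(1) by (auto simp: a_def)
  have a1: "[a = 1] (mod 4)" unfolding a_def by (simp add: cong_iff_dvd_diff)
  have b1: "[b = 1] (mod 4)" unfolding b_def
  proof -
    have "16 * \<kappa>\<^sup>2 - 68 * \<kappa> + 41 - 1 = 4 * (4 * \<kappa>\<^sup>2 - 17 * \<kappa> + 10)" by simp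
    then show "[16 * \<kappa>\<^sup>2 - 68 * \<kappa> + 41 = 1] (mod 4)" by (metis cong_iff_dvd_diff dvd_triv_left)
  qed
  have c1: "[5 = 1 :: int] (mod 4)" by (simp add: unique_euclidean_semiring_class.cong_def)
  note m1 = cong_mult[OF a1 b1, simplified] cong_mult[OF a1 c1, simplified] cong_mult[OF b1 c1, simplified]
    cong_mult[OF cong_mult[OF a1 b1] c1, simplified]
  let ?L = "\<lambda>D p. real_of_int (Legendre D (int p))"
  obtain lab where lab: "0 \<le> lab" "prime_mean (?L (a * b)) \<longlonglongrightarrow> lab" using prime_mean_Legendre[OF m1(1)] .
  obtain labc where labc: "0 \<le> labc" "prime_mean (?L (a * b * 5)) \<longlonglongrightarrow> labc" using prime_mean_Legendre[OF m1(4)] .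
  note lims = prime_mean_Legendre_nonsquare[OF a1 sq(1)] prime_mean_Legendre_nonsquare[OF b1 sq(2)]
    prime_mean_Legendre_nonsquare[OF c1 not_square_5] prime_mean_Legendre_nonsquare[OF m1(2) sq(3)]
    prime_mean_Legendre_nonsquare[OF m1(3) sq(4)]
  have "(\<lambda>N. prime_mean (\<lambda>_. 5 / 8) N + ((3 / 8) * prime_mean (?L a) N + ((1 / 8) * prime_mean (?L 5) N +
    ((- 1 / 8) * prime_mean (?L b) N + ((- 1 / 8) * prime_mean (?L (b * 5)) N + ((- 1 / 8) * prime_mean (?L (a * 5)) N +
    ((1 / 8) * prime_mean (?L (a * b)) N + (1 / 8) * prime_mean (?L (a * b * 5)) N))))))) \<longlonglongrightarrow>
    5 / 8 + ((3 / 8) * 0 + ((1 / 8) * 0 + ((- 1 / 8) * 0 + ((- 1 / 8) * 0 + ((- 1 / 8) * 0 + ((1 / 8) * lab + (1 / 8) * labc))))))"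
    by (intro tendsto_add tendsto_mult tendsto_const prime_mean_const lims lab labc)
  then have lim: "prime_mean (\<lambda>p. 5 / 8 + ((3 / 8) * ?L a p + ((1 / 8) * ?L 5 p +
    ((- 1 / 8) * ?L b p + ((- 1 / 8) * ?L (b * 5) p + ((- 1 / 8) * ?L (a * 5) p +
    ((1 / 8) * ?L (a * b) p + (1 / 8) * ?L (a * b * 5) p))))))) \<longlonglongrightarrow>
    5 / 8 + ((3 / 8) * 0 + ((1 / 8) * 0 + ((- 1 / 8) * 0 + ((- 1 / 8) * 0 + ((- 1 / 8) * 0 + ((1 / 8) * lab + (1 / 8) * labc))))))"
    by (simp only: prime_mean_add prime_mean_cmult)
  let ?N = "(\<kappa> - 4) * (\<kappa>\<^sup>2 - 6 * \<kappa> + 4) * (\<kappa>\<^sup>2 - 5 * \<kappa> + 5) * (\<kappa>\<^sup>2 - 13 * \<kappa> + 11)"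
  let ?M = "?N * (\<kappa> - 2) * a * b * 5"
  show ?thesis
  proof (rule prime_density_at_leastI[OF lim])
    show "finite ({..3} \<union> {p :: nat. int p dvd ?M})"
      using \<kappa>4 \<kappa>2 odd_norm_factors unfolding a_def b_def
      by (intro finite_UnI finite_prime_divisors_int) auto
    fix p :: nat assume p: "prime p" "p \<notin> {..3} \<union> {p. int p dvd ?M}"
    have p3: "p > 3" and nM: "\<not> int p dvd ?M" using p(2) by auto
    have nd: "\<not> int p dvd ?N" "\<not> int p dvd \<kappa> - 2" "\<not> int p dvd a" "\<not> int p dvd b" "\<not> int p dvd 5"
      using nM by (metis dvd_mult2 dvd_mult)+
    have n4: "\<not> int p dvd \<kappa> - 4" using nd(1) by auto
    have p2: "p > 2" using p3 by simp
    have "Legendre D (int p) = 1 \<or> Legendre D (int p) = -1" if "\<not> int p dvd D" for D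
      using Legendre_values[of D "int p"] Legendre_eq_0_iff[of D "int p"] that by auto
    note v = this[OF nd(3)] this[OF nd(4)] this[OF nd(5)]
    have tri: "p \<in> K33_primes \<kappa>" if "Legendre a (int p) = 1"
      using K33_primes_of_Legendre_triangle[OF p(1) p3 _ nd(2) n4] that by (simp add: a_def)
    have pent: "p \<in> K33_primes \<kappa>" if "Legendre 5 (int p) = 1" "Legendre b (int p) = -1"
      using K33_primes_of_Legendre_pentagon[OF p(1) p3 that(1) _ nd(1)] that(2) by (simp add: b_def)
    show "5 / 8 + ((3 / 8) * ?L a p + ((1 / 8) * ?L 5 p +
      ((- 1 / 8) * ?L b p + ((- 1 / 8) * ?L (b * 5) p + ((- 1 / 8) * ?L (a * 5) p +
      ((1 / 8) * ?L (a * b) p + (1 / 8) * ?L (a * b * 5) p)))))) \<le> (if p \<in> K33_primes \<kappa> then 1 else 0)"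
      unfolding Legendre_mult[OF p(1) p2] using v tri pent by auto
  qed (use lab labc in auto)
qed

section \<open>Exceptional parameters\<close>

definition density_zero :: "int set \<Rightarrow> bool" where
  "density_zero B \<longleftrightarrow>
    ((\<lambda>x :: real. real (card {k \<in> B. \<bar>real_of_int k\<bar> \<le> x}) / real (card {k :: int. \<bar>real_of_int k\<bar> \<le> x}))
      \<longlongrightarrow> 0) at_top"

lemma abs_le_real_eq: "{k :: int. \<bar>real_of_int k\<bar> \<le> x} = {-\<lfloor>x\<rfloor>..\<lfloor>x\<rfloor>}"
  by (auto simp: abs_le_iff le_floor_iff) linarith+

lemma finite_abs_le_real [simp]: "finite {k :: int. \<bar>real_of_int k\<bar> \<le> x}"
  by (simp add: abs_le_real_eq)

lemma finite_Collect_abs_le_real [simp]: "finite {k \<in> B. \<bar>real_of_int k\<bar> \<le> x}"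
  by (rule finite_subset[OF _ finite_abs_le_real[of x]]) auto

lemma card_abs_le_real_ge:
  assumes "x \<ge> 1"
  shows "real (card {k :: int. \<bar>real_of_int k\<bar> \<le> x}) \<ge> x"
proof -
  have f: "\<lfloor>x\<rfloor> \<ge> 1"
    using assms by (simp add: le_floor_iff)
  hence "real (card {k :: int. \<bar>real_of_int k\<bar> \<le> x}) = 2 * real_of_int \<lfloor>x\<rfloor> + 1"
    by (simp add: abs_le_real_eq)
  with f show ?thesis
    by linarith
qed

lemma density_zero_mono:
  assumes "density_zero B" "A \<subseteq> B"
  shows "density_zero A"
  unfolding density_zero_def
proof (rule tendsto_sandwich[OF _ _ tendsto_const assms(1)[unfolded density_zero_def]])
  show "\<forall>\<^sub>F x in at_top. real (card {k \<in> A. \<bar>real_of_int k\<bar> \<le> x}) / real (card {k :: int. \<bar>real_of_int k\<bar> \<le> x})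
      \<le> real (card {k \<in> B. \<bar>real_of_int k\<bar> \<le> x}) / real (card {k :: int. \<bar>real_of_int k\<bar> \<le> x})"
    using assms(2) by (intro always_eventually allI divide_right_mono of_nat_mono card_mono) auto
qed auto

lemma density_zero_Un:
  assumes "density_zero A" "density_zero B"
  shows "density_zero (A \<union> B)"
  unfolding density_zero_def
proof (rule tendsto_sandwich[OF _ _ tendsto_const
    tendsto_add_zero[OF assms[unfolded density_zero_def]]])
  show "\<forall>\<^sub>F x in at_top. real (card {k \<in> A \<union> B. \<bar>real_of_int k\<bar> \<le> x}) / real (card {k :: int. \<bar>real_of_int k\<bar> \<le> x})
      \<le> real (card {k \<in> A. \<bar>real_of_int k\<bar> \<le> x}) / real (card {k :: int. \<bar>real_of_int k\<bar> \<le> x})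
        + real (card {k \<in> B. \<bar>real_of_int k\<bar> \<le> x}) / real (card {k :: int. \<bar>real_of_int k\<bar> \<le> x})"
  proof (intro always_eventually allI)
    fix x :: real
    have "{k \<in> A \<union> B. \<bar>real_of_int k\<bar> \<le> x} = {k \<in> A. \<bar>real_of_int k\<bar> \<le> x} \<union> {k \<in> B. \<bar>real_of_int k\<bar> \<le> x}"
      by auto
    hence "card {k \<in> A \<union> B. \<bar>real_of_int k\<bar> \<le> x}
        \<le> card {k \<in> A. \<bar>real_of_int k\<bar> \<le> x} + card {k \<in> B. \<bar>real_of_int k\<bar> \<le> x}"
      by (simp add: card_Un_le)
    hence "real (card {k \<in> A \<union> B. \<bar>real_of_int k\<bar> \<le> x})
        \<le> real (card {k \<in> A. \<bar>real_of_int k\<bar> \<le> x}) + real (card {k \<in> B. \<bar>real_of_int k\<bar> \<le> x})"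
      by linarith
    thus "real (card {k \<in> A \<union> B. \<bar>real_of_int k\<bar> \<le> x}) / real (card {k :: int. \<bar>real_of_int k\<bar> \<le> x})
      \<le> real (card {k \<in> A. \<bar>real_of_int k\<bar> \<le> x}) / real (card {k :: int. \<bar>real_of_int k\<bar> \<le> x})
        + real (card {k \<in> B. \<bar>real_of_int k\<bar> \<le> x}) / real (card {k :: int. \<bar>real_of_int k\<bar> \<le> x})"
      by (simp add: divide_right_mono flip: add_divide_distrib)
  qed
qed auto

text \<open>The members of absolute value at most x inject into the numbers up to a multiple of sqrt
  (x + 1).\<close>

lemma density_zero_if_inj_sqrt:
  fixes f :: "int \<Rightarrow> nat"
  assumes inj: "inj_on f B" and f: "\<And>k. k \<in> B \<Longrightarrow> int ((f k)\<^sup>2) \<le> C * (\<bar>k\<bar> + 1)"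
  shows "density_zero B"
proof -
  define D where "D = real_of_int (max C 0)"
  have bound: "real (card {k \<in> B. \<bar>real_of_int k\<bar> \<le> x}) / real (card {k :: int. \<bar>real_of_int k\<bar> \<le> x})
      \<le> (sqrt (D * (x + 1)) + 1) / x" if x: "x \<ge> 1" for x
  proof -
    define n where "n = nat \<lfloor>sqrt (D * (x + 1))\<rfloor>"
    have D: "D \<ge> 0"
      by (simp add: D_def)
    have "f ` {k \<in> B. \<bar>real_of_int k\<bar> \<le> x} \<subseteq> {..n}"
    proof
      fix y assume "y \<in> f ` {k \<in> B. \<bar>real_of_int k\<bar> \<le> x}"
      then obtain k where k: "k \<in> B" "\<bar>real_of_int k\<bar> \<le> x" "y = f k"
        by auto
      have "real_of_int (int ((f k)\<^sup>2)) \<le> real_of_int (C * (\<bar>k\<bar> + 1))"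
        using f[OF k(1)] by (simp only: of_int_le_iff)
      hence "(real y)\<^sup>2 \<le> real_of_int C * (\<bar>real_of_int k\<bar> + 1)"
        by (simp add: k)
      also have "\<dots> \<le> D * (\<bar>real_of_int k\<bar> + 1)"
        by (intro mult_right_mono) (auto simp: D_def)
      also have "\<dots> \<le> D * (x + 1)"
        using k(2) D by (intro mult_left_mono) auto
      finally have "real y \<le> sqrt (D * (x + 1))"
        by (simp add: real_le_rsqrt)
      thus "y \<in> {..n}"
        by (simp add: n_def le_nat_floor)
    qed
    hence "card (f ` {k \<in> B. \<bar>real_of_int k\<bar> \<le> x}) \<le> n + 1"
      using card_mono[of "{..n}"] by fastforce
    moreover have "card (f ` {k \<in> B. \<bar>real_of_int k\<bar> \<le> x}) = card {k \<in> B. \<bar>real_of_int k\<bar> \<le> x}"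
      using inj by (intro card_image) (auto simp: inj_on_def)
    ultimately have "real (card {k \<in> B. \<bar>real_of_int k\<bar> \<le> x}) \<le> real n + 1"
      by linarith
    also have "\<dots> \<le> sqrt (D * (x + 1)) + 1"
      using D x by (simp add: n_def)
    finally show ?thesis
      using card_abs_le_real_ge[OF x] D x by (intro frac_le) auto
  qed
  have lim: "((\<lambda>x. (sqrt (D * (x + 1)) + 1) / x) \<longlongrightarrow> 0) at_top"
  proof -
    have "((\<lambda>x :: real. sqrt (x + 1) / x) \<longlongrightarrow> 0) at_top" "((\<lambda>x :: real. 1 / x) \<longlongrightarrow> 0) at_top"
      by real_asymp+
    hence "((\<lambda>x. sqrt D * (sqrt (x + 1) / x) + 1 / x) \<longlongrightarrow> sqrt D * 0 + 0) at_top"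
      by (intro tendsto_add tendsto_mult tendsto_const)
    thus ?thesis
      by (simp add: real_sqrt_mult add_divide_distrib)
  qed
  show ?thesis
    unfolding density_zero_def
  proof (rule tendsto_sandwich[OF _ _ tendsto_const lim])
    show "\<forall>\<^sub>F x in at_top. real (card {k \<in> B. \<bar>real_of_int k\<bar> \<le> x}) / real (card {k :: int. \<bar>real_of_int k\<bar> \<le> x})
        \<le> (sqrt (D * (x + 1)) + 1) / x"
      using bound by (rule eventually_mono[OF eventually_ge_at_top])
  qed simp
qed

text \<open>The zigzag numbering of the integers is injective, and on a finite set its squares are
  bounded by a constant.\<close>

lemma density_zero_finite:
  assumes "finite (B :: int set)"
  shows "density_zero B"
proof -
  define C where "C = Max (insert 0 ((\<lambda>k. k\<^sup>2) ` B)) + 1"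
  define f :: "int \<Rightarrow> nat" where "f k = nat (if k \<ge> 0 then 2 * k else - 2 * k - 1)" for k
  have "inj_on f B"
  proof (rule inj_onI)
    fix j k assume "f j = f k"
    then have "(if j \<ge> 0 then 2 * j else - 2 * j - 1) = (if k \<ge> 0 then 2 * k else - 2 * k - 1)"
      unfolding f_def by (auto split: if_splits)
    then show "j = k"
      by (auto split: if_splits; presburger)
  qed
  moreover have "int ((f k)\<^sup>2) \<le> 4 * C * (\<bar>k\<bar> + 1)" if "k \<in> B" for k
  proof -
    have "k\<^sup>2 \<le> C"
    proof -
      have "k\<^sup>2 \<le> Max (insert 0 ((\<lambda>k. k\<^sup>2) ` B))"
        using assms that by (intro Max_ge) auto
      thus ?thesis
        by (simp add: C_def)
    qed
    moreover have "int (f k) \<le> 2 * \<bar>k\<bar>"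
      by (simp add: f_def)
    hence "(int (f k))\<^sup>2 \<le> (2 * \<bar>k\<bar>)\<^sup>2"
      by (intro power_mono) auto
    ultimately have 1: "int ((f k)\<^sup>2) \<le> 4 * C"
      by (simp add: power_mult_distrib)
    moreover have "C \<ge> 0"
      using \<open>k\<^sup>2 \<le> C\<close> by (meson order_trans zero_le_power2)
    hence "4 * C * 1 \<le> 4 * C * (\<bar>k\<bar> + 1)"
      by (intro mult_left_mono) auto
    ultimately show ?thesis
      by linarith
  qed
  ultimately show ?thesis
    by (rule density_zero_if_inj_sqrt)
qed

lemma int_density_oneI:
  assumes "density_zero (- A)"
  shows "int_density_one A"
  unfolding int_density_one_def
proof (rule Lim_transform_eventually)
  show "((\<lambda>x. 1 - real (card {k \<in> - A. \<bar>real_of_int k\<bar> \<le> x}) / real (card {k :: int. \<bar>real_of_int k\<bar> \<le> x}))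
      \<longlongrightarrow> 1) at_top"
    using tendsto_diff[OF tendsto_const assms[unfolded density_zero_def], of 1] by simp
  show "\<forall>\<^sub>F x in at_top. 1 - real (card {k \<in> - A. \<bar>real_of_int k\<bar> \<le> x}) / real (card {k :: int. \<bar>real_of_int k\<bar> \<le> x})
      = real (card {k \<in> A. \<bar>real_of_int k\<bar> \<le> x}) / real (card {k :: int. \<bar>real_of_int k\<bar> \<le> x})"
  proof (rule eventually_mono[OF eventually_ge_at_top[of "1 :: real"]])
    fix x :: real assume x: "1 \<le> x"
    have "card {k :: int. \<bar>real_of_int k\<bar> \<le> x}
        = card ({k \<in> A. \<bar>real_of_int k\<bar> \<le> x} \<union> {k \<in> - A. \<bar>real_of_int k\<bar> \<le> x})"
      by (rule arg_cong[of _ _ card]) auto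
    also have "\<dots> = card {k \<in> A. \<bar>real_of_int k\<bar> \<le> x} + card {k \<in> - A. \<bar>real_of_int k\<bar> \<le> x}"
      by (rule card_Un_disjoint) auto
    finally have "real (card {k :: int. \<bar>real_of_int k\<bar> \<le> x})
        = real (card {k \<in> A. \<bar>real_of_int k\<bar> \<le> x}) + real (card {k \<in> - A. \<bar>real_of_int k\<bar> \<le> x})"
      by simp
    moreover have "real (card {k :: int. \<bar>real_of_int k\<bar> \<le> x}) > 0"
      using card_abs_le_real_ge[OF x] x by linarith
    ultimately show "1 - real (card {k \<in> - A. \<bar>real_of_int k\<bar> \<le> x}) / real (card {k :: int. \<bar>real_of_int k\<bar> \<le> x})
      = real (card {k \<in> A. \<bar>real_of_int k\<bar> \<le> x}) / real (card {k :: int. \<bar>real_of_int k\<bar> \<le> x})"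
      by (simp add: field_simps)
  qed
qed

section \<open>Squares, gcd arguments and a Pell equation\<close>

lemma is_square_mult_of_ratio:
  fixes a b :: int
  assumes "is_square (rat_of_int a / rat_of_int b)" "b \<noteq> 0"
  shows "is_square (a * b)"
proof -
  obtain q where q: "rat_of_int a / rat_of_int b = q\<^sup>2"
    using assms(1) by (elim is_nth_powerE)
  obtain n d where nd: "quotient_of q = (n, d)"
    by fastforce
  have d: "d > 0" "q = rat_of_int n / rat_of_int d"
    using quotient_of_denom_pos[OF nd] quotient_of_div[OF nd] by auto
  have "rat_of_int a * rat_of_int d ^ 2 = rat_of_int b * rat_of_int n ^ 2"
    using q assms(2) d by (simp add: field_simps)
  hence "a * d\<^sup>2 = b * n\<^sup>2"
    by (metis (no_types, lifting) of_int_eq_iff of_int_mult of_int_power)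
  hence eq: "a * b * d\<^sup>2 = (b * n)\<^sup>2"
    by (simp add: power2_eq_square algebra_simps)
  hence "d\<^sup>2 dvd (b * n)\<^sup>2"
    by (metis dvd_triv_right)
  hence "d dvd b * n"
    by simp
  then obtain e where "b * n = d * e" ..
  with eq have "a * b * d\<^sup>2 = e\<^sup>2 * d\<^sup>2"
    by (simp add: power_mult_distrib)
  hence "a * b = e\<^sup>2"
    using d(1) by simp
  thus ?thesis
    by simp
qed

lemma square_of_coprime_mult:
  fixes a b :: int
  assumes "is_square (a * b)" "coprime a b"
  shows "is_square \<bar>a\<bar>"
proof -
  obtain t where t: "a * b = t\<^sup>2"
    using assms(1) by (elim is_nth_powerE)
  hence "nat \<bar>a\<bar> * nat \<bar>b\<bar> = (nat \<bar>t\<bar>)\<^sup>2"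
    by (metis abs_mult abs_power2 nat_abs_mult_distrib nat_power_eq abs_ge_zero power2_abs)
  moreover have "coprime (nat \<bar>a\<bar>) (nat \<bar>b\<bar>)"
    using assms(2) by simp
  ultimately have "is_square (nat \<bar>a\<bar>)"
    using is_nth_power_mult_coprime_nat_iff is_nth_power_nth_power by metis
  then obtain s where "nat \<bar>a\<bar> = s\<^sup>2"
    by (elim is_nth_powerE)
  hence "\<bar>a\<bar> = (int s)\<^sup>2"
    by (metis abs_ge_zero int_nat_eq of_nat_power)
  thus ?thesis
    by simp
qed

lemma density_zero_linear_square:
  assumes "g \<noteq> 0"
  shows "density_zero {k :: int. \<exists>s. 4 * k - 7 = g * s\<^sup>2}" (is "density_zero ?B")
proof -
  have "\<exists>s. 4 * k - 7 = g * (int s)\<^sup>2" if "k \<in> ?B" for k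
  proof -
    from that obtain s where "4 * k - 7 = g * s\<^sup>2"
      by blast
    then have "4 * k - 7 = g * (int (nat \<bar>s\<bar>))\<^sup>2"
      by simp
    then show ?thesis ..
  qed
  then obtain f where f: "\<And>k. k \<in> ?B \<Longrightarrow> 4 * k - 7 = g * (int (f k))\<^sup>2"
    by metis
  show ?thesis
  proof (rule density_zero_if_inj_sqrt)
    show "inj_on f ?B"
    proof (rule inj_onI)
      fix j k assume "j \<in> ?B" "k \<in> ?B" "f j = f k"
      with f[of j] f[of k] show "j = k"
        by simp
    qed
    show "int ((f k)\<^sup>2) \<le> 7 * (\<bar>k\<bar> + 1)" if "k \<in> ?B" for k
    proof -
      have "1 * (int (f k))\<^sup>2 \<le> \<bar>g\<bar> * (int (f k))\<^sup>2"
        using assms by (intro mult_right_mono) auto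
      also have "\<dots> = \<bar>4 * k - 7\<bar>"
        unfolding f[OF that] by (simp add: abs_mult)
      also have "\<dots> \<le> 7 * (\<bar>k\<bar> + 1)"
        by (auto simp: abs_if)
      finally show ?thesis
        by simp
    qed
  qed
qed

text \<open>The product (m Y' - m' Y) (m Y' + m' Y) equals m'^2 - m^2. Its first factor is a
  positive integer and its second is at least 4 m m' because Y \<ge> 2 m, so 4 m m' \<le>
  m'^2.\<close>

lemma pell_gap:
  fixes m m' Y Y' :: int
  assumes "0 < m" "m < m'" "0 \<le> Y" "0 \<le> Y'" "5 * m\<^sup>2 = Y\<^sup>2 + 1" "5 * m'\<^sup>2 = Y'\<^sup>2 + 1"
  shows "4 * m \<le> m'"
proof -
  have Y: "2 * m \<le> Y" "2 * m' \<le> Y'"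
  proof -
    have "(2 * m)\<^sup>2 \<le> Y\<^sup>2" "(2 * m')\<^sup>2 \<le> Y'\<^sup>2"
    proof -
      have "1 \<le> m\<^sup>2" "1 \<le> m'\<^sup>2"
        using assms(1,2) by (auto intro: one_le_power)
      thus "(2 * m)\<^sup>2 \<le> Y\<^sup>2" "(2 * m')\<^sup>2 \<le> Y'\<^sup>2"
        using assms(5,6) unfolding power_mult_distrib by simp_all
    qed
    thus "2 * m \<le> Y" "2 * m' \<le> Y'"
      using assms by (auto intro: power2_le_imp_le)
  qed
  have "m\<^sup>2 < m'\<^sup>2"
    using assms by (intro power_strict_mono) auto
  have eq: "(m * Y' - m' * Y) * (m * Y' + m' * Y) = m'\<^sup>2 - m\<^sup>2"
  proof -
    have "(m * Y' - m' * Y) * (m * Y' + m' * Y) = m\<^sup>2 * (Y'\<^sup>2 + 1) - m'\<^sup>2 * (Y\<^sup>2 + 1) + m'\<^sup>2 - m\<^sup>2"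
      by (simp add: power2_eq_square algebra_simps)
    thus ?thesis
      by (simp flip: assms(5,6))
  qed
  have "m * (2 * m') \<le> m * Y'" "m' * (2 * m) \<le> m' * Y"
    using Y assms(1,2) by (auto intro!: mult_left_mono)
  hence sum: "4 * m * m' \<le> m * Y' + m' * Y"
    by (simp add: mult_ac)
  moreover have mm: "0 < m * m'"
    using assms(1,2) by simp
  ultimately have pos: "0 < m * Y' + m' * Y"
    by linarith
  hence "0 < m * Y' - m' * Y"
    using eq \<open>m\<^sup>2 < m'\<^sup>2\<close> by (metis diff_gt_0_iff_gt zero_less_mult_pos2)
  hence "1 * (m * Y' + m' * Y) \<le> (m * Y' - m' * Y) * (m * Y' + m' * Y)"
    using pos by (intro mult_right_mono) auto
  hence "m * Y' + m' * Y \<le> m'\<^sup>2 - m\<^sup>2"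
    by (simp only: eq mult_1)
  with sum have "4 * m * m' \<le> m'\<^sup>2 - m\<^sup>2"
    by (rule order_trans)
  also have "\<dots> \<le> m' * m'"
    by (simp add: power2_eq_square)
  finally have "4 * m * m' \<le> m' * m'" .
  thus ?thesis
    using assms(1,2) by simp
qed

text \<open>Solutions grow by a factor of at least 4, so their square roots at least double and
  differ after rounding down. The constant 17 comes from 25 m = |8 k - 17|.\<close>

lemma density_zero_pell:
  assumes "c \<in> {1, -1 :: int}"
  shows "density_zero {k :: int. \<exists>m>0. 8 * k - 17 = 25 * c * m \<and> is_square (5 * m\<^sup>2 - 1)}"
    (is "density_zero ?B")
proof -
  obtain f where f: "\<And>k. k \<in> ?B \<Longrightarrow> f k > 0 \<and> 8 * k - 17 = 25 * c * f k \<and> is_square (5 * (f k)\<^sup>2 - 1)"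
    using bchoice[of ?B "\<lambda>k m. m > 0 \<and> 8 * k - 17 = 25 * c * m \<and> is_square (5 * m\<^sup>2 - 1)"]
    by blast
  have gap: "4 * f j \<le> f k" if jk: "j \<in> ?B" "k \<in> ?B" "f j < f k" for j k
  proof -
    obtain Y Y' where "5 * (f j)\<^sup>2 - 1 = Y\<^sup>2" "5 * (f k)\<^sup>2 - 1 = Y'\<^sup>2"
      using f[OF jk(1)] f[OF jk(2)] by (metis is_nth_powerE)
    thus ?thesis
      using pell_gap[of "f j" "f k" "\<bar>Y\<bar>" "\<bar>Y'\<bar>"] f[OF jk(1)] jk(3) by simp
  qed
  show ?thesis
  proof (rule density_zero_if_inj_sqrt)
    have less: "floor_sqrt (nat (f j)) < floor_sqrt (nat (f k))"
      if jk: "j \<in> ?B" "k \<in> ?B" "f j < f k" for j k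
    proof -
      define r where "r = floor_sqrt (nat (f j))"
      have "r\<^sup>2 \<le> nat (f j)"
        by (simp add: r_def)
      moreover have "r > 0"
        using f[OF jk(1)] by (simp add: r_def)
      hence "(r + 1)\<^sup>2 \<le> (2 * r)\<^sup>2"
        by (intro power_mono) auto
      moreover have "4 * nat (f j) \<le> nat (f k)"
        using gap[OF jk] by linarith
      ultimately have "(r + 1)\<^sup>2 \<le> nat (f k)"
        by (simp add: power_mult_distrib)
      hence "r + 1 \<le> floor_sqrt (nat (f k))"
        by (simp add: le_floor_sqrt_iff)
      thus ?thesis
        by (simp add: r_def)
    qed
    show "inj_on (\<lambda>k. floor_sqrt (nat (f k))) ?B"
    proof (rule inj_onI)
      fix j k assume jk: "j \<in> ?B" "k \<in> ?B" "floor_sqrt (nat (f j)) = floor_sqrt (nat (f k))"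
      have "f j = f k"
        using less[OF jk(1,2)] less[OF jk(2,1)] jk(3) by (cases "f j" "f k" rule: linorder_cases) auto
      thus "j = k"
        using f[OF jk(1)] f[OF jk(2)] by simp
    qed
    show "int ((floor_sqrt (nat (f k)))\<^sup>2) \<le> 17 * (\<bar>k\<bar> + 1)" if "k \<in> ?B" for k
    proof -
      have "int ((floor_sqrt (nat (f k)))\<^sup>2) \<le> int (nat (f k))"
        by (simp only: of_nat_le_iff floor_sqrt_power2_le)
      also have "\<dots> = f k"
        using f[OF that] by simp
      also have "\<dots> \<le> 17 * (\<bar>k\<bar> + 1)"
        using f[OF that] assms by auto
      finally show ?thesis .
    qed
  qed
qed

text \<open>Completing the square gives (8 k - 17)^2 - 4 t^2 = 125, which factors into two integers
  and bounds both.\<close>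

lemma finite_quadratic_square: "finite {k :: int. is_square (16 * k\<^sup>2 - 68 * k + 41)}"
proof (rule finite_subset)
  show "{k :: int. is_square (16 * k\<^sup>2 - 68 * k + 41)} \<subseteq> {-100..100}"
  proof
    fix k :: int assume "k \<in> {k. is_square (16 * k\<^sup>2 - 68 * k + 41)}"
    then obtain t where t: "16 * k\<^sup>2 - 68 * k + 41 = t\<^sup>2"
      by (auto elim: is_nth_powerE)
    define u where "u = \<bar>t\<bar>"
    define m where "m = \<bar>8 * k - 17\<bar>"
    have "m\<^sup>2 = (8 * k - 17)\<^sup>2"
      by (simp add: m_def)
    hence eq: "(m - 2 * u) * (m + 2 * u) = 125"
      using t by (simp add: u_def power2_eq_square algebra_simps)
    have "u \<ge> 0" "m > 0"
      unfolding u_def m_def by presburger+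
    hence pos: "0 < m + 2 * u"
      by simp
    hence "0 < m - 2 * u"
      using eq by (metis zero_less_mult_pos2 zero_less_numeral)
    hence "1 * (m + 2 * u) \<le> (m - 2 * u) * (m + 2 * u)"
      using pos by (intro mult_right_mono) auto
    hence "m \<le> 125"
      using eq \<open>u \<ge> 0\<close> by simp
    thus "k \<in> {-100..100}"
      by (auto simp: m_def)
  qed
qed simp

text \<open>The gcd of the two factors divides 29. If it is 1, \<open>a\<close> is a square up to
  sign; otherwise 29 is taken out of both factors and the cofactors are coprime.\<close>

lemma linear_square_of_product:
  fixes a :: int
  assumes "is_square (a * (a\<^sup>2 - 3 * a - 29))"
  shows "\<exists>s. a = 1 * s\<^sup>2 \<or> a = -1 * s\<^sup>2 \<or> a = 29 * s\<^sup>2 \<or> a = -29 * s\<^sup>2"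
proof (cases "a = 0")
  case False
  define b where "b = a\<^sup>2 - 3 * a - 29"
  have gcd: "gcd a b = gcd a 29"
  proof -
    have "b = -29 + (a - 3) * a"
      by (simp add: b_def power2_eq_square algebra_simps)
    thus ?thesis
      by (metis gcd_add_mult gcd_neg2 add.commute gcd.commute)
  qed
  have "prime (29 :: int)"
    by (simp add: prime_int_numeral_eq)
  show ?thesis
  proof (cases "29 dvd a")
    case False
    hence "coprime a b"
      using \<open>prime 29\<close> gcd by (metis coprime_commute coprime_iff_gcd_eq_1 prime_imp_coprime)
    hence "is_square \<bar>a\<bar>"
      using assms by (intro square_of_coprime_mult) (auto simp: b_def)
    then obtain s where "\<bar>a\<bar> = s\<^sup>2"
      by (elim is_nth_powerE)
    hence "a = 1 * s\<^sup>2 \<or> a = -1 * s\<^sup>2"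
      by linarith
    thus ?thesis
      by blast
  next
    case True
    then obtain a' where a': "a = 29 * a'"
      by (elim dvdE)
    define b' where "b' = 29 * a'\<^sup>2 - 3 * a' - 1"
    have b: "b = 29 * b'"
      by (simp add: b_def b'_def a' power2_eq_square algebra_simps)
    have "coprime a' b'"
    proof -
      have "b' = -1 + (29 * a' - 3) * a'"
        by (simp add: b'_def power2_eq_square algebra_simps)
      hence "gcd a' b' = gcd a' (-1)"
        by (metis gcd_add_mult add.commute)
      thus ?thesis
        by (simp add: coprime_iff_gcd_eq_1)
    qed
    moreover have "is_square (a' * b')"
    proof -
      obtain t where t: "a * b = t\<^sup>2"
        using assms by (auto simp: b_def elim: is_nth_powerE)
      hence "29\<^sup>2 * (a' * b') = t\<^sup>2"
        by (simp add: a' b)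
      moreover from this have "29\<^sup>2 dvd t\<^sup>2"
        by (metis dvd_triv_left)
      hence "29 dvd t"
        by (simp only: pow_divides_pow_iff zero_less_numeral)
      then obtain t' where "t = 29 * t'" ..
      ultimately have "a' * b' = t'\<^sup>2"
        by (simp add: power_mult_distrib)
      thus ?thesis
        by simp
    qed
    ultimately have "is_square \<bar>a'\<bar>"
      by (rule square_of_coprime_mult[rotated])
    then obtain s where "\<bar>a'\<bar> = s\<^sup>2"
      by (elim is_nth_powerE)
    hence "a = 29 * s\<^sup>2 \<or> a = -29 * s\<^sup>2"
      using a' by linarith
    thus ?thesis
      by blast
  qed
qed (auto intro: exI[of _ 0])

lemma prime_5_int: "prime (5 :: int)"
  by (simp add: prime_int_numeral_eq)

text \<open>With n = 8 k - 17 the hypothesis reads 5 (n^2 - 125) = 4 t^2. Alternate divisions by 5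
  give n = 25 \<open>n2\<close> and t = 25 \<open>t2\<close>, and what remains is 5
  \<open>n2\<close>^2 - 1 = (2 \<open>t2\<close>)^2.\<close>

lemma pell_of_quadratic_square:
  fixes k :: int
  assumes "is_square ((16 * k\<^sup>2 - 68 * k + 41) * 5)"
  shows "\<exists>c\<in>{1, -1}. \<exists>m>0. 8 * k - 17 = 25 * c * m \<and> is_square (5 * m\<^sup>2 - 1)"
proof -
  obtain t where t: "(16 * k\<^sup>2 - 68 * k + 41) * 5 = t\<^sup>2"
    using assms by (elim is_nth_powerE)
  define n where "n = 8 * k - 17"
  have eq: "5 * (n\<^sup>2 - 125) = 4 * t\<^sup>2"
    using t by (simp add: n_def power2_eq_square algebra_simps)
  have five: "5 dvd x" if "5 dvd 4 * x\<^sup>2" for x :: int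
  proof -
    have "5 dvd x\<^sup>2"
      using that by presburger
    thus ?thesis
      using prime_5_int prime_dvd_power by blast
  qed
  have "5 dvd 4 * t\<^sup>2"
    unfolding eq[symmetric] by simp
  hence "5 dvd t"
    by (rule five)
  then obtain t1 where t1: "t = 5 * t1" ..
  hence eq1: "n\<^sup>2 = 5 * (25 + 4 * t1\<^sup>2)"
    using eq by (simp add: power2_eq_square)
  hence "5 dvd n"
    using prime_5_int by (metis dvd_triv_left prime_dvd_power)
  then obtain n1 where n1: "n = 5 * n1" ..
  hence eq2: "5 * n1\<^sup>2 = 25 + 4 * t1\<^sup>2"
    using eq1 by (simp add: power2_eq_square)
  hence "5 dvd 4 * t1\<^sup>2"
    by presburger
  hence "5 dvd t1"
    by (rule five)
  then obtain t2 where t2: "t1 = 5 * t2" ..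
  hence eq3: "n1\<^sup>2 = 5 * (1 + 4 * t2\<^sup>2)"
    using eq2 by (simp add: power2_eq_square)
  hence "5 dvd n1"
    using prime_5_int by (metis dvd_triv_left prime_dvd_power)
  then obtain n2 where n2: "n1 = 5 * n2" ..
  hence "5 * n2\<^sup>2 - 1 = (2 * t2)\<^sup>2"
    using eq3 by (simp add: power2_eq_square)
  hence "is_square (5 * \<bar>n2\<bar>\<^sup>2 - 1)"
    by (metis is_nth_power_nth_power power2_abs)
  moreover have "n1 \<noteq> 0"
  proof
    assume "n1 = 0"
    with eq3 have "5 + 20 * t2\<^sup>2 = 0"
      by simp
    with zero_le_power2[of t2] show False
      by linarith
  qed
  hence "n2 \<noteq> 0"
    by (simp add: n2)
  moreover have "8 * k - 17 = 25 * sgn n2 * \<bar>n2\<bar>"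
    using n1 n2 by (simp add: n_def mult_sgn_abs mult.assoc)
  moreover have "sgn n2 \<in> {1, -1}"
    using \<open>n2 \<noteq> 0\<close> by (auto simp: sgn_if)
  ultimately show ?thesis
    by (metis zero_less_abs_iff)
qed

theorem int_density_one_generic_kappa: "int_density_one {\<kappa>. \<kappa> \<noteq> 4 \<and> generic_kappa \<kappa>}"
proof (rule int_density_oneI, rule density_zero_mono)
  let ?L = "\<lambda>g. {k :: int. \<exists>s. 4 * k - 7 = g * s\<^sup>2}"
  let ?P = "\<lambda>c. {k :: int. \<exists>m>0. 8 * k - 17 = 25 * c * m \<and> is_square (5 * m\<^sup>2 - 1)}"
  let ?Q = "{k :: int. is_square (16 * k\<^sup>2 - 68 * k + 41)}"
  let ?B = "{4} \<union> ?L 1 \<union> ?L (-1) \<union> ?L 29 \<union> ?L (-29) \<union> ?L 5 \<union> ?P 1 \<union> ?P (-1) \<union> ?Q"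
  show "density_zero ?B"
    by (intro density_zero_Un density_zero_linear_square density_zero_pell density_zero_finite
        finite_quadratic_square) auto
  show "- {\<kappa>. \<kappa> \<noteq> 4 \<and> generic_kappa \<kappa>} \<subseteq> ?B"
  proof
    fix k :: int assume "k \<in> - {\<kappa>. \<kappa> \<noteq> 4 \<and> generic_kappa \<kappa>}"
    hence "k = 4 \<or> \<not> generic_kappa k"
      by auto
    moreover have "k \<in> ?L 1" if "is_square (4 * k - 7)"
      using that by (auto elim: is_nth_powerE)
    moreover have "k \<in> ?L 1 \<union> ?L (-1) \<union> ?L 29 \<union> ?L (-29)"
      if sq: "is_square (rat_of_int (4 * k - 7) / rat_of_int (16 * k\<^sup>2 - 68 * k + 41))"
    proof -
      \<comment> \<open>In terms of 4 k - 7 the second number has constant term -29, which is where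
        the factor 29 comes from.\<close>
      have "16 * k\<^sup>2 - 68 * k + 41 = (4 * k - 7)\<^sup>2 - 3 * (4 * k - 7) - 29"
        by (simp add: power2_eq_square algebra_simps)
      hence "is_square ((4 * k - 7) * ((4 * k - 7)\<^sup>2 - 3 * (4 * k - 7) - 29))"
        using is_square_mult_of_ratio[OF sq odd_norm_factors(4)] by (simp only:)
      from linear_square_of_product[OF this] show ?thesis
        by auto
    qed
    moreover have "k \<in> ?L 5" if sq: "is_square (rat_of_int (4 * k - 7) / rat_of_int 5)"
    proof -
      obtain t where t: "(4 * k - 7) * 5 = t\<^sup>2"
        using is_square_mult_of_ratio[OF sq] by (auto elim: is_nth_powerE)
      have "5 dvd t"
        using t prime_dvd_power[of "5 :: int" t 2] by (metis dvd_triv_right prime_5_int)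
      then obtain s where "t = 5 * s" ..
      with t have "4 * k - 7 = 5 * s\<^sup>2"
        by (simp add: power2_eq_square)
      thus ?thesis
        by blast
    qed
    moreover have "k \<in> ?P 1 \<union> ?P (-1)"
      if sq: "is_square (rat_of_int (16 * k\<^sup>2 - 68 * k + 41) / rat_of_int 5)"
      using pell_of_quadratic_square[OF is_square_mult_of_ratio[OF sq]] by auto
    ultimately show "k \<in> ?B"
      using not_square_5 unfolding generic_kappa_def Let_def by blast
  qed
qed

theorem theorem5p1:
  shows "(\<forall>\<kappa> :: int. \<kappa> \<noteq> 4 \<longrightarrow>
            infinite (K33_primes \<kappa>) \<and>
            prime_density_at_least (K33_primes \<kappa>) (if \<kappa> = 2 then 1/4 else 1/2) \<and>
            (generic_kappa \<kappa> \<longrightarrow> prime_density_at_least (K33_primes \<kappa>) (5/8))) \<and>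
         int_density_one {\<kappa>. \<kappa> \<noteq> 4 \<and> generic_kappa \<kappa>}"
proof (intro conjI allI impI int_density_one_generic_kappa)
  fix \<kappa> :: int assume \<kappa>: "\<kappa> \<noteq> 4"
  show dens: "prime_density_at_least (K33_primes \<kappa>) (if \<kappa> = 2 then 1/4 else 1/2)"
    using K33_primes_density_half[OF \<kappa>] K33_primes_density_quarter by simp
  then show "infinite (K33_primes \<kappa>)"
    by (rule prime_density_pos_imp_infinite) simp
qed (rule K33_primes_density_generic)

end
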